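(* Let $t>0$, let $J\subseteq\Delta^d_n$ be an M-convex set, and let $f_J=\sum_{\alpha\in J}\frac{x^\alpha}{\alpha!}$. Then the triple $(\log(\mathrm{N}_t(f_J)),\log(\mathrm{L}_J),V_J)$ is strongly star-shaped.
   Context: $\Delta^d_n=\{\alpha\in\mathbb{Z}^n_{\ge0}:\sum\alpha_i=d\}$; $J$ is M-convex if nonempty and for all $\alpha,\beta\in J$, $i$ with $\alpha_i<\beta_i$ there is $j$ with $\alpha_j>\beta_j$ and $\alpha+e_i-e_j,\beta-e_i+e_j\in J$; $\delta^\pm_J$ are coordinatewise max/min over $J$. For a polynomial $f=\sum_{\alpha\in J}c_\alpha x^\alpha/\alpha!$ with all $c_\alpha>0$, $\log(f)=(\log c_\alpha)_{\alpha\in J}\in\mathbb{R}^J$. A nonzero homogeneous $f$ with nonnegative coefficients is Lorentzian if its support $\{\alpha:c_\alpha\ne0\}$ is M-convex and $\partial^\alpha f$ has Hessian with at most one positive eigenvalue for all $\alpha\in\Delta^{d-2}_n$. $\mathrm{L}_J$ is the set of Lorentzian polynomials with support $J$ and $\log(\mathrm{L}_J)=\{\log f:f\in\mathrm{L}_J\}$. $\mathrm{N}_t$ is the linear operator with $\mathrm{N}_t(x^\alpha)=x^\alpha/(\alpha!)^t$. A list $b_1,\dots,b_k\ge0$ is $\infty$-null if all are zero, or the maximum is attained at least twice, or at least three are nonzero. A strong $\mathbb{T}_\infty$-representation of $J$ is $\rho\colon\Delta^d_n\to\mathbb{R}_{\ge0}$ with support $J$ such that for all $2\le s\le d$, $\alpha\in\Delta^{d-s}_n$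 with $\delta^-_J\le\alpha$, $i_0\le\dots\le i_s$, $j_2\le\dots\le j_s$ with $\alpha+\sum e_{i_m}+\sum e_{j_m}\le\delta^+_J$, the numbers $\rho(\alpha+\sum_{m\ne k}e_{i_m})\rho(\alpha+e_{i_k}+e_{j_2}+\dots+e_{j_s})$, $k=0,\dots,s$, are $\infty$-null. $V_J=\{(\log\rho(\alpha))_{\alpha\in J}:\rho$ a strong $\mathbb{T}_\infty$-representation of $J\}$, a linear subspace of $\mathbb{R}^J$. A triple $(x_*,X,V)$ with $V$ a finite-dimensional real vector space, $X\subseteq V$, $x_*\in X$ is strongly star-shaped if $X$ is closed in $V$ and for every $x\in X$ and $t\in[0,1)$ the point $x_*+t(x-x_* )$ lies in the interior of $X$ relative to $V$. *)

theory Defs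
  imports
    "HOL-Analysis.Analysis"
    "HOL-Library.Poly_Mapping"
    "HOL-Library.Function_Algebras"
    "Jordan_Normal_Form.Char_Poly"
begin

(* Exponent vectors in Z_{>=0}^n are finitely supported maps on the indices 0, ..., n-1; polynomials
   are finitely supported maps from exponent vectors to coefficients, so that the library's + and *
   on this type are those of polynomials.  Caution: <= on the type expo is the library's
   lexicographic order; coordinatewise comparisons are therefore always made on
   "Poly_Mapping.lookup alpha", with the pointwise order on functions. *)

type_synonym expo = "nat \<Rightarrow>\<^sub>0 nat"
type_synonym rpoly = "expo \<Rightarrow>\<^sub>0 real"

abbreviation lkp :: "('a \<Rightarrow>\<^sub>0 'b::zero) \<Rightarrow> 'a \<Rightarrow> 'b"
  where "lkp \<equiv> Poly_Mapping.lookup"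

abbreviation supp :: "('a \<Rightarrow>\<^sub>0 'b::zero) \<Rightarrow> 'a set"
  where "supp \<equiv> Poly_Mapping.keys"

definition unit_expo :: "nat \<Rightarrow> expo"
  where "unit_expo i = Poly_Mapping.single i 1"

definition expo_fact :: "expo \<Rightarrow> real"
  where "expo_fact \<alpha> = (\<Prod>i\<in>supp \<alpha>. fact (lkp \<alpha> i))"

definition Delta :: "nat \<Rightarrow> nat \<Rightarrow> expo set"
  where "Delta n d = {\<alpha>. supp \<alpha> \<subseteq> {..<n} \<and> (\<Sum>i<n. lkp \<alpha> i) = d}"

(* The subtractions never truncate: the inequalities between alpha and beta force the i-th
   coordinate of beta and the j-th coordinate of alpha to be positive. *)
definition M_convex :: "expo set \<Rightarrow> bool"
  where "M_convex J \<longleftrightarrow> J \<noteq> {} \<and>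
    (\<forall>\<alpha>\<in>J. \<forall>\<beta>\<in>J. \<forall>i. lkp \<alpha> i < lkp \<beta> i \<longrightarrow>
      (\<exists>j. lkp \<alpha> j > lkp \<beta> j \<and>
           \<alpha> + unit_expo i - unit_expo j \<in> J \<and> \<beta> - unit_expo i + unit_expo j \<in> J))"

definition delta_plus :: "expo set \<Rightarrow> nat \<Rightarrow> nat"
  where "delta_plus J i = Max ((\<lambda>\<alpha>. lkp \<alpha> i) ` J)"

definition delta_minus :: "expo set \<Rightarrow> nat \<Rightarrow> nat"
  where "delta_minus J i = Min ((\<lambda>\<alpha>. lkp \<alpha> i) ` J)"

section \<open>Lorentzian polynomials\<close>

(* For alpha with i-th coordinate 0 the coefficient is 0, so truncation in the exponent is
   irrelevant. *)
definition partial_deriv :: "nat \<Rightarrow> rpoly \<Rightarrow> rpoly"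
  where "partial_deriv i f =
    (\<Sum>\<alpha>\<in>supp f. Poly_Mapping.single (\<alpha> - unit_expo i) (real (lkp \<alpha> i) * lkp f \<alpha>))"

definition multi_deriv :: "expo \<Rightarrow> rpoly \<Rightarrow> rpoly"
  where "multi_deriv \<alpha> f =
    fold (\<lambda>i. partial_deriv i ^^ lkp \<alpha> i) (sorted_list_of_set (supp \<alpha>)) f"

(* Hessian of a quadratic form: its second derivatives are constant polynomials, and an entry is
   the constant term of such a derivative. *)
definition hessian :: "nat \<Rightarrow> rpoly \<Rightarrow> real mat"
  where "hessian n q = mat n n (\<lambda>(i, j). lkp (partial_deriv i (partial_deriv j q)) 0)"

(* Eigenvalues are counted with (algebraic) multiplicity. *)
definition at_most_one_pos_eigenvalue :: "real mat \<Rightarrow> bool"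
  where "at_most_one_pos_eigenvalue A \<longleftrightarrow>
    (\<Sum>a | eigenvalue A a \<and> a > 0. Polynomial.order a (char_poly A)) \<le> 1"

(* For d < 2 there are no exponent vectors of degree d - 2, hence the guard on d. *)
definition Lorentzian :: "nat \<Rightarrow> nat \<Rightarrow> rpoly \<Rightarrow> bool"
  where "Lorentzian n d f \<longleftrightarrow>
    f \<noteq> 0 \<and> supp f \<subseteq> Delta n d \<and> (\<forall>\<alpha>. lkp f \<alpha> \<ge> 0) \<and> M_convex (supp f) \<and>
    (d \<ge> 2 \<longrightarrow> (\<forall>\<alpha>\<in>Delta n (d - 2).
      at_most_one_pos_eigenvalue (hessian n (multi_deriv \<alpha> f))))"

definition Lorentzian_supp :: "nat \<Rightarrow> nat \<Rightarrow> expo set \<Rightarrow> rpoly set"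
  where "Lorentzian_supp n d J = {f. Lorentzian n d f \<and> supp f = J}"

definition gen_poly :: "expo set \<Rightarrow> rpoly"
  where "gen_poly J = (\<Sum>\<alpha>\<in>J. Poly_Mapping.single \<alpha> (1 / expo_fact \<alpha>))"

definition N_op :: "real \<Rightarrow> rpoly \<Rightarrow> rpoly"
  where "N_op t f = (\<Sum>\<alpha>\<in>supp f. Poly_Mapping.single \<alpha> (lkp f \<alpha> / expo_fact \<alpha> powr t))"

section \<open>The space of real vectors indexed by J, and logarithms\<close>

(* For finite J, the space R^J is realised as the functions expo => real that vanish outside J.
   The product topology, which the library puts on function types, induces on it the usual
   topology of a finite-dimensional real vector space. *)

instantiation "fun" :: (type, real_vector) real_vector
begin

definition scaleR_fun :: "real \<Rightarrow> ('a \<Rightarrow> 'b) \<Rightarrow> 'a \<Rightarrow> 'b"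
  where "scaleR_fun c f = (\<lambda>x. c *\<^sub>R f x)"

instance
  by standard (simp_all add: scaleR_fun_def fun_eq_iff scaleR_add_right scaleR_add_left)

end

(* The coefficient c_alpha of f = sum c_alpha x^alpha / alpha! is alpha! times the coefficient of
   x^alpha. *)
definition log_coeffs :: "rpoly \<Rightarrow> expo \<Rightarrow> real"
  where "log_coeffs f = (\<lambda>\<alpha>. if \<alpha> \<in> supp f then ln (expo_fact \<alpha> * lkp f \<alpha>) else 0)"

section \<open>Strong representations over the tropical hyperfield with q = infinity\<close>

definition inf_null :: "real list \<Rightarrow> bool"
  where "inf_null bs \<longleftrightarrow>
    (\<forall>b\<in>set bs. b = 0) \<or>
    card {k. k < length bs \<and> bs ! k = Max (set bs)} \<ge> 2 \<or>
    card {k. k < length bs \<and> bs ! k \<noteq> 0} \<ge> 3"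

(* A function on Delta n d is a function on all exponent vectors whose values outside Delta n d are
   ignored. The index sequences are i_0, ..., i_s and j_2, ..., j_s, with values in {0, ..., n-1}. *)
definition strong_rep :: "nat \<Rightarrow> nat \<Rightarrow> expo set \<Rightarrow> (expo \<Rightarrow> real) \<Rightarrow> bool"
  where "strong_rep n d J \<rho> \<longleftrightarrow>
    (\<forall>\<alpha>\<in>Delta n d. \<rho> \<alpha> \<ge> 0) \<and> {\<alpha>\<in>Delta n d. \<rho> \<alpha> \<noteq> 0} = J \<and>
    (\<forall>s \<alpha> i j. 2 \<le> s \<and> s \<le> d \<and> \<alpha> \<in> Delta n (d - s) \<and> delta_minus J \<le> lkp \<alpha> \<and>
       i ` {0..s} \<subseteq> {..<n} \<and> mono_on {0..s} i \<and>
       j ` {2..s} \<subseteq> {..<n} \<and> mono_on {2..s} j \<and>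
       lkp (\<alpha> + (\<Sum>m\<in>{0..s}. unit_expo (i m)) + (\<Sum>m\<in>{2..s}. unit_expo (j m))) \<le> delta_plus J
       \<longrightarrow> inf_null (map (\<lambda>k.
             \<rho> (\<alpha> + (\<Sum>m\<in>{0..s} - {k}. unit_expo (i m))) *
             \<rho> (\<alpha> + unit_expo (i k) + (\<Sum>m\<in>{2..s}. unit_expo (j m)))) [0..<Suc s]))"

definition V_space :: "nat \<Rightarrow> nat \<Rightarrow> expo set \<Rightarrow> (expo \<Rightarrow> real) set"
  where "V_space n d J =
    {(\<lambda>\<alpha>. if \<alpha> \<in> J then ln (\<rho> \<alpha>) else 0) | \<rho>. strong_rep n d J \<rho>}"

section \<open>Strongly star-shaped triples\<close>

(* Meant for subspaces V of a Hausdorff topological vector space, where the induced topology is the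
   usual one on V since V is finite-dimensional.  That V is a vector space and that x0 and X lie
   in V is part of the notion of such a triple and therefore of what is asserted. *)
definition strongly_star_shaped ::
    "'v::{real_vector, topological_space} \<Rightarrow> 'v set \<Rightarrow> 'v set \<Rightarrow> bool"
  where "strongly_star_shaped x0 X V \<longleftrightarrow>
    subspace V \<and> (\<exists>B. finite B \<and> V = span B) \<and> X \<subseteq> V \<and> x0 \<in> X \<and>
    closedin (top_of_set V) X \<and>
    (\<forall>x\<in>X. \<forall>t\<in>{0..<1}. x0 + t *\<^sub>R (x - x0) \<in> (top_of_set V) interior_of X)"

end

theory Submission
  imports Defs "Jordan_Normal_Form.Schur_Decomposition"
begin

text \<open>
  Write \<open>f = \<Sum> c_\<beta> x^\<beta> / \<beta>!\<close>. The Hessian of \<open>\<partial>^\<alpha> f\<close> is the matrix \<open>c_(\<alpha> + e_i + e_j)\<close>, and it has at most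
  one positive eigenvalue iff its quadratic form is nonpositive on a hyperplane. For matrices with
  nonnegative entries this is a closed condition by the reverse Cauchy-Schwarz inequality.

  The space \<open>V_J\<close> is cut out by the equations \<open>v_ex + v_fy = v_fx + v_ey\<close> coming from the three-term
  relations with a vanishing term; an induction on the distance of the exponents shows that they imply
  all longer relations with exactly two nonzero terms. For a Lorentzian polynomial they hold because
  parallel rows of a Hessian differ by an isotropic vector orthogonal to a positive one.

  If \<open>Q\<close> is a nonnegative matrix with at most one positive eigenvalue, then after rescaling
  \<open>Q = 1 - M\<close> entrywise with \<open>M\<close> positive semidefinite. The binomial series of \<open>(1 - M)^\<theta>\<close> and the Schur product
  theorem show that the entrywise power \<open>Q^\<theta>\<close> is negative semidefinite on a hyperplane, and that for
  \<open>0 < \<theta> < 1\<close>, restricted to representatives of the parallel classes, its isotropic vectors there are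
  supported where the diagonal of \<open>Q\<close> is positive. Moving towards \<open>log (N_t f_J)\<close> multiplies the
  diagonal by factors less than 1, so that the form becomes negative definite. This is stable under small perturbations, and a vector of \<open>V_J\<close> is determined up to
  proportional rows by the entries at the representatives.
\<close>

section \<open>Quadratic forms that are nonpositive on a hyperplane\<close>

text \<open>Why representatives are needed: a nonzero Hessian with two parallel rows has a positive
  vector and a kernel vector, so it is negative definite on no hyperplane. Strictness can therefore
  hold only on one index per parallel class, and openness only inside \<open>V_space\<close>, where
  perturbations keep parallel rows parallel. Why isotropic vectors avoid zero diagonal entries:
  lowering the diagonal gains nothing where \<open>Q i i = 0\<close>. If the form of the power
  vanishes, then so do the forms of all entrywise powers of M, hence of all entrywise polynomials in
  M. Off-diagonal entries of M are less than 1 and \<open>Q i i = 0\<close> gives the diagonal entry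
  1, so a polynomial can tell the two apart. Where the rescaling comes from: reverse Cauchy-Schwarz
  against the all-ones vector, which has positive value as soon as a matrix with nonnegative entries
  is nonzero.\<close>

definition bil_form :: "'a set \<Rightarrow> ('a \<Rightarrow> 'a \<Rightarrow> real) \<Rightarrow> ('a \<Rightarrow> real) \<Rightarrow> ('a \<Rightarrow> real) \<Rightarrow> real"
  where "bil_form N Q x y = (\<Sum>i\<in>N. \<Sum>j\<in>N. Q i j * x i * y j)"

text \<open>\<open>h\<close> may vanish on \<open>N\<close>, so negative semidefinite forms are
  included: this is "at most one positive eigenvalue" without any mention of eigenvectors.\<close>

definition hyperbolic :: "'a set \<Rightarrow> ('a \<Rightarrow> 'a \<Rightarrow> real) \<Rightarrow> bool"
  where "hyperbolic N Q \<longleftrightarrow>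
    (\<exists>h. \<forall>x. (\<Sum>i\<in>N. h i * x i) = 0 \<longrightarrow> bil_form N Q x x \<le> 0)"

definition strictly_hyperbolic :: "'a set \<Rightarrow> ('a \<Rightarrow> 'a \<Rightarrow> real) \<Rightarrow> bool"
  where "strictly_hyperbolic N Q \<longleftrightarrow>
    (\<exists>h. \<forall>x. (\<Sum>i\<in>N. h i * x i) = 0 \<longrightarrow> (\<exists>i\<in>N. x i \<noteq> 0) \<longrightarrow> bil_form N Q x x < 0)"

definition psd :: "'a set \<Rightarrow> ('a \<Rightarrow> 'a \<Rightarrow> real) \<Rightarrow> bool"
  where "psd N M \<longleftrightarrow> (\<forall>x. bil_form N M x x \<ge> 0)"

lemma bil_form_add_left:
  "bil_form N Q (\<lambda>i. x i + c * y i) z = bil_form N Q x z + c * bil_form N Q y z"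
  by (simp add: bil_form_def algebra_simps sum.distrib sum_distrib_left)

lemma bil_form_add_right:
  "bil_form N Q z (\<lambda>i. x i + c * y i) = bil_form N Q z x + c * bil_form N Q z y"
  by (simp add: bil_form_def algebra_simps sum.distrib sum_distrib_left)

lemma bil_form_commute:
  assumes "\<And>i j. i \<in> N \<Longrightarrow> j \<in> N \<Longrightarrow> Q i j = Q j i"
  shows "bil_form N Q x y = bil_form N Q y x"
  unfolding bil_form_def
  by (subst sum.swap) (intro sum.cong refl, simp add: assms)

lemma bil_form_cong:
  assumes "\<And>i j. i \<in> N \<Longrightarrow> j \<in> N \<Longrightarrow> Q i j * x i * y j = Q' i j * x' i * y' j"
  shows "bil_form N Q x y = bil_form N Q' x' y'"
  unfolding bil_form_def by (intro sum.cong refl assms)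

lemma bil_form_scale:
  "bil_form N Q (\<lambda>i. c * x i) (\<lambda>i. d * y i) = c * d * bil_form N Q x y"
  by (simp add: bil_form_def sum_distrib_left algebra_simps)

lemma bil_form_sum:
  "bil_form N (\<lambda>i j. \<Sum>k\<in>A. c k * F k i j) x y = (\<Sum>k\<in>A. c k * bil_form N (F k) x y)"
  by (induction A rule: infinite_finite_induct)
    (simp_all add: bil_form_def algebra_simps sum.distrib sum_distrib_left)

lemma bil_form_indicator:
  assumes "finite N" "a \<in> N" "b \<in> N"
  shows "bil_form N Q (\<lambda>i. of_bool (i = a)) (\<lambda>i. of_bool (i = b)) = Q a b"
  using assms by (simp add: bil_form_def of_bool_def sum.delta if_distrib [of "\<lambda>t. _ * t"] cong: if_cong)

lemma bil_form_restrict: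
  assumes "finite N" "R \<subseteq> N" "\<And>i. i \<in> N - R \<Longrightarrow> x i = 0" "\<And>i. i \<in> N - R \<Longrightarrow> y i = 0"
  shows "bil_form N Q x y = bil_form R Q x y"
proof -
  have "bil_form N Q x y = (\<Sum>i\<in>R. \<Sum>j\<in>N. Q i j * x i * y j)"
    unfolding bil_form_def using assms by (intro sum.mono_neutral_right) auto
  also have "\<dots> = bil_form R Q x y"
    unfolding bil_form_def using assms by (intro sum.cong refl sum.mono_neutral_right) auto
  finally show ?thesis .
qed

lemma hyperbolic_subset:
  assumes "hyperbolic N Q" "finite N" "R \<subseteq> N"
  shows "hyperbolic R Q"
proof -
  obtain h where h: "\<And>x. (\<Sum>i\<in>N. h i * x i) = 0 \<Longrightarrow> bil_form N Q x x \<le> 0"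
    using assms unfolding hyperbolic_def by blast
  have "bil_form R Q x x \<le> 0" if "(\<Sum>i\<in>R. h i * x i) = 0" for x
  proof -
    define y where "y = (\<lambda>i. if i \<in> R then x i else 0)"
    have "(\<Sum>i\<in>N. h i * y i) = (\<Sum>i\<in>R. h i * y i)"
      using assms by (intro sum.mono_neutral_right) (auto simp: y_def)
    also have "\<dots> = 0" using that by (simp add: y_def)
    finally have "bil_form N Q y y \<le> 0" by (rule h)
    also have "bil_form N Q y y = bil_form R Q y y"
      using assms by (intro bil_form_restrict) (auto simp: y_def)
    also have "\<dots> = bil_form R Q x x" by (intro bil_form_cong) (simp add: y_def)
    finally show ?thesis .
  qed
  then show ?thesis unfolding hyperbolic_def by blast
qed

text \<open>A vector \<open>w\<close> of positive value lies off the hyperplane, so \<open>x\<close>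
  can be moved along \<open>w\<close> onto it; nonpositivity there gives the inequality after
  completing the square.\<close>

lemma hyperbolic_reverse_Cauchy_Schwarz:
  assumes "hyperbolic N Q" and sym: "\<And>i j. i \<in> N \<Longrightarrow> j \<in> N \<Longrightarrow> Q i j = Q j i"
    and w: "bil_form N Q w w > 0"
  shows "bil_form N Q x x * bil_form N Q w w \<le> (bil_form N Q x w)\<^sup>2"
proof -
  obtain h where h: "\<And>x. (\<Sum>i\<in>N. h i * x i) = 0 \<Longrightarrow> bil_form N Q x x \<le> 0"
    using assms unfolding hyperbolic_def by blast
  define c where "c = (\<Sum>i\<in>N. h i * x i) / (\<Sum>i\<in>N. h i * w i)"
  have "(\<Sum>i\<in>N. h i * w i) \<noteq> 0" using h [of w] w by auto
  have "(\<Sum>i\<in>N. h i * (x i + - c * w i)) = 0"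
  proof -
    have "(\<Sum>i\<in>N. h i * (x i + - c * w i)) = (\<Sum>i\<in>N. h i * x i) - c * (\<Sum>i\<in>N. h i * w i)"
      by (simp add: ring_distribs sum_subtractf sum_distrib_left mult.left_commute)
    then show ?thesis using \<open>(\<Sum>i\<in>N. h i * w i) \<noteq> 0\<close> by (simp add: c_def)
  qed
  then have "bil_form N Q (\<lambda>i. x i + - c * w i) (\<lambda>i. x i + - c * w i) \<le> 0" by (rule h)
  also have "bil_form N Q (\<lambda>i. x i + - c * w i) (\<lambda>i. x i + - c * w i)
      = bil_form N Q x x - 2 * c * bil_form N Q x w + c\<^sup>2 * bil_form N Q w w"
    unfolding bil_form_add_left bil_form_add_right
    by (simp add: bil_form_commute [of N Q w x, OF sym] power2_eq_square algebra_simps)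
  finally have "bil_form N Q x x \<le> 2 * c * bil_form N Q x w - c\<^sup>2 * bil_form N Q w w" by simp
  then have "bil_form N Q x x * bil_form N Q w w
      \<le> (2 * c * bil_form N Q x w - c\<^sup>2 * bil_form N Q w w) * bil_form N Q w w"
    using w by (intro mult_right_mono) auto
  also have "\<dots> = (bil_form N Q x w)\<^sup>2 - (bil_form N Q x w - c * bil_form N Q w w)\<^sup>2"
    by (simp add: power2_eq_square algebra_simps)
  also have "\<dots> \<le> (bil_form N Q x w)\<^sup>2" by simp
  finally show ?thesis .
qed

text \<open>The all-ones vector has positive value unless \<open>Q\<close> is zero, so it can always
  play the part of \<open>w\<close>, and its \<open>Q\<close>-orthogonal complement that of the
  hyperplane. The existential \<open>h\<close> gives way to inequalities continuous in
  \<open>Q\<close>.\<close>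

lemma hyperbolic_iff_closed_condition:
  assumes "finite N" and sym: "\<And>i j. i \<in> N \<Longrightarrow> j \<in> N \<Longrightarrow> Q i j = Q j i"
    and nonneg: "\<And>i j. i \<in> N \<Longrightarrow> j \<in> N \<Longrightarrow> Q i j \<ge> 0"
  shows "hyperbolic N Q \<longleftrightarrow> (\<forall>x. bil_form N Q x x * bil_form N Q (\<lambda>_. 1) (\<lambda>_. 1)
           \<le> (bil_form N Q x (\<lambda>_. 1))\<^sup>2)" (is "_ \<longleftrightarrow> ?C")
proof -
  have ge0: "bil_form N Q (\<lambda>_. 1) (\<lambda>_. 1) \<ge> 0"
    unfolding bil_form_def by (auto intro!: sum_nonneg nonneg)
  show ?thesis
  proof (cases "bil_form N Q (\<lambda>_. 1) (\<lambda>_. 1) = 0")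
    case True
    have "Q i j = 0" if "i \<in> N" "j \<in> N" for i j
      using True that assms(1)
      by (auto simp: bil_form_def sum_nonneg_eq_0_iff sum_nonneg nonneg)
    then have "bil_form N Q x x = 0" for x by (simp add: bil_form_def)
    then show ?thesis by (simp add: hyperbolic_def)
  next
    case False
    show ?thesis
    proof
      assume "hyperbolic N Q"
      then show ?C using hyperbolic_reverse_Cauchy_Schwarz [of N Q, OF _ sym] False ge0 by simp
    next
      assume C: ?C
      have "bil_form N Q x x \<le> 0" if "(\<Sum>i\<in>N. (\<Sum>j\<in>N. Q i j) * x i) = 0" for x
      proof -
        have "bil_form N Q x (\<lambda>_. 1) = 0"
          using that by (simp add: bil_form_def sum_distrib_right)
        then show ?thesis
          using C [rule_format, of x] False ge0 by (simp add: mult_le_0_iff)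
      qed
      then show "hyperbolic N Q"
        unfolding hyperbolic_def by (intro exI [of _ "\<lambda>i. \<Sum>j\<in>N. Q i j"]) blast
    qed
  qed
qed

text \<open>The isotropic vector \<open>Q f x \<cdot> e - Q e x \<cdot> f\<close> is orthogonal to the positive vector \<open>x + e\<close>, hence
  lies in the kernel of the form.\<close>
lemma hyperbolic_proportional:
  assumes "hyperbolic N Q" "finite N" and sym: "\<And>i j. i \<in> N \<Longrightarrow> j \<in> N \<Longrightarrow> Q i j = Q j i"
    and N: "e \<in> N" "f \<in> N" "x \<in> N" "y \<in> N"
    and zero: "Q e e = 0" "Q f f = 0" "Q e f = 0" and pos: "Q e x > 0" "Q x x \<ge> 0"
  shows "Q e x * Q f y = Q f x * Q e y"
proof (rule ccontr)
  assume ne: "Q e x * Q f y \<noteq> Q f x * Q e y"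
  let ?d = "\<lambda>a i. of_bool (i = a) :: real" and ?B = "bil_form N Q"
  \<comment> \<open>The isotropic vector perturbed in direction \<open>y\<close>; the leading 0
    gives it the shape that \<open>bil_form_add_left\<close> expands. Its value has the linear
    coefficient \<open>2 * D\<close>, while its product with \<open>w\<close> is only of order
    \<open>t\<close>.\<close>
  define z where "z = (\<lambda>t i. (\<lambda>i. (\<lambda>i. 0 + Q f x * ?d e i) i + - Q e x * ?d f i) i + t * ?d y i)"
  define w where "w = (\<lambda>i. ?d x i + 1 * ?d e i)"
  have zero_left: "?B (\<lambda>_. 0) v = 0" "?B v (\<lambda>_. 0) = 0" for v
    by (simp_all add: bil_form_def)
  note simps = bil_form_add_left bil_form_add_right bil_form_indicator assms(2) N zero zero_left
    sym [of f e] sym [of x e] sym [of x f] sym [of y e] sym [of y f]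
  define D where "D = Q f x * Q e y - Q e x * Q f y"
  define W where "W = Q x x + 2 * Q e x"
  define C where "C = Q y x + Q e y"
  have W: "W > 0" using pos by (simp add: W_def)
  have "D \<noteq> 0" using ne by (simp add: D_def)
  have ww: "?B w w = W"
    unfolding w_def W_def by (simp only: simps) (simp add: simps)
  have zz: "?B (z t) (z t) = 2 * t * D + t\<^sup>2 * Q y y" for t
    unfolding z_def D_def by (simp only: simps) (simp add: simps algebra_simps power2_eq_square)
  have zw: "?B (z t) w = t * C" for t
    unfolding z_def w_def C_def by (simp only: simps) (simp add: simps algebra_simps)
  have ineq: "(2 * t * D + t\<^sup>2 * Q y y) * W \<le> (t * C)\<^sup>2" for t
    using hyperbolic_reverse_Cauchy_Schwarz [of N Q w "z t", OF assms(1) sym] W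
    by (simp add: ww zz zw)
  \<comment> \<open>So small that the quadratic terms contribute at most \<open>W\<close>, against
    \<open>2 * W\<close> from the linear one. Setting \<open>t = s * D\<close> below turns the
    factor \<open>D\<close> of the linear term into \<open>D\<^sup>2\<close>.\<close>
  define s where "s = W / (\<bar>Q y y\<bar> * W + C\<^sup>2 + 1)"
  have den: "\<bar>Q y y\<bar> * W + C\<^sup>2 + 1 > 0" using W by (intro add_nonneg_pos) auto
  then have s: "s > 0" using W by (simp add: s_def)
  have "(2 * s * D\<^sup>2 + s\<^sup>2 * D\<^sup>2 * Q y y) * W \<le> s\<^sup>2 * D\<^sup>2 * C\<^sup>2"
    using ineq [of "s * D"] by (simp add: power2_eq_square algebra_simps)
  then have "(s * D\<^sup>2) * (2 * W) \<le> (s * D\<^sup>2) * (s * (C\<^sup>2 - Q y y * W))"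
    by (simp add: power2_eq_square algebra_simps)
  then have "2 * W \<le> s * (C\<^sup>2 - Q y y * W)"
    using s \<open>D \<noteq> 0\<close> by (simp add: mult_le_cancel_left_pos)
  also have "\<dots> \<le> s * (\<bar>Q y y\<bar> * W + C\<^sup>2 + 1)"
  proof (intro mult_left_mono)
    have "- Q y y * W \<le> \<bar>Q y y\<bar> * W" using W by (intro mult_right_mono) auto
    then show "C\<^sup>2 - Q y y * W \<le> \<bar>Q y y\<bar> * W + C\<^sup>2 + 1" by simp
  qed (use s in auto)
  also have "\<dots> = W" using den by (simp add: s_def)
  finally show False using W by simp
qed

text \<open>Congruence by the matrix that sends the basis vector \<open>i\<close> to
  \<open>l i\<close> times the basis vector \<open>r i\<close>. Zero rows are encoded by
  \<open>l i = 0\<close>, and then \<open>r i\<close> may lie outside \<open>R\<close>.\<close>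

lemma bil_form_pullback:
  assumes "finite N" "finite R"
    and r: "\<And>i. i \<in> N \<Longrightarrow> l i \<noteq> 0 \<Longrightarrow> r i \<in> R"
    and Q: "\<And>i j. i \<in> N \<Longrightarrow> j \<in> N \<Longrightarrow> Q i j = l i * l j * Q (r i) (r j)"
  shows "bil_form N Q x x = bil_form R Q (\<lambda>s. \<Sum>i\<in>{i\<in>N. r i = s}. l i * x i)
           (\<lambda>s. \<Sum>i\<in>{i\<in>N. r i = s}. l i * x i)"
proof -
  have col: "(\<Sum>i\<in>N. l i * x i * g (r i)) = (\<Sum>s\<in>R. (\<Sum>i\<in>{i\<in>N. r i = s}. l i * x i) * g s)" for g
  proof -
    let ?L = "{i \<in> N. l i \<noteq> 0}"
    have "(\<Sum>i\<in>N. l i * x i * g (r i)) = (\<Sum>i\<in>?L. l i * x i * g (r i))"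
      using assms(1) by (intro sum.mono_neutral_right) auto
    also have "\<dots> = (\<Sum>s\<in>R. \<Sum>i\<in>{i\<in>?L. r i = s}. l i * x i * g (r i))"
      using assms(1,2) r by (intro sum.group [symmetric]) auto
    also have "\<dots> = (\<Sum>s\<in>R. (\<Sum>i\<in>{i\<in>N. r i = s}. l i * x i) * g s)"
    proof (intro sum.cong refl)
      fix s
      have "(\<Sum>i\<in>{i\<in>?L. r i = s}. l i * x i * g (r i)) = (\<Sum>i\<in>{i\<in>N. r i = s}. l i * x i * g (r i))"
        using assms(1) by (intro sum.mono_neutral_left) auto
      then show "(\<Sum>i\<in>{i\<in>?L. r i = s}. l i * x i * g (r i)) = (\<Sum>i\<in>{i\<in>N. r i = s}. l i * x i) * g s"
        by (simp add: sum_distrib_right)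
    qed
    finally show ?thesis .
  qed
  have "bil_form N Q x x = (\<Sum>i\<in>N. l i * x i * (\<Sum>j\<in>N. l j * x j * Q (r i) (r j)))"
    unfolding bil_form_def sum_distrib_left by (intro sum.cong refl) (simp add: Q mult_ac)
  also have "\<dots> = (\<Sum>s\<in>R. (\<Sum>i\<in>{i\<in>N. r i = s}. l i * x i) * (\<Sum>j\<in>N. l j * x j * Q s (r j)))"
    by (rule col [of "\<lambda>s. \<Sum>j\<in>N. l j * x j * Q s (r j)"])
  also have "\<dots> = bil_form R Q (\<lambda>s. \<Sum>i\<in>{i\<in>N. r i = s}. l i * x i)
           (\<lambda>s. \<Sum>i\<in>{i\<in>N. r i = s}. l i * x i)"
    unfolding bil_form_def col sum_distrib_left [of "sum _ _"]
    by (intro sum.cong refl) (simp add: mult_ac)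
  finally show ?thesis .
qed

lemma hyperbolic_pullback:
  assumes "finite N" "finite R"
    and r: "\<And>i. i \<in> N \<Longrightarrow> l i \<noteq> 0 \<Longrightarrow> r i \<in> R"
    and Q: "\<And>i j. i \<in> N \<Longrightarrow> j \<in> N \<Longrightarrow> Q i j = l i * l j * Q (r i) (r j)"
    and "hyperbolic R Q"
  shows "hyperbolic N Q"
proof -
  obtain h where h: "\<And>x. (\<Sum>i\<in>R. h i * x i) = 0 \<Longrightarrow> bil_form R Q x x \<le> 0"
    using assms unfolding hyperbolic_def by blast
  have "bil_form N Q x x \<le> 0" if "(\<Sum>i\<in>N. (l i * h (r i)) * x i) = 0" for x
  proof -
    let ?L = "{i \<in> N. l i \<noteq> 0}"
    have "(\<Sum>s\<in>R. h s * (\<Sum>i\<in>{i\<in>N. r i = s}. l i * x i))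
        = (\<Sum>s\<in>R. \<Sum>i\<in>{i\<in>?L. r i = s}. (l i * h (r i)) * x i)"
      unfolding sum_distrib_left using assms(1)
      by (intro sum.cong refl sum.mono_neutral_cong_right) auto
    also have "\<dots> = (\<Sum>i\<in>?L. (l i * h (r i)) * x i)"
      using assms(1,2) r by (intro sum.group) auto
    also have "\<dots> = (\<Sum>i\<in>N. (l i * h (r i)) * x i)"
      using assms(1) by (intro sum.mono_neutral_left) auto
    finally have "(\<Sum>s\<in>R. h s * (\<Sum>i\<in>{i\<in>N. r i = s}. l i * x i)) = 0" using that by simp
    from h [OF this] show ?thesis
      using bil_form_pullback [where Q = Q and l = l and r = r, OF assms(1,2) r Q] by simp
  qed
  then show ?thesis
    unfolding hyperbolic_def by (intro exI [of _ "\<lambda>i. l i * h (r i)"]) blast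
qed

section \<open>Hadamard products and powers of positive semidefinite matrices\<close>

lemma psd_diag: "psd N M \<Longrightarrow> finite N \<Longrightarrow> i \<in> N \<Longrightarrow> M i i \<ge> 0"
  using bil_form_indicator [of N i i M] unfolding psd_def by metis

text \<open>Cauchy-Schwarz, by testing on the basis vector \<open>j\<close> plus \<open>t\<close>
  times the basis vector \<open>i\<close> and minimising over \<open>t\<close>.\<close>

lemma psd_entry_square_le:
  assumes "psd N M" "finite N" and sym: "\<And>i j. i \<in> N \<Longrightarrow> j \<in> N \<Longrightarrow> M i j = M j i"
    and "i \<in> N" "j \<in> N"
  shows "(M i j)\<^sup>2 \<le> M i i * M j j"
proof -
  have ge: "M j j + 2 * t * M i j + t\<^sup>2 * M i i \<ge> 0" for t
  proof -
    let ?v = "\<lambda>k. of_bool (k = j) + t * of_bool (k = i) :: real"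
    have "0 \<le> bil_form N M ?v ?v" using assms(1) by (simp add: psd_def)
    also have "\<dots> = M j j + 2 * t * M i j + t\<^sup>2 * M i i"
      by (simp only: bil_form_add_left bil_form_add_right bil_form_indicator assms)
        (simp add: sym [of j i] assms power2_eq_square algebra_simps)
    finally show ?thesis .
  qed
  show ?thesis
  proof (cases "M i i = 0")
    case True
    have "M i j = 0"
    proof (rule ccontr)
      assume "M i j \<noteq> 0"
      \<comment> \<open>With \<open>M i i = 0\<close> the expression is affine in \<open>t\<close>;
        here it takes the value -1.\<close>
      with ge [of "- (M j j + 1) / (2 * M i j)"] True show False by (simp add: field_simps)
    qed
    with True show ?thesis by simp
  next
    case False
    then have pos: "M i i > 0" using psd_diag [OF assms(1,2,4)] by simp
    have "0 \<le> M j j + 2 * (- M i j / M i i) * M i j + (- M i j / M i i)\<^sup>2 * M i i" by (rule ge)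
    also have "\<dots> = M j j - (M i j)\<^sup>2 / M i i"
      using pos by (simp add: field_simps power2_eq_square)
    finally show ?thesis using pos by (simp add: field_simps)
  qed
qed

text \<open>One Cholesky step per index: subtracting the rank-one matrix \<open>b i * b j\<close>
  clears row and column \<open>a\<close>, and the Schur complement left on \<open>N\<close> is again
  positive semidefinite.\<close>

lemma psd_Gram:
  assumes "finite N" "psd N M" "\<And>i j. i \<in> N \<Longrightarrow> j \<in> N \<Longrightarrow> M i j = M j i"
  shows "\<exists>bs. \<forall>i\<in>N. \<forall>j\<in>N. M i j = (\<Sum>b\<leftarrow>bs. b i * b j)"
  using assms
proof (induction N arbitrary: M rule: finite_induct)
  case empty
  then show ?case by simp
next
  case (insert a N)
  note sym = insert.prems(2)
  \<comment> \<open>If \<open>M a a = 0\<close>, division by zero makes \<open>b\<close> zero, as it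
    should be: row \<open>a\<close> of \<open>M\<close> vanishes as well.\<close>
  define b where "b = (\<lambda>i. M a i / sqrt (M a a))"
  define M' where "M' = (\<lambda>i j. M i j - b i * b j)"
  have Maa: "M a a \<ge> 0" using psd_diag [OF insert.prems(1)] insert.hyps by simp
  have b_a: "b a * b j = M a j" if "j \<in> insert a N" for j
  proof (cases "M a a = 0")
    case True
    then show ?thesis
      using psd_entry_square_le [of "insert a N" M a j, OF insert.prems(1) _ sym] insert.hyps that
      by (simp add: b_def)
  next
    case False
    then show ?thesis using Maa by (simp add: b_def)
  qed
  have "bil_form N M' x x \<ge> 0" for x
  proof -
    define S where "S = (\<Sum>i\<in>N. M a i * x i)"
    \<comment> \<open>The value at \<open>a\<close> that minimises the form, so that
      \<open>M\<close> at \<open>y\<close> equals \<open>M'\<close> at \<open>x\<close>. If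
      \<open>M a a = 0\<close> it is 0.\<close>
    define y where "y = x(a := - S / M a a)"
    have x: "x i = y i" if "i \<in> N" for i using that insert.hyps by (auto simp: y_def)
    have *: "(\<Sum>i\<in>N. M a i * y i) = S" unfolding S_def by (intro sum.cong refl) (simp add: x)
    have **: "(\<Sum>i\<in>N. M i a * y i) = S"
      unfolding *[symmetric] by (intro sum.cong refl) (simp add: sym)
    have "(\<Sum>i\<in>N. b i * x i) = S / sqrt (M a a)"
      unfolding b_def S_def sum_divide_distrib by simp
    moreover have "bil_form N M' x x = bil_form N M x x - (\<Sum>i\<in>N. b i * x i)\<^sup>2"
      unfolding bil_form_def M'_def power2_eq_square sum_product
      by (simp add: algebra_simps sum_subtractf)
    ultimately have "bil_form N M' x x = bil_form N M x x - S\<^sup>2 / M a a"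
      using Maa by (simp add: power_divide)
    moreover have "bil_form (insert a N) M y y
        = M a a * y a * y a + (\<Sum>i\<in>N. M a i * y i) * y a + (\<Sum>i\<in>N. M i a * y i) * y a + bil_form N M y y"
      unfolding bil_form_def using insert.hyps
      by (simp add: sum.distrib sum_distrib_left sum_distrib_right mult_ac)
    moreover have "bil_form N M y y = bil_form N M x x" by (intro bil_form_cong) (simp add: x)
    moreover have "y a = - S / M a a" by (simp add: y_def)
    moreover have "bil_form (insert a N) M y y \<ge> 0" using insert.prems by (simp add: psd_def)
    ultimately show ?thesis
      unfolding * ** by (cases "M a a = 0") (simp_all add: power2_eq_square)
  qed
  then have "psd N M'" by (simp add: psd_def)
  moreover have "M' i j = M' j i" if "i \<in> N" "j \<in> N" for i j
    using sym that by (simp add: M'_def)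
  ultimately obtain bs where bs: "\<And>i j. i \<in> N \<Longrightarrow> j \<in> N \<Longrightarrow> M' i j = (\<Sum>b\<leftarrow>bs. b i * b j)"
    using insert.IH [of M'] by blast
  define cs where "cs = map (\<lambda>b i. if i = a then 0 else b i) bs"
  have zero: "(\<Sum>b\<leftarrow>cs. b a * b i) = 0" "(\<Sum>b\<leftarrow>cs. b i * b a) = 0" for i
    by (simp_all add: cs_def o_def)
  have other: "(\<Sum>b\<leftarrow>cs. b i * b j) = M' i j" if "i \<in> N" "j \<in> N" for i j
  proof -
    have "i \<noteq> a" "j \<noteq> a" using that insert.hyps by auto
    then show ?thesis using bs [OF that] by (simp add: cs_def o_def)
  qed
  have "M i j = (\<Sum>b\<leftarrow>b # cs. b i * b j)" if "i \<in> insert a N" "j \<in> insert a N" for i j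
  proof -
    consider "i = a" | "i \<in> N" "j = a" | "i \<in> N" "j \<in> N" using \<open>i \<in> _\<close> \<open>j \<in> _\<close> by auto
    then show ?thesis
    proof cases
      case 1
      then show ?thesis using b_a that zero by simp
    next
      case 2
      then show ?thesis using b_a [of i] sym [of i j] zero by (simp add: mult.commute [of "b i"])
    next
      case 3
      then show ?thesis using other by (simp add: M'_def)
    qed
  qed
  then show ?case by blast
qed

text \<open>Each Gram vector \<open>b\<close> of \<open>M\<close> contributes the form of
  \<open>A\<close> at the vector with entries \<open>b i * x i\<close>.\<close>

lemma Schur_product_theorem:
  assumes "finite N" "psd N M" "\<And>i j. i \<in> N \<Longrightarrow> j \<in> N \<Longrightarrow> M i j = M j i" "psd N A"
  shows "psd N (\<lambda>i j. M i j * A i j)"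
proof -
  obtain bs where bs: "\<And>i j. i \<in> N \<Longrightarrow> j \<in> N \<Longrightarrow> M i j = (\<Sum>b\<leftarrow>bs. b i * b j)"
    using psd_Gram [OF assms(1-3)] by blast
  have "bil_form N (\<lambda>i j. M i j * A i j) x x \<ge> 0" for x
  proof -
    have "bil_form N (\<lambda>i j. M i j * A i j) x x
        = bil_form N (\<lambda>i j. (\<Sum>b\<leftarrow>bs. b i * b j) * A i j) x x"
      by (intro bil_form_cong) (simp add: bs)
    also have "\<dots> = (\<Sum>b\<leftarrow>bs. bil_form N A (\<lambda>i. b i * x i) (\<lambda>i. b i * x i))"
      by (induction bs) (simp_all add: bil_form_def algebra_simps sum.distrib)
    also have "\<dots> \<ge> 0" using assms(4) by (intro sum_list_nonneg) (auto simp: psd_def)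
    finally show ?thesis .
  qed
  then show ?thesis by (simp add: psd_def)
qed

lemma psd_power:
  assumes "finite N" "psd N M" "\<And>i j. i \<in> N \<Longrightarrow> j \<in> N \<Longrightarrow> M i j = M j i"
  shows "psd N (\<lambda>i j. M i j ^ k)"
proof (induction k)
  case 0
  have "bil_form N (\<lambda>i j. 1) x x = (\<Sum>i\<in>N. x i)\<^sup>2" for x
    by (simp add: bil_form_def power2_eq_square sum_product)
  then show ?case by (simp add: psd_def)
next
  case (Suc k)
  show ?case unfolding power_Suc by (rule Schur_product_theorem [OF assms Suc])
qed

text \<open>The coefficient of z^k in the power series of -(1 - z)^\<theta>; with this sign those
  with \<open>k > 0\<close> are positive for 0 < \<theta> < 1.\<close>

definition powr_coeff :: "real \<Rightarrow> nat \<Rightarrow> real"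
  where "powr_coeff \<theta> k = - ((-1) ^ k * (\<theta> gchoose k))"

text \<open>Exactly one factor of the Pochhammer product of -\<theta> is negative, the first
  one.\<close>

lemma powr_coeff_pos:
  assumes "0 < \<theta>" "\<theta> < 1" "k > 0"
  shows "powr_coeff \<theta> k > 0"
proof -
  obtain m where k: "k = Suc m" using assms by (cases k) auto
  have "(-1) ^ k * (\<theta> gchoose k) = pochhammer (-\<theta>) k / fact k"
    by (simp add: gbinomial_pochhammer flip: power_mult_distrib mult.assoc)
  also have "pochhammer (-\<theta>) k = - \<theta> * pochhammer (1 - \<theta>) m"
    by (simp add: k pochhammer_rec)
  also have "pochhammer (1 - \<theta>) m > 0" using assms by (intro pochhammer_pos) auto
  then have "- \<theta> * pochhammer (1 - \<theta>) m / fact k < 0"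
    using assms by (simp add: divide_neg_pos)
  finally show ?thesis by (simp add: powr_coeff_def)
qed

lemma powr_coeff_sums:
  assumes "\<bar>z\<bar> < 1"
  shows "(\<lambda>k. powr_coeff \<theta> k * z ^ k) sums - ((1 - z) powr \<theta>)"
proof -
  have "(\<lambda>k. (\<theta> gchoose k) * (- z) ^ k) sums (1 + - z) powr \<theta>"
    using assms by (intro gen_binomial_real) auto
  then have "(\<lambda>k. - ((\<theta> gchoose k) * (- z) ^ k)) sums - ((1 + - z) powr \<theta>)" by (rule sums_minus)
  then show ?thesis by (simp add: powr_coeff_def power_minus [of z] mult_ac)
qed

text \<open>Expand \<open>(1 - r M) powr \<theta>\<close> entrywise into the binomial series, all of whose nonconstant
  coefficients are negative, and let \<open>r\<close> tend to 1.\<close>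
lemma bil_form_powr_le:
  assumes "finite N" "psd N M" and sym: "\<And>i j. i \<in> N \<Longrightarrow> j \<in> N \<Longrightarrow> M i j = M j i"
    and le1: "\<And>i j. i \<in> N \<Longrightarrow> j \<in> N \<Longrightarrow> M i j \<le> 1"
    and \<theta>: "0 < \<theta>" "\<theta> < 1" and m: "m > 0" and z: "(\<Sum>i\<in>N. z i) = 0"
  shows "bil_form N (\<lambda>i j. (1 - M i j) powr \<theta>) z z
           \<le> - powr_coeff \<theta> m * bil_form N (\<lambda>i j. M i j ^ m) z z"
proof -
  have abs1: "\<bar>M i j\<bar> \<le> 1" if "i \<in> N" "j \<in> N" for i j
  proof -
    have "(M i j)\<^sup>2 \<le> M i i * M j j" using psd_entry_square_le [of N M i j, OF assms(2,1) sym] that by simp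
    also have "\<dots> \<le> 1 * 1"
      using le1 that psd_diag [OF assms(2,1)] by (intro mult_mono) auto
    finally show ?thesis by (simp add: abs_square_le_1)
  qed
  \<comment> \<open>Entries of \<open>M\<close> may have modulus 1, on the boundary of convergence,
    hence a damping factor below 1.\<close>
  let ?r = "\<lambda>n. real n / real (Suc n)"
  have ineq: "bil_form N (\<lambda>i j. (1 - ?r n * M i j) powr \<theta>) z z
      \<le> - powr_coeff \<theta> m * (?r n ^ m * bil_form N (\<lambda>i j. M i j ^ m) z z)" for n
  proof -
    define r where "r = ?r n"
    have r: "0 \<le> r" "r < 1" by (simp_all add: r_def)
    define f where "f = (\<lambda>k. bil_form N (\<lambda>i j. powr_coeff \<theta> k * (r * M i j) ^ k) z z)"
    have f_eq: "f k = powr_coeff \<theta> k * (r ^ k * bil_form N (\<lambda>i j. M i j ^ k) z z)" for k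
      by (simp add: f_def bil_form_def sum_distrib_left power_mult_distrib mult_ac)
    have "f sums (bil_form N (\<lambda>i j. - ((1 - r * M i j) powr \<theta>)) z z)"
      unfolding f_def bil_form_def
    proof (intro sums_sum sums_mult2 powr_coeff_sums)
      fix i j assume "i \<in> N" "j \<in> N"
      have "\<bar>r * M i j\<bar> \<le> r * 1" unfolding abs_mult using r abs1 [OF \<open>i \<in> N\<close> \<open>j \<in> N\<close>]
        by (intro mult_mono) auto
      then show "\<bar>r * M i j\<bar> < 1" using r by simp
    qed
    moreover have "f k \<ge> 0" for k
    proof (cases "k = 0")
      case True
      \<comment> \<open>The constant coefficient is -1, but its form is the square of the sum of
        \<open>z\<close>, which is 0.\<close>
      have "bil_form N (\<lambda>i j. 1) z z = (\<Sum>i\<in>N. z i)\<^sup>2"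
        by (simp add: bil_form_def power2_eq_square sum_product)
      then show ?thesis using True z by (simp add: f_eq)
    next
      case False
      then have "powr_coeff \<theta> k > 0" using \<theta> by (intro powr_coeff_pos) auto
      moreover have "bil_form N (\<lambda>i j. M i j ^ k) z z \<ge> 0"
        using psd_power [of N M, OF assms(1,2) sym] by (simp add: psd_def)
      ultimately show ?thesis using r by (simp add: f_eq)
    qed
    \<comment> \<open>Of a convergent series with nonnegative terms only the \<open>m\<close>-th is
      kept.\<close>
    ultimately have "sum f {m} \<le> bil_form N (\<lambda>i j. - ((1 - r * M i j) powr \<theta>)) z z"
      using sum_le_suminf [of f "{m}"] by (simp add: sums_iff)
    moreover have "bil_form N (\<lambda>i j. - ((1 - r * M i j) powr \<theta>)) z z
        = - bil_form N (\<lambda>i j. (1 - r * M i j) powr \<theta>) z z"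
      by (simp add: bil_form_def sum_negf)
    ultimately show ?thesis unfolding r_def by (simp add: f_eq r_def)
  qed
  have r1: "?r \<longlonglongrightarrow> 1" by (rule LIMSEQ_n_over_Suc_n)
  have "(\<lambda>n. bil_form N (\<lambda>i j. (1 - ?r n * M i j) powr \<theta>) z z)
      \<longlonglongrightarrow> bil_form N (\<lambda>i j. (1 - 1 * M i j) powr \<theta>) z z"
    unfolding bil_form_def
  proof (intro tendsto_sum tendsto_mult tendsto_const tendsto_powr' tendsto_diff r1)
    fix i j assume ij: "i \<in> N" "j \<in> N"
    have "1 - ?r n * M i j \<ge> 0" for n
    proof -
      have "?r n * M i j \<le> ?r n * 1" using le1 [OF ij] by (intro mult_left_mono) auto
      also have "\<dots> \<le> 1" by simp
      finally show ?thesis by simp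
    qed
    \<comment> \<open>The limit base may be 0; there convergence of \<open>powr\<close> rests on a
      positive exponent and nonnegative bases.\<close>
    then show "1 - 1 * M i j \<noteq> 0 \<or> (0 < \<theta> \<and> (\<forall>\<^sub>F n in sequentially. 0 \<le> 1 - ?r n * M i j))"
      using \<theta> by simp
  qed
  moreover have "(\<lambda>n. - powr_coeff \<theta> m * (?r n ^ m * bil_form N (\<lambda>i j. M i j ^ m) z z))
      \<longlonglongrightarrow> - powr_coeff \<theta> m * (1 ^ m * bil_form N (\<lambda>i j. M i j ^ m) z z)"
    by (intro tendsto_mult tendsto_power tendsto_const r1)
  ultimately show ?thesis using ineq by (intro LIMSEQ_le [where X = "\<lambda>n. bil_form N (\<lambda>i j. (1 - ?r n * M i j) powr \<theta>) z z"]) auto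
qed

section \<open>Entrywise powers of hyperbolic matrices\<close>

text \<open>Entrywise powers give a semidefinite form on a hyperplane, and the lowered diagonal
  makes it definite. The case \<theta> = 0 assumes no hyperbolicity, so that it applies at the
  centre of the star before the centre is known to be a member.\<close>

lemma strictly_hyperbolic_powr:
  assumes fin: "finite R" and sym: "\<And>i j. i \<in> R \<Longrightarrow> j \<in> R \<Longrightarrow> Q i j = Q j i"
    and nonneg: "\<And>i j. i \<in> R \<Longrightarrow> j \<in> R \<Longrightarrow> Q i j \<ge> 0"
    and pos: "\<And>i j. i \<in> R \<Longrightarrow> j \<in> R \<Longrightarrow> i \<noteq> j \<Longrightarrow> Q i j > 0"
    and \<theta>: "\<theta> = 0 \<or> 0 < \<theta> \<and> \<theta> < 1 \<and> hyperbolic R Q"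
    and off: "\<And>i j. i \<in> R \<Longrightarrow> j \<in> R \<Longrightarrow> i \<noteq> j \<Longrightarrow> P i j = Q i j powr \<theta>"
    and diag: "\<And>i. i \<in> R \<Longrightarrow> P i i \<le> Q i i powr \<theta>"
    and diag': "\<And>i. i \<in> R \<Longrightarrow> Q i i > 0 \<Longrightarrow> P i i < Q i i powr \<theta>"
  shows "strictly_hyperbolic R P"
proof -
  have P_eq: "bil_form R P x x = bil_form R (\<lambda>i j. Q i j powr \<theta>) x x
      - (\<Sum>i\<in>R. (Q i i powr \<theta> - P i i) * (x i)\<^sup>2)" for x
  proof -
    have "bil_form R (\<lambda>i j. Q i j powr \<theta>) x x - bil_form R P x x
        = (\<Sum>i\<in>R. \<Sum>j\<in>R. if j = i then (Q i i powr \<theta> - P i i) * (x i)\<^sup>2 else 0)"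
      unfolding bil_form_def sum_subtractf [symmetric]
      by (intro sum.cong refl) (auto simp: off power2_eq_square algebra_simps)
    also have "\<dots> = (\<Sum>i\<in>R. (Q i i powr \<theta> - P i i) * (x i)\<^sup>2)" using fin by simp
    finally show ?thesis by simp
  qed
  have diag_nonneg: "(Q i i powr \<theta> - P i i) * (x i)\<^sup>2 \<ge> 0" if "i \<in> R" for i x
    using diag [OF that] by simp
  consider "\<theta> = 0" | r where "R = {r}" | "R = {}"
    | i j where "\<theta> \<noteq> 0" "i \<in> R" "j \<in> R" "i \<noteq> j"
    by (metis insertI1 is_singletonI' is_singleton_def)
  then show ?thesis
  proof cases
    case 1
    \<comment> \<open>\<open>P\<close> is the all-ones matrix minus a positive diagonal: positive
      entries of \<open>Q\<close> have power 1 off the diagonal, and on it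
      \<open>0 powr 0 = 0\<close> keeps \<open>P i i\<close> below 1 also where
      \<open>Q i i = 0\<close>.\<close>
    have "bil_form R P x x < 0" if x: "(\<Sum>i\<in>R. 1 * x i) = 0" and i: "i \<in> R" "x i \<noteq> 0" for x i
    proof -
      have "bil_form R P x x = (\<Sum>i\<in>R. \<Sum>j\<in>R. x i * x j - (if j = i then (1 - P i i) * (x i)\<^sup>2 else 0))"
        unfolding bil_form_def
      proof (intro sum.cong refl)
        fix i j assume "i \<in> R" "j \<in> R"
        then show "P i j * x i * x j = x i * x j - (if j = i then (1 - P i i) * (x i)\<^sup>2 else 0)"
          using off [of i j] pos [of i j] 1 by (auto simp: power2_eq_square algebra_simps)
      qed
      also have "\<dots> = (\<Sum>i\<in>R. x i)\<^sup>2 - (\<Sum>i\<in>R. (1 - P i i) * (x i)\<^sup>2)"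
        using fin by (simp add: sum_subtractf power2_eq_square sum_product)
      also have "\<dots> = - (\<Sum>i\<in>R. (1 - P i i) * (x i)\<^sup>2)" using x by simp
      also have "\<dots> < 0"
      proof -
        have lt: "P i i < 1" if "i \<in> R" for i
          using diag [OF that] diag' [OF that] nonneg [OF that that] 1
          by (cases "Q i i = 0") auto
        have "(\<Sum>i\<in>R. (1 - P i i) * (x i)\<^sup>2) > 0"
          using i lt by (intro sum_pos2 [OF fin i(1)]) (auto simp: less_imp_le)
        then show ?thesis by simp
      qed
      finally show ?thesis .
    qed
    then show ?thesis unfolding strictly_hyperbolic_def by (intro exI [of _ "\<lambda>_. 1"]) blast
  next
    case 2
    then show ?thesis unfolding strictly_hyperbolic_def by (intro exI [of _ "\<lambda>_. 1"]) simp
  next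
    case 3
    then show ?thesis unfolding strictly_hyperbolic_def by simp
  next
    case (4 i\<^sub>0 j\<^sub>0)
    then have \<theta>: "0 < \<theta>" "\<theta> < 1" "hyperbolic R Q" using \<theta> by auto
    \<comment> \<open>A second index makes every row sum positive, since \<open>Q\<close> is
      positive off the diagonal.\<close>
    define u where "u = (\<lambda>i. \<Sum>j\<in>R. Q i j)"
    have u: "u i > 0" if "i \<in> R" for i
    proof -
      obtain j where "j \<in> R" "j \<noteq> i" using 4 by metis
      then show ?thesis unfolding u_def using that pos nonneg fin
        by (intro sum_pos2 [of R j]) auto
    qed
    define S where "S = bil_form R Q (\<lambda>_. 1) (\<lambda>_. 1)"
    have S: "S > 0"
    proof -
      have "S = (\<Sum>i\<in>R. u i)" by (simp add: S_def bil_form_def u_def)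
      also have "\<dots> > 0" using u 4 fin by (intro sum_pos) auto
      finally show ?thesis .
    qed
    \<comment> \<open>\<open>u\<close> is \<open>Q\<close> applied to the all-ones vector and
      \<open>S\<close> the value of that vector, so reverse Cauchy-Schwarz against it says that 1 -
      \<open>K\<close> is positive semidefinite.\<close>
    define K where "K = (\<lambda>i j. S * Q i j / (u i * u j))"
    define M where "M = (\<lambda>i j. 1 - K i j)"
    have M_sym: "M i j = M j i" if "i \<in> R" "j \<in> R" for i j
      using sym [OF that] by (simp add: M_def K_def mult.commute)
    have M_le: "M i j \<le> 1" if "i \<in> R" "j \<in> R" for i j
      using nonneg [OF that] u [OF that(1)] u [OF that(2)] S by (simp add: M_def K_def)
    have "bil_form R M x x \<ge> 0" for x
    proof -
      define y where "y = (\<lambda>i. x i / u i)"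
      have S_Q: "S * bil_form R Q y y = (\<Sum>i\<in>R. \<Sum>j\<in>R. S * (Q i j * y i * y j))"
        by (simp add: bil_form_def sum_distrib_left)
      have "bil_form R M x x = (\<Sum>i\<in>R. x i)\<^sup>2 - S * bil_form R Q y y"
        unfolding S_Q unfolding bil_form_def power2_eq_square sum_product sum_subtractf [symmetric]
        by (intro sum.cong refl) (simp add: M_def K_def y_def left_diff_distrib)
      also have "(\<Sum>i\<in>R. x i) = (\<Sum>i\<in>R. u i * y i)"
      proof (intro sum.cong refl)
        fix i assume "i \<in> R"
        from u [OF this] show "x i = u i * y i" by (simp add: y_def)
      qed
      also have "\<dots> = bil_form R Q y (\<lambda>_. 1)"
        by (simp add: bil_form_def u_def sum_distrib_right)
      finally show ?thesis
        using \<theta>(3) hyperbolic_iff_closed_condition [of R Q, OF fin sym nonneg]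
        by (simp add: S_def mult.commute)
    qed
    then have psd: "psd R M" by (simp add: psd_def)
    have powr_eq: "bil_form R (\<lambda>i j. Q i j powr \<theta>) x x
        = S powr - \<theta> * bil_form R (\<lambda>i j. (1 - M i j) powr \<theta>) (\<lambda>i. u i powr \<theta> * x i) (\<lambda>i. u i powr \<theta> * x i)" for x
      unfolding bil_form_def sum_distrib_left
    proof (intro sum.cong refl)
      fix i j assume ij: "i \<in> R" "j \<in> R"
      have K: "K i j \<ge> 0" using u [OF ij(1)] u [OF ij(2)] S nonneg [OF ij] by (simp add: K_def)
      have "Q i j = K i j * (u i * u j) * inverse S"
        using u [OF ij(1)] u [OF ij(2)] S by (simp add: K_def field_simps)
      also have "\<dots> powr \<theta> = K i j powr \<theta> * (u i powr \<theta> * u j powr \<theta>) * S powr - \<theta>"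
        using u [OF ij(1)] u [OF ij(2)] S K by (simp add: powr_mult powr_minus inverse_powr)
      finally show "Q i j powr \<theta> * x i * x j = S powr - \<theta> *
          ((1 - M i j) powr \<theta> * (u i powr \<theta> * x i) * (u j powr \<theta> * x j))"
        by (simp add: M_def)
    qed
    have "bil_form R P x x < 0"
      if x: "(\<Sum>i\<in>R. u i powr \<theta> * x i) = 0" and k: "k \<in> R" "x k \<noteq> 0" for x k
    proof (rule ccontr)
      define z where "z = (\<lambda>i. u i powr \<theta> * x i)"
      have z: "(\<Sum>i\<in>R. z i) = 0" using x by (simp add: z_def)
      note le = bil_form_powr_le [OF fin psd M_sym M_le \<theta>(1,2) _ z]
      have M_pow: "bil_form R (\<lambda>i j. M i j ^ m) z z \<ge> 0" for m
        using psd_power [of R M, OF fin psd M_sym] by (simp add: psd_def)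
      have neg: "bil_form R (\<lambda>i j. (1 - M i j) powr \<theta>) z z \<le> 0"
        using le [of 1] M_pow [of 1] powr_coeff_pos [OF \<theta>(1,2), of 1]
        by (auto intro: order_trans)
      assume "\<not> bil_form R P x x < 0"
      moreover have "(\<Sum>i\<in>R. (Q i i powr \<theta> - P i i) * (x i)\<^sup>2) \<ge> 0"
        by (intro sum_nonneg diag_nonneg)
      moreover have "bil_form R (\<lambda>i j. Q i j powr \<theta>) x x \<le> 0"
        using neg S by (simp add: powr_eq z_def mult_le_0_iff)
      ultimately have 0: "bil_form R (\<lambda>i j. Q i j powr \<theta>) x x = 0"
          "(\<Sum>i\<in>R. (Q i i powr \<theta> - P i i) * (x i)\<^sup>2) = 0"
        using P_eq [of x] by linarith+
      have "bil_form R (\<lambda>i j. (1 - M i j) powr \<theta>) z z = 0"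
        using 0(1) S by (simp add: powr_eq z_def)
      then have M_pow_0: "bil_form R (\<lambda>i j. M i j ^ m) z z = 0" for m
      proof (cases "m = 0")
        case True
        then show ?thesis using z by (simp add: bil_form_def flip: sum_product)
      next
        case False
        then have "powr_coeff \<theta> m > 0" using powr_coeff_pos \<theta> by simp
        then show ?thesis
          using le [of m] M_pow [of m] False \<open>bil_form R (\<lambda>i j. (1 - M i j) powr \<theta>) z z = 0\<close>
          by (simp add: mult_le_0_iff)
      qed
      have poly_0: "bil_form R (\<lambda>i j. poly p (M i j)) z z = 0" for p
      proof -
        show ?thesis unfolding poly_altdef bil_form_sum by (simp add: M_pow_0)
      qed
      have x0: "x i = 0" if "i \<in> R" "Q i i > 0" for i
      proof -
        have "(Q i i powr \<theta> - P i i) * (x i)\<^sup>2 = 0"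
          using 0(2) that(1) fin diag_nonneg by (simp only: sum_nonneg_eq_0_iff)
        then show ?thesis using diag' [OF that] by simp
      qed
      have Qk: "Q k k = 0" using x0 [OF k(1)] k nonneg [OF k(1) k(1)] by force
      \<comment> \<open>The polynomial \<open>p\<close> kills every off-diagonal value of
        \<open>M\<close>. The value 1 is not among them, whereas \<open>M i i = 1\<close> whenever
        \<open>Q i i = 0\<close>.\<close>
      define vals where "vals = (\<lambda>(i, j). M i j) ` {(i, j) \<in> R \<times> R. i \<noteq> j}"
      define p where "p = (\<Prod>v\<in>vals. [:- v, 1:])"
      have "finite {(i, j) \<in> R \<times> R. i \<noteq> j}"
        by (rule finite_subset [of _ "R \<times> R"]) (use fin in auto)
      then have "finite vals" unfolding vals_def by (rule finite_imageI)
      have p_off: "poly p (M i j) = 0" if "i \<in> R" "j \<in> R" "i \<noteq> j" for i j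
      proof -
        have "M i j \<in> vals" using that by (force simp: vals_def)
        then show ?thesis using \<open>finite vals\<close> by (auto simp: p_def poly_prod)
      qed
      have p_1: "poly p 1 \<noteq> 0"
      proof -
        have "1 \<notin> vals"
        proof
          assume "1 \<in> vals"
          then obtain i j where ij: "i \<in> R" "j \<in> R" "i \<noteq> j" "M i j = 1" by (auto simp: vals_def)
          then show False
            using pos [OF ij(1-3)] u [OF ij(1)] u [OF ij(2)] S by (simp add: M_def K_def)
        qed
        then show ?thesis using \<open>finite vals\<close> by (auto simp: p_def poly_prod)
      qed
      \<comment> \<open>Only diagonal terms survive, and these only where \<open>Q i i = 0\<close>:
        the vanishing form is \<open>poly p 1\<close> times a sum of squares.\<close>
      have "0 = bil_form R (\<lambda>i j. poly p (M i j)) z z" by (simp add: poly_0)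
      also have "\<dots> = (\<Sum>i\<in>R. \<Sum>j\<in>R. if j = i then poly p 1 * (z i)\<^sup>2 else 0)"
        unfolding bil_form_def
      proof (intro sum.cong refl)
        fix i j assume ij: "i \<in> R" "j \<in> R"
        have "poly p (M i i) * z i * z i = poly p 1 * (z i)\<^sup>2"
        proof (cases "Q i i = 0")
          case True
          then show ?thesis by (simp add: M_def K_def power2_eq_square)
        next
          case False
          then have "x i = 0" using x0 [OF ij(1)] nonneg [OF ij(1) ij(1)] by simp
          then show ?thesis by (simp add: z_def)
        qed
        then show "poly p (M i j) * z i * z j = (if j = i then poly p 1 * (z i)\<^sup>2 else 0)"
          using p_off [OF ij] by auto
      qed
      also have "\<dots> = poly p 1 * (\<Sum>i\<in>R. (z i)\<^sup>2)" using fin by (simp add: sum_distrib_left)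
      finally have "(\<Sum>i\<in>R. (z i)\<^sup>2) = 0" using p_1 by simp
      then have "z k = 0" using k fin by (simp add: sum_nonneg_eq_0_iff)
      then show False using k u [OF k(1)] by (simp add: z_def)
    qed
    then show ?thesis
      unfolding strictly_hyperbolic_def by (intro exI [of _ "\<lambda>i. u i powr \<theta>"]) blast
  qed
qed

section \<open>Rescaling and stability of strict hyperbolicity\<close>

lemma strictly_hyperbolic_scale:
  assumes "strictly_hyperbolic R Q" "c > 0" and s: "\<And>i. i \<in> R \<Longrightarrow> s i > 0"
    and P: "\<And>i j. i \<in> R \<Longrightarrow> j \<in> R \<Longrightarrow> P i j = c * s i * s j * Q i j"
  shows "strictly_hyperbolic R P"
proof -
  obtain h where h: "\<And>x. (\<Sum>i\<in>R. h i * x i) = 0 \<Longrightarrow> (\<exists>i\<in>R. x i \<noteq> 0) \<Longrightarrow> bil_form R Q x x < 0"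
    using assms unfolding strictly_hyperbolic_def by blast
  have "bil_form R P x x < 0" if "(\<Sum>i\<in>R. h i * s i * x i) = 0" "\<exists>i\<in>R. x i \<noteq> 0" for x
  proof -
    have "bil_form R Q (\<lambda>i. s i * x i) (\<lambda>i. s i * x i) < 0"
    proof (rule h)
      show "\<exists>i\<in>R. s i * x i \<noteq> 0" using that(2) s by (metis less_irrefl mult_eq_0_iff)
    qed (use that in \<open>simp add: mult.assoc\<close>)
    moreover have "bil_form R P x x = c * bil_form R Q (\<lambda>i. s i * x i) (\<lambda>i. s i * x i)"
      unfolding bil_form_def sum_distrib_left by (intro sum.cong refl) (simp add: P)
    ultimately show ?thesis using \<open>c > 0\<close> by (simp add: mult_pos_neg)
  qed
  then show ?thesis
    unfolding strictly_hyperbolic_def by (intro exI [of _ "\<lambda>i. h i * s i"]) blast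
qed

text \<open>The index type may be infinite, so the surrounding compact set is a Tychonoff cube; the
  value 0 off \<open>R\<close> places the sphere inside it as a closed subset.\<close>

lemma compact_unit_vectors_orthogonal:
  fixes h :: "'a \<Rightarrow> real"
  assumes "finite R"
  shows "compact {x :: 'a \<Rightarrow> real. (\<forall>i. i \<notin> R \<longrightarrow> x i = 0) \<and> (\<Sum>i\<in>R. (x i)\<^sup>2) = 1 \<and> (\<Sum>i\<in>R. h i * x i) = 0}"
    (is "compact ?S")
proof -
  define K where "K = PiE UNIV (\<lambda>_::'a. {-1..1::real})"
  have "compactin (product_topology (\<lambda>_. euclidean) UNIV) K"
    unfolding K_def by (simp add: compactin_PiE)
  then have "compact K" by (simp add: euclidean_product_topology)
  have "closed ?S"
    by (intro closed_Collect_conj closed_Collect_all closed_Collect_imp closed_Collect_eq open_Collect_const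
        continuous_intros continuous_on_product_coordinates)
  have "?S \<subseteq> K"
    unfolding K_def
  proof (intro subsetI PiE_I)
    fix x i assume x: "x \<in> ?S"
    show "x i \<in> {-1..1}"
    proof (cases "i \<in> R")
      case True
      have "(x i)\<^sup>2 \<le> (\<Sum>i\<in>R. (x i)\<^sup>2)" using assms True by (intro member_le_sum) auto
      also have "\<dots> = 1" using x by simp
      finally show ?thesis by (simp add: abs_square_le_1 abs_le_iff)
    qed (use x in auto)
  qed simp
  then have "?S \<inter> K = ?S" by (rule Int_absorb2)
  moreover have "compact (?S \<inter> K)" by (rule closed_Int_compact) fact+
  ultimately show ?thesis by (simp only:)
qed

text \<open>On the compact unit sphere of the hyperplane the form is at most \<open>- m\<close> for
  some \<open>m > 0\<close>, and an entrywise error \<epsilon> changes it there by at most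
  \<epsilon> times \<open>card R\<close>. The same hyperplane thus works for all nearby
  matrices.\<close>

lemma strictly_hyperbolic_open:
  assumes fin: "finite R" and "strictly_hyperbolic R Q"
  obtains \<epsilon> where "\<epsilon> > 0"
    "\<And>P. (\<And>i j. i \<in> R \<Longrightarrow> j \<in> R \<Longrightarrow> \<bar>P i j - Q i j\<bar> \<le> \<epsilon>) \<Longrightarrow> hyperbolic R P"
proof -
  obtain h where h: "\<And>x. (\<Sum>i\<in>R. h i * x i) = 0 \<Longrightarrow> (\<exists>i\<in>R. x i \<noteq> 0) \<Longrightarrow> bil_form R Q x x < 0"
    using assms unfolding strictly_hyperbolic_def by blast
  define S where "S = {x :: 'a \<Rightarrow> real. (\<forall>i. i \<notin> R \<longrightarrow> x i = 0) \<and> (\<Sum>i\<in>R. (x i)\<^sup>2) = 1 \<and> (\<Sum>i\<in>R. h i * x i) = 0}"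
  have "compact S" unfolding S_def by (rule compact_unit_vectors_orthogonal [OF fin])
  have cont: "continuous_on A (\<lambda>x. bil_form R Q x x)" for A
    unfolding bil_form_def
    by (intro continuous_intros continuous_on_subset [OF continuous_on_product_coordinates subset_UNIV])
  have "\<exists>m>0. \<forall>x\<in>S. bil_form R Q x x \<le> - m"
  proof (cases "S = {}")
    case True
    then show ?thesis by (intro exI [of _ 1]) auto
  next
    case False
    then obtain x where x: "x \<in> S" "\<And>y. y \<in> S \<Longrightarrow> bil_form R Q y y \<le> bil_form R Q x x"
      using continuous_attains_sup [OF \<open>compact S\<close> _ cont] by blast
    have "\<exists>i\<in>R. x i \<noteq> 0"
    proof (rule ccontr)
      assume "\<not> (\<exists>i\<in>R. x i \<noteq> 0)"
      then show False using x(1) by (simp add: S_def)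
    qed
    then have "bil_form R Q x x < 0" using h x(1) by (simp add: S_def)
    then show ?thesis using x(2) by (intro exI [of _ "- bil_form R Q x x"]) simp
  qed
  then obtain m where m: "m > 0" "\<And>x. x \<in> S \<Longrightarrow> bil_form R Q x x \<le> - m" by blast
  \<comment> \<open>The summand 1 keeps the denominator positive when \<open>R\<close> is
    empty.\<close>
  define \<epsilon> where "\<epsilon> = m / (real (card R) + 1)"
  have \<epsilon>: "\<epsilon> > 0" using m by (simp add: \<epsilon>_def)
  have "hyperbolic R P" if P: "\<And>i j. i \<in> R \<Longrightarrow> j \<in> R \<Longrightarrow> \<bar>P i j - Q i j\<bar> \<le> \<epsilon>" for P
  proof -
    have "bil_form R P x x \<le> 0" if x: "(\<Sum>i\<in>R. h i * x i) = 0" for x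
    proof (cases "\<exists>i\<in>R. x i \<noteq> 0")
      case False
      then show ?thesis by (simp add: bil_form_def)
    next
      case True
      define s where "s = (\<Sum>i\<in>R. (x i)\<^sup>2)"
      have s: "s > 0" using True fin unfolding s_def by (auto intro: sum_pos2)
      define y where "y = (\<lambda>i. if i \<in> R then inverse (sqrt s) * x i else 0)"
      have "(\<Sum>i\<in>R. (y i)\<^sup>2) = (\<Sum>i\<in>R. inverse s * (x i)\<^sup>2)"
        using s by (intro sum.cong refl) (simp add: y_def power_mult_distrib power_inverse)
      also have "\<dots> = 1" using s by (simp add: s_def flip: sum_distrib_left)
      finally have y1: "(\<Sum>i\<in>R. (y i)\<^sup>2) = 1" .
      have "(\<Sum>i\<in>R. h i * y i) = inverse (sqrt s) * (\<Sum>i\<in>R. h i * x i)"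
        unfolding sum_distrib_left by (intro sum.cong refl) (simp add: y_def)
      then have "y \<in> S" using x y1 by (simp add: S_def y_def)
      then have le: "bil_form R Q y y \<le> - m" by (rule m)
      have "bil_form R P y y - bil_form R Q y y = (\<Sum>i\<in>R. \<Sum>j\<in>R. (P i j - Q i j) * (y i * y j))"
        by (simp add: bil_form_def algebra_simps flip: sum_subtractf)
      also have "\<dots> \<le> (\<Sum>i\<in>R. \<Sum>j\<in>R. \<epsilon> * (((y i)\<^sup>2 + (y j)\<^sup>2) / 2))"
      proof (intro sum_mono)
        fix i j assume ij: "i \<in> R" "j \<in> R"
        have "0 \<le> (\<bar>y i\<bar> - \<bar>y j\<bar>)\<^sup>2" by simp
        then have "\<bar>y i * y j\<bar> \<le> ((y i)\<^sup>2 + (y j)\<^sup>2) / 2"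
          by (simp add: power2_diff abs_mult)
        then have "\<bar>P i j - Q i j\<bar> * \<bar>y i * y j\<bar> \<le> \<epsilon> * (((y i)\<^sup>2 + (y j)\<^sup>2) / 2)"
          using P [OF ij] \<epsilon> by (intro mult_mono) auto
        then show "(P i j - Q i j) * (y i * y j) \<le> \<epsilon> * (((y i)\<^sup>2 + (y j)\<^sup>2) / 2)"
          by (simp add: flip: abs_mult)
      qed
      also have "\<dots> = \<epsilon> * real (card R)"
        using y1 by (simp add: sum.distrib y1 flip: sum_distrib_left sum_divide_distrib sum_distrib_right)
      also have "\<dots> \<le> m" using m by (simp add: \<epsilon>_def field_simps)
      finally have "bil_form R P y y \<le> 0" using le by simp
      moreover have "bil_form R P y y = inverse (sqrt s) * inverse (sqrt s) * bil_form R P x x"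
        unfolding bil_form_scale [symmetric] by (intro bil_form_cong) (simp add: y_def)
      ultimately show ?thesis using s by (simp add: mult_le_0_iff zero_le_mult_iff)
    qed
    then show ?thesis unfolding hyperbolic_def by blast
  qed
  with \<epsilon> show ?thesis by (rule that)
qed

section \<open>Eigenvalues of real symmetric matrices\<close>

text \<open>A complex root of the characteristic polynomial has an eigenvector \<open>z\<close>. The
  Hermitian form at \<open>z\<close> is real by symmetry and equals the root times the nonzero
  squared norm of \<open>z\<close>, so the root is real.\<close>

lemma symmetric_real_mat_has_eigenvalue:
  fixes A :: "real mat"
  assumes A: "A \<in> carrier_mat n n" and sym: "transpose_mat A = A" and n: "n \<noteq> 0"
  shows "\<exists>e. eigenvalue A e"
proof -
  define C where "C = map_mat complex_of_real A"
  have C: "C \<in> carrier_mat n n" using A by (simp add: C_def)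
  have sym': "A $$ (i, j) = A $$ (j, i)" if "i < n" "j < n" for i j
    using arg_cong [OF sym, of "\<lambda>B. B $$ (j, i)"] A that by simp
  have "degree (char_poly C) = n" using degree_monic_char_poly [OF C] by simp
  then have "\<not> constant (poly (char_poly C))" using n by (simp add: constant_degree)
  then obtain c where c: "poly (char_poly C) c = 0"
    using fundamental_theorem_of_algebra by blast
  then have "eigenvalue C c" using eigenvalue_root_char_poly [OF C] by simp
  then obtain z where z: "z \<in> carrier_vec n" "z \<noteq> 0\<^sub>v n" "C *\<^sub>v z = c \<cdot>\<^sub>v z"
    using C by (auto simp: eigenvalue_def eigenvector_def)
  have row: "(\<Sum>j<n. complex_of_real (A $$ (i, j)) * z $ j) = c * z $ i" if "i < n" for i
    using arg_cong [OF z(3), of "\<lambda>v. v $ i"] that A z(1)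
    by (simp add: C_def scalar_prod_def atLeast0LessThan)
  define s where "s = (\<Sum>i<n. \<Sum>j<n. cnj (z $ i) * complex_of_real (A $$ (i, j)) * z $ j)"
  define r where "r = (\<Sum>i<n. (cmod (z $ i))\<^sup>2)"
  have "s = (\<Sum>i<n. cnj (z $ i) * (c * z $ i))"
    unfolding s_def by (intro sum.cong refl) (simp add: row mult.assoc flip: sum_distrib_left)
  also have "\<dots> = c * complex_of_real r"
    unfolding r_def of_real_sum sum_distrib_left complex_norm_square
    by (intro sum.cong refl) (simp add: mult_ac)
  finally have s: "s = c * complex_of_real r" .
  have "cnj s = (\<Sum>i<n. \<Sum>j<n. z $ i * complex_of_real (A $$ (i, j)) * cnj (z $ j))"
    by (simp add: s_def)
  also have "\<dots> = (\<Sum>j<n. \<Sum>i<n. z $ i * complex_of_real (A $$ (i, j)) * cnj (z $ j))"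
    by (rule sum.swap)
  also have "\<dots> = s" unfolding s_def
    by (intro sum.cong refl) (simp add: sym' mult_ac)
  finally have "cnj s = s" .
  then have "cnj c * complex_of_real r = c * complex_of_real r" unfolding s by simp
  moreover have "r \<noteq> 0"
  proof
    assume "r = 0"
    then have "z $ i = 0" if "i < n" for i
      using that by (simp add: r_def sum_nonneg_eq_0_iff)
    then have "z = 0\<^sub>v n" using z(1) by auto
    with z(2) show False by simp
  qed
  ultimately have "cnj c = c" by simp
  then have c_real: "c = complex_of_real (Re c)"
    by (metis Reals_cnj_iff of_real_Re)
  have "char_poly C = map_poly complex_of_real (char_poly A)"
    unfolding C_def by (rule of_real_hom.char_poly_hom [OF A])
  then have "complex_of_real (poly (char_poly A) (Re c)) = 0"
    using c c_real by (metis of_real_hom.poly_map_poly)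
  then have "poly (char_poly A) (Re c) = 0" by simp
  then show ?thesis using eigenvalue_root_char_poly [OF A] by blast
qed

lemma orthonormal_completion:
  fixes v :: "real vec"
  assumes v: "v \<in> carrier_vec n" and "v \<bullet> v = 1"
  shows "\<exists>W\<in>carrier_mat n n. transpose_mat W * W = 1\<^sub>m n \<and> col W 0 = v"
proof -
  interpret cof_vec_space n "TYPE(real)" .
  have v0: "v \<noteq> 0\<^sub>v n" using assms by auto
  have n: "n \<noteq> 0"
  proof
    assume "n = 0"
    then show False using assms by (simp add: scalar_prod_def)
  qed
  define b where "b = basis_completion v"
  define ws where "ws = gram_schmidt n b"
  from basis_completion [OF v v0, folded b_def]
  have b: "distinct b" "\<not> lin_dep (set b)" "set b \<subseteq> carrier_vec n" "hd b = v" "length b = n"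
    by auto
  then obtain vs where bv: "b = v # vs" using n by (cases b) auto
  from gram_schmidt_result [OF b(3,1,2) refl, folded ws_def]
  have ws: "set ws \<subseteq> carrier_vec n" "corthogonal ws" "length ws = n" by (auto simp: b)
  have hd: "hd ws = v" unfolding ws_def bv by (rule gram_schmidt_hd [OF v])
  have ws_c: "ws ! i \<in> carrier_vec n" if "i < n" for i using ws that by auto
  have orth: "ws ! i \<bullet> ws ! j = 0 \<longleftrightarrow> i \<noteq> j" if "i < n" "j < n" for i j
    using corthogonalD [OF ws(2), of i j] that ws(3) by simp
  have pos: "ws ! i \<bullet> ws ! i > 0" if "i < n" for i
  proof -
    have "ws ! i \<bullet> ws ! i \<ge> 0" unfolding scalar_prod_def by (intro sum_nonneg) auto
    then show ?thesis using orth [OF that that] by simp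
  qed
  define us where "us = map (\<lambda>w. (1 / sqrt (w \<bullet> w)) \<cdot>\<^sub>v w) ws"
  define W where "W = mat_of_cols n us"
  have us: "us ! i = (1 / sqrt (ws ! i \<bullet> ws ! i)) \<cdot>\<^sub>v ws ! i" "us ! i \<in> carrier_vec n" if "i < n" for i
    using that ws(3) ws_c [OF that] by (simp_all add: us_def)
  have W: "W \<in> carrier_mat n n"
    using mat_of_cols_carrier(1) [of n us] ws(3) by (simp add: W_def us_def)
  have col: "col W i = us ! i" if "i < n" for i
    using that ws(3) us(2) [OF that] by (simp add: W_def us_def)
  have "transpose_mat W * W = 1\<^sub>m n"
  proof (rule eq_matI)
    fix i j assume ij: "i < dim_row (1\<^sub>m n :: real mat)" "j < dim_col (1\<^sub>m n :: real mat)"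
    then have ij: "i < n" "j < n" by auto
    have "(transpose_mat W * W) $$ (i, j) = us ! i \<bullet> us ! j"
      using ij W by (simp add: col)
    also have "\<dots> = (1 / sqrt (ws ! i \<bullet> ws ! i)) * ((1 / sqrt (ws ! j \<bullet> ws ! j)) * (ws ! i \<bullet> ws ! j))"
      unfolding us(1) [OF ij(1)] us(1) [OF ij(2)]
      by (subst smult_scalar_prod_distrib [of _ n], simp_all add: ws_c ij)
        (subst scalar_prod_smult_distrib [of _ n], simp_all add: ws_c ij)
    also have "\<dots> = 1\<^sub>m n $$ (i, j)"
      using pos [OF ij(1)] orth [OF ij] ij by auto
    finally show "(transpose_mat W * W) $$ (i, j) = 1\<^sub>m n $$ (i, j)" .
  qed (use W in auto)
  moreover have "col W 0 = v"
  proof -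
    have "ws ! 0 = v" using hd n ws(3) by (metis hd_conv_nth list.size(3))
    then show ?thesis using n assms(2) by (simp add: col us)
  qed
  ultimately show ?thesis using W by blast
qed

text \<open>Deflation: in an orthonormal basis beginning with an eigenvector, symmetry splits off a
  1 by 1 block, and the induction hypothesis handles the rest.\<close>

lemma symmetric_real_mat_diagonalization:
  fixes A :: "real mat"
  assumes "A \<in> carrier_mat n n" "transpose_mat A = A"
  shows "\<exists>P f. P \<in> carrier_mat n n \<and> transpose_mat P * P = 1\<^sub>m n \<and>
           transpose_mat P * A * P = mat_diag n f"
  using assms
proof (induction n arbitrary: A)
  case 0
  then show ?case by (intro exI [of _ "1\<^sub>m 0"] exI [of _ "\<lambda>_. 0"] conjI eq_matI)
      (auto simp: mat_diag_def)
next
  case (Suc m)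
  let ?n = "Suc m"
  note A = Suc.prems(1) and sym = Suc.prems(2)
  obtain e where "eigenvalue A e" using symmetric_real_mat_has_eigenvalue [OF A sym] by auto
  then obtain v0 where v0: "v0 \<in> carrier_vec ?n" "v0 \<noteq> 0\<^sub>v ?n" "A *\<^sub>v v0 = e \<cdot>\<^sub>v v0"
    using A by (auto simp: eigenvalue_def eigenvector_def)
  define c where "c = 1 / sqrt (v0 \<bullet> v0)"
  define v where "v = c \<cdot>\<^sub>v v0"
  have v: "v \<in> carrier_vec ?n" using v0 by (simp add: v_def)
  have "v0 \<bullet> v0 \<noteq> 0"
  proof
    assume "v0 \<bullet> v0 = 0"
    then have "v0 $ i = 0" if "i < ?n" for i
      using that v0(1) by (simp add: scalar_prod_def sum_nonneg_eq_0_iff del: sum.op_ivl_Suc)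
    then have "v0 = 0\<^sub>v ?n" using v0(1) by auto
    with v0(2) show False by simp
  qed
  moreover have "v0 \<bullet> v0 \<ge> 0" unfolding scalar_prod_def by (intro sum_nonneg) auto
  ultimately have "v \<bullet> v = 1" using v0(1) by (simp add: v_def c_def)
  then obtain W where W: "W \<in> carrier_mat ?n ?n" "transpose_mat W * W = 1\<^sub>m ?n" "col W 0 = v"
    using orthonormal_completion [OF v] by blast
  have WT: "transpose_mat W \<in> carrier_mat ?n ?n" using W by simp
  have Av: "A *\<^sub>v v = e \<cdot>\<^sub>v v"
    using A v0 by (simp add: v_def mult_mat_vec smult_smult_assoc mult.commute)
  define A' where "A' = transpose_mat W * A * W"
  have A': "A' \<in> carrier_mat ?n ?n" using A W by (simp add: A'_def)
  have "transpose_mat A' = A'"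
    unfolding A'_def using A W sym WT
    by (subst transpose_mult [of _ ?n ?n _ ?n], simp, simp, subst transpose_mult [of _ ?n ?n _ ?n])
      (simp_all add: assoc_mult_mat [of _ ?n ?n _ ?n _ ?n])
  then have A'_sym: "A' $$ (i, j) = A' $$ (j, i)" if "i < ?n" "j < ?n" for i j
    using A' that by (metis carrier_matD index_transpose_mat(1))
  have A'_0: "A' $$ (i, 0) = (if i = 0 then e else 0)" if "i < ?n" for i
  proof -
    have "A' = transpose_mat W * (A * W)"
      unfolding A'_def using A W WT by (simp add: assoc_mult_mat [of _ ?n ?n _ ?n _ ?n])
    then have "A' $$ (i, 0) = col W i \<bullet> col (A * W) 0" using A W that by simp
    also have "col (A * W) 0 = A *\<^sub>v v" using col_mult2 [OF A W(1), of 0] W(3) by simp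
    also have "\<dots> = e \<cdot>\<^sub>v col W 0" by (simp add: Av W(3))
    also have "col W i \<bullet> (e \<cdot>\<^sub>v col W 0) = e * (transpose_mat W * W) $$ (i, 0)"
      using W(1) that by simp
    also have "\<dots> = (if i = 0 then e else 0)" unfolding W(2) using that by simp
    finally show ?thesis .
  qed
  have A'_0': "A' $$ (0, Suc k) = 0" if "k < m" for k
    using A'_sym [of 0 "Suc k"] A'_0 [of "Suc k"] that by simp
  define A3 where "A3 = mat m m (\<lambda>(i, j). A' $$ (Suc i, Suc j))"
  have A3: "A3 \<in> carrier_mat m m" by (simp add: A3_def)
  have "transpose_mat A3 = A3" unfolding A3_def by (rule eq_matI) (auto simp: A'_sym)
  from Suc.IH [OF A3 this] obtain P3 f where P3: "P3 \<in> carrier_mat m m"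
      "transpose_mat P3 * P3 = 1\<^sub>m m" "transpose_mat P3 * A3 * P3 = mat_diag m f" by blast
  define E where "E = mat 1 1 (\<lambda>_. e)"
  have E: "E \<in> carrier_mat 1 1" by (simp add: E_def)
  have block: "A' = four_block_mat E (0\<^sub>m 1 m) (0\<^sub>m m 1) A3"
  proof (rule eq_matI)
    fix i j assume "i < dim_row (four_block_mat E (0\<^sub>m 1 m) (0\<^sub>m m 1) A3)"
      "j < dim_col (four_block_mat E (0\<^sub>m 1 m) (0\<^sub>m m 1) A3)"
    then have "i < ?n" "j < ?n" using E A3 by auto
    then show "A' $$ (i, j) = four_block_mat E (0\<^sub>m 1 m) (0\<^sub>m m 1) A3 $$ (i, j)"
      using E A3 A'_0 A'_0' by (cases i; cases j) (auto simp: E_def A3_def)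
  qed (use A' E A3 in auto)
  define B where "B = four_block_mat (1\<^sub>m 1) (0\<^sub>m 1 m) (0\<^sub>m m 1) P3"
  have B: "B \<in> carrier_mat ?n ?n" 
    using four_block_carrier_mat [OF one_carrier_mat P3(1), of 1] by (simp add: B_def)
  have BT: "transpose_mat B = four_block_mat (1\<^sub>m 1) (0\<^sub>m 1 m) (0\<^sub>m m 1) (transpose_mat P3)"
    unfolding B_def using P3
    by (subst transpose_four_block_mat [of _ 1 1 _ m _ m]) auto
  have BT_c: "transpose_mat B \<in> carrier_mat ?n ?n" using B by simp
  have BB: "transpose_mat B * B = 1\<^sub>m ?n"
    unfolding BT unfolding B_def using P3
    by (subst mult_four_block_mat [of _ 1 1 _ m _ m _ _ 1 _ m]) auto
  have BAB: "transpose_mat B * A' * B = four_block_mat E (0\<^sub>m 1 m) (0\<^sub>m m 1) (mat_diag m f)"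
    unfolding BT block unfolding B_def using P3 E A3
    by (subst mult_four_block_mat [of _ 1 1 _ m _ m _ _ 1 _ m], simp_all)
      (subst mult_four_block_mat [of _ 1 1 _ m _ m _ _ 1 _ m], auto)
  have diag: "four_block_mat E (0\<^sub>m 1 m) (0\<^sub>m m 1) (mat_diag m f)
      = mat_diag ?n (\<lambda>i. case i of 0 \<Rightarrow> e | Suc k \<Rightarrow> f k)"
    by (rule eq_matI) (auto simp: E_def mat_diag_def split: nat.splits)
  define P where "P = W * B"
  have P: "P \<in> carrier_mat ?n ?n" using W B by (simp add: P_def)
  have PT: "transpose_mat P = transpose_mat B * transpose_mat W"
    unfolding P_def using W B by (simp add: transpose_mult [of _ ?n ?n _ ?n])
  have "transpose_mat P * P = transpose_mat B * (transpose_mat W * W) * B"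
    unfolding PT unfolding P_def using W(1) B WT BT_c by (simp add: assoc_mult_mat [of _ ?n ?n _ ?n _ ?n])
  also have "\<dots> = 1\<^sub>m ?n" unfolding W(2) using BB BT_c by simp
  finally have "transpose_mat P * P = 1\<^sub>m ?n" .
  moreover have "transpose_mat P * A * P = transpose_mat B * A' * B"
    unfolding PT unfolding P_def A'_def using A W(1) B WT BT_c
    by (simp add: assoc_mult_mat [of _ ?n ?n _ ?n _ ?n])
  ultimately show ?case using P unfolding BAB diag by blast
qed

lemma order_prod_linear_factors:
  "Polynomial.order (a :: real) (\<Prod>b\<leftarrow>bs. [:- b, 1:]) = length (filter (\<lambda>b. b = a) bs)"
proof (induction bs)
  case (Cons b bs)
  have "monic (\<Prod>b\<leftarrow>b # bs. [:- b, 1:])" by (rule monic_prod_list) auto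
  then have "[:- b, 1:] * (\<Prod>b\<leftarrow>bs. [:- b, 1:]) \<noteq> 0" by auto
  then have "Polynomial.order a (\<Prod>b\<leftarrow>b # bs. [:- b, 1:])
      = Polynomial.order a [:- b, 1:] + Polynomial.order a (\<Prod>b\<leftarrow>bs. [:- b, 1:])"
    unfolding list.map prod_list.Cons by (rule Polynomial.order_mult)
  moreover have "Polynomial.order a [:- b, 1:] = (if b = a then 1 else 0)"
    using order_power_n_n [of a 1] by (auto intro: order_0I)
  ultimately show ?case using Cons by simp
qed simp

text \<open>In an orthonormal eigenbasis the orders of the positive roots add up to the number of
  positive diagonal entries. Two of these span a positive definite plane, which meets every
  hyperplane; for a single one the orthogonal complement is the hyperplane.\<close>

lemma at_most_one_pos_eigenvalue_iff_hyperbolic: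
  assumes sym: "\<And>i j. i < n \<Longrightarrow> j < n \<Longrightarrow> Q i j = Q j i"
  shows "at_most_one_pos_eigenvalue (mat n n (\<lambda>(i, j). Q i j)) \<longleftrightarrow> hyperbolic {..<n} Q"
proof -
  define A where "A = mat n n (\<lambda>(i, j). Q i j)"
  have A: "A \<in> carrier_mat n n" by (simp add: A_def)
  have "transpose_mat A = A" unfolding A_def by (rule eq_matI) (auto simp: sym)
  from symmetric_real_mat_diagonalization [OF A this] obtain P f
    where P: "P \<in> carrier_mat n n" "transpose_mat P * P = 1\<^sub>m n" "transpose_mat P * A * P = mat_diag n f"
    by blast
  have PT: "transpose_mat P \<in> carrier_mat n n" using P by simp
  have PPT: "P * transpose_mat P = 1\<^sub>m n" using mat_mult_left_right_inverse [OF PT P(1) P(2)] .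
  have D: "mat_diag n f \<in> carrier_mat n n" by simp
  have "P * mat_diag n f * transpose_mat P = (P * transpose_mat P) * A * (P * transpose_mat P)"
    unfolding P(3) [symmetric] using A P(1) PT by (simp add: assoc_mult_mat [of _ n n _ n _ n])
  then have A_eq: "A = P * mat_diag n f * transpose_mat P" using A by (simp add: PPT)
  have sim: "similar_mat A (mat_diag n f)"
    unfolding similar_mat_def
    by (intro exI [of _ P] exI [of _ "transpose_mat P"] similar_mat_witI [OF PPT P(2) A_eq A D P(1) PT])
  have "char_poly A = (\<Prod>a\<leftarrow>diag_mat (mat_diag n f). [:- a, 1:])"
    unfolding char_poly_similar [OF sim]
    by (rule char_poly_upper_triangular [OF D]) (auto simp: mat_diag_def)
  also have "diag_mat (mat_diag n f) = map f [0..<n]"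
    by (auto simp: diag_mat_def mat_diag_def)
  finally have cp: "char_poly A = (\<Prod>a\<leftarrow>map f [0..<n]. [:- a, 1:])" .
  have order: "Polynomial.order a (char_poly A) = card {i \<in> {..<n}. f i = a}" for a
    unfolding cp order_prod_linear_factors
    by (simp add: filter_map o_def length_filter_conv_card) (rule arg_cong [of _ _ card], auto)
  have ev: "eigenvalue A a \<longleftrightarrow> (\<exists>i<n. f i = a)" for a
    unfolding eigenvalue_root_char_poly [OF A] cp
    by (auto simp: poly_prod_list prod_list_zero_iff)
  define pos where "pos = {i \<in> {..<n}. f i > 0}"
  have "(\<Sum>a | eigenvalue A a \<and> a > 0. Polynomial.order a (char_poly A))
      = (\<Sum>a\<in>f ` pos. card {i \<in> pos. f i = a})"
    unfolding order
  proof (intro sum.cong)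
    show "{a. eigenvalue A a \<and> 0 < a} = f ` pos" by (auto simp: ev pos_def)
    show "card {i \<in> {..<n}. f i = a} = card {i \<in> pos. f i = a}" if "a \<in> f ` pos" for a
      using that by (intro arg_cong [of _ _ card]) (auto simp: pos_def)
  qed
  also have "\<dots> = card pos"
    using sum.group [of pos "f ` pos" f "\<lambda>_. 1 :: nat"] by (simp add: pos_def)
  finally have count: "at_most_one_pos_eigenvalue A \<longleftrightarrow> card pos \<le> 1"
    by (simp add: at_most_one_pos_eigenvalue_def)
  define p where "p = (\<lambda>k i. P $$ (i, k))"
  have Q_eq: "Q i j = (\<Sum>k<n. f k * (p k i * p k j))" if "i < n" "j < n" for i j
  proof -
    have "Q i j = A $$ (i, j)" using that by (simp add: A_def)
    also have "\<dots> = (\<Sum>k<n. (P * mat_diag n f) $$ (i, k) * P $$ (j, k))"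
      unfolding A_eq using that P(1)
      by (simp add: scalar_prod_def atLeast0LessThan carrier_matD [OF D] cong: sum.cong_simp)
    also have "\<dots> = (\<Sum>k<n. f k * (p k i * p k j))"
      using that P(1) by (intro sum.cong refl) (simp add: mat_diag_mult_right [of _ n] p_def mult_ac)
    finally show ?thesis .
  qed
  have orth: "(\<Sum>i<n. p k i * p l i) = of_bool (k = l)" if "k < n" "l < n" for k l
    using arg_cong [OF P(2), of "\<lambda>B. B $$ (k, l)"] P(1) that
    by (simp add: scalar_prod_def atLeast0LessThan p_def)
  have form: "bil_form {..<n} Q x x = (\<Sum>k<n. f k * (\<Sum>i<n. p k i * x i)\<^sup>2)" for x
  proof -
    have "bil_form {..<n} Q x x = bil_form {..<n} (\<lambda>i j. \<Sum>k<n. f k * (p k i * p k j)) x x"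
      by (intro bil_form_cong) (simp add: Q_eq)
    also have "\<dots> = (\<Sum>k<n. f k * bil_form {..<n} (\<lambda>i j. p k i * p k j) x x)" by (rule bil_form_sum)
    also have "\<dots> = (\<Sum>k<n. f k * (\<Sum>i<n. p k i * x i)\<^sup>2)"
      by (simp add: bil_form_def power2_eq_square sum_product mult_ac)
    finally show ?thesis .
  qed
  have fin: "finite pos" by (simp add: pos_def)
  have "card pos \<le> 1 \<longleftrightarrow> hyperbolic {..<n} Q"
  proof
    assume "card pos \<le> 1"
    then obtain k where k: "pos \<subseteq> {k}"
      using fin by (metis card_le_Suc0_iff_eq One_nat_def insertI1 subsetI singleton_iff)
    have "bil_form {..<n} Q x x \<le> 0" if "(\<Sum>i\<in>{..<n}. p k i * x i) = 0" for x
      unfolding form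
    proof (intro sum_nonpos)
      fix l assume "l \<in> {..<n}"
      then show "f l * (\<Sum>i<n. p l i * x i)\<^sup>2 \<le> 0"
        using that k by (cases "l = k") (auto simp: pos_def intro!: mult_nonpos_nonneg)
    qed
    then show "hyperbolic {..<n} Q" unfolding hyperbolic_def by blast
  next
    assume "hyperbolic {..<n} Q"
    then obtain h where h: "\<And>x. (\<Sum>i<n. h i * x i) = 0 \<Longrightarrow> bil_form {..<n} Q x x \<le> 0"
      unfolding hyperbolic_def by blast
    have "k = l" if k: "k \<in> pos" and l: "l \<in> pos" for k l
    proof (rule ccontr)
      assume "k \<noteq> l"
      define hk hl where "hk = (\<Sum>i<n. h i * p k i)" and "hl = (\<Sum>i<n. h i * p l i)"
      \<comment> \<open>A nonzero vector of the positive plane on the given hyperplane; the pair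
        \<open>hl\<close>, \<open>- hk\<close> is useless exactly when both are 0.\<close>
      obtain a b where ab: "a \<noteq> 0 \<or> b \<noteq> 0" "a * hk + b * hl = 0"
      proof (cases "hk = 0 \<and> hl = 0")
        case True
        then show ?thesis using that [of 1 0] by simp
      next
        case False
        then show ?thesis using that [of hl "- hk"] by (auto simp: mult.commute)
      qed
      define x where "x = (\<lambda>i. a * p k i + b * p l i)"
      have "(\<Sum>i<n. h i * x i) = a * hk + b * hl"
        by (simp add: x_def hk_def hl_def sum_distrib_left sum.distrib algebra_simps)
      then have le: "bil_form {..<n} Q x x \<le> 0" using h ab by simp
      have kl: "k < n" "l < n" "f k > 0" "f l > 0" using k l by (auto simp: pos_def)
      have coord: "(\<Sum>i<n. p m i * x i) = a * of_bool (m = k) + b * of_bool (m = l)" if "m < n" for m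
      proof -
        have "(\<Sum>i<n. p m i * x i) = a * (\<Sum>i<n. p m i * p k i) + b * (\<Sum>i<n. p m i * p l i)"
          by (simp add: x_def sum_distrib_left sum.distrib algebra_simps)
        then show ?thesis using orth [OF that kl(1)] orth [OF that kl(2)] by simp
      qed
      have "bil_form {..<n} Q x x = (\<Sum>m<n. f m * (a * of_bool (m = k) + b * of_bool (m = l))\<^sup>2)"
        unfolding form by (intro sum.cong refl) (simp add: coord)
      also have "\<dots> = (\<Sum>m\<in>{k, l}. f m * (a * of_bool (m = k) + b * of_bool (m = l))\<^sup>2)"
        using kl by (intro sum.mono_neutral_right) auto
      also have "\<dots> = f k * a\<^sup>2 + f l * b\<^sup>2" using \<open>k \<noteq> l\<close> by simp
      also have "\<dots> > 0"
        using ab(1) kl by (smt (verit) mult_nonneg_nonneg mult_pos_pos zero_le_power2 zero_less_power2)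
      finally show False using le by simp
    qed
    then show "card pos \<le> 1" using fin card_le_Suc0_iff_eq by (metis One_nat_def)
  qed
  then show ?thesis using count unfolding A_def by simp
qed

section \<open>Degenerate three-term relations on M-convex sets\<close>

lemma lookup_unit_expo [simp]: "lkp (unit_expo i) k = of_bool (k = i)"
  by (simp add: unit_expo_def lookup_single when_def of_bool_def)

lemma expo_minus_unit_add:
  "lkp \<alpha> i > 0 \<Longrightarrow> \<alpha> - unit_expo i + unit_expo i = \<alpha>"
  by (intro poly_mapping_eqI) (simp add: lookup_add lookup_minus of_bool_def)

lemma in_Delta_bound:
  assumes "\<alpha> \<in> Delta n d" "lkp \<alpha> i > 0"
  shows "i < n"
  using assms in_keys_iff [of i \<alpha>] by (auto simp: Delta_def)

lemma sum_lookup_unit [simp]: "i < n \<Longrightarrow> (\<Sum>k<n. lkp (unit_expo i) k) = 1"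
  by (simp add: of_bool_def)

lemma in_Delta_cancel:
  assumes "\<alpha> + unit_expo i \<in> Delta n (Suc d)"
  shows "\<alpha> \<in> Delta n d"
proof -
  have "i < n" using in_Delta_bound [OF assms, of i] by (simp add: lookup_add)
  moreover have "supp \<alpha> \<subseteq> {..<n}"
    using in_Delta_bound [OF assms] by (auto simp: in_keys_iff lookup_add)
  ultimately show ?thesis
    using assms by (simp add: Delta_def lookup_add sum.distrib del: lookup_unit_expo)
qed

lemma add_unit_in_Delta:
  assumes "\<alpha> \<in> Delta n d" "i < n"
  shows "\<alpha> + unit_expo i \<in> Delta n (Suc d)"
proof -
  have "supp (\<alpha> + unit_expo i) \<subseteq> {..<n}"
    using in_Delta_bound [OF assms(1)] assms(2)
    by (auto simp: in_keys_iff lookup_add of_bool_def split: if_splits)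
  then show ?thesis
    using assms by (simp add: Delta_def lookup_add sum.distrib del: lookup_unit_expo)
qed

lemma finite_Delta: "finite (Delta n d)"
proof -
  have "lkp \<alpha> i \<le> d" if "\<alpha> \<in> Delta n d" "i < n" for \<alpha> i
  proof -
    have "lkp \<alpha> i \<le> (\<Sum>i<n. lkp \<alpha> i)" using that by (intro member_le_sum) auto
    then show ?thesis using that by (simp add: Delta_def)
  qed
  moreover have "lkp \<alpha> i = 0" if "\<alpha> \<in> Delta n d" "\<not> i < n" for \<alpha> i
    using in_Delta_bound that by blast
  ultimately have "lkp ` Delta n d \<subseteq> {f. \<forall>i. (i \<in> {..<n} \<longrightarrow> f i \<in> {..d}) \<and> (i \<notin> {..<n} \<longrightarrow> f i = 0)}"
    by auto
  then have "finite (lkp ` Delta n d)"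
    by (rule finite_subset) (intro finite_set_of_finite_funs; simp)
  then show ?thesis
    by (rule finite_imageD) (auto intro!: inj_onI poly_mapping_eqI)
qed

text \<open>The additive form avoids truncated subtraction.\<close>
lemma M_convex_exchange:
  assumes "M_convex J" "\<alpha> \<in> J" "\<beta> \<in> J" "lkp \<alpha> i < lkp \<beta> i"
  obtains j \<alpha>' \<beta>' where "lkp \<beta> j < lkp \<alpha> j" "\<alpha>' \<in> J" "\<beta>' \<in> J"
    "\<alpha>' + unit_expo j = \<alpha> + unit_expo i" "\<beta>' + unit_expo i = \<beta> + unit_expo j"
proof -
  obtain j where j: "lkp \<beta> j < lkp \<alpha> j" "\<alpha> + unit_expo i - unit_expo j \<in> J" "\<beta> - unit_expo i + unit_expo j \<in> J"
    using assms unfolding M_convex_def by blast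
  show ?thesis
  proof (rule that [OF j])
    show "\<alpha> + unit_expo i - unit_expo j + unit_expo j = \<alpha> + unit_expo i"
      using j(1) by (intro expo_minus_unit_add) (simp add: lookup_add)
    have "\<beta> - unit_expo i + unit_expo j + unit_expo i = (\<beta> - unit_expo i + unit_expo i) + unit_expo j"
      by (simp add: add_ac)
    then show "\<beta> - unit_expo i + unit_expo j + unit_expo i = \<beta> + unit_expo j"
      using assms(4) by (simp add: expo_minus_unit_add)
  qed
qed

text \<open>Call \<open>i\<close>, \<open>j\<close> parallel at \<alpha> if \<alpha> plus both units
  is not in \<open>J\<close>. The contrapositive is transitivity of parallelism through a non-loop
  \<open>j\<close>; for \<open>i = k\<close> it makes an index parallel to some non-loop also
  parallel to itself.\<close>

lemma M_convex_nonloop_trans: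
  assumes "M_convex J" "\<alpha> + unit_expo i + unit_expo k \<in> J" "\<alpha> + unit_expo j + unit_expo l \<in> J"
  shows "\<alpha> + unit_expo i + unit_expo j \<in> J \<or> \<alpha> + unit_expo j + unit_expo k \<in> J"
proof (cases "j = i \<or> j = k")
  case True
  then show ?thesis using assms(2) by (auto simp: add_ac)
next
  case False
  then have "lkp (\<alpha> + unit_expo i + unit_expo k) j < lkp (\<alpha> + unit_expo j + unit_expo l) j"
    by (simp add: lookup_add)
  then obtain m A where m: "lkp (\<alpha> + unit_expo j + unit_expo l) m < lkp (\<alpha> + unit_expo i + unit_expo k) m"
    "A \<in> J" "A + unit_expo m = \<alpha> + unit_expo i + unit_expo k + unit_expo j"
    using M_convex_exchange [OF assms] by blast
  from m(1) have "m = i \<or> m = k" by (auto simp: lookup_add of_bool_def split: if_splits)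
  then show ?thesis
  proof
    assume "m = i"
    then have "A + unit_expo i = (\<alpha> + unit_expo j + unit_expo k) + unit_expo i" using m(3) by (simp add: add_ac)
    then show ?thesis using m(2) by (metis add_right_cancel)
  next
    assume "m = k"
    then have "A + unit_expo k = (\<alpha> + unit_expo i + unit_expo j) + unit_expo k" using m(3) by (simp add: add_ac)
    then show ?thesis using m(2) by (metis add_right_cancel)
  qed
qed

text \<open>The linear content of the three-term relations: \<open>inf_null\<close> asks nothing of
  three nonzero products, but if \<open>e\<close>, \<open>f\<close> are parallel at \<sigma> one
  product vanishes and the other two must agree, so that rows \<open>e\<close> and \<open>f\<close>
  are proportional. \<open>V_space_eq_W_space\<close> identifies this with the space of the
  theorem.\<close>

definition W_space :: "expo set \<Rightarrow> (expo \<Rightarrow> real) set"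
  where "W_space J = {v. (\<forall>\<beta>. \<beta> \<notin> J \<longrightarrow> v \<beta> = 0) \<and>
    (\<forall>\<sigma> e f x y. \<sigma> + unit_expo e + unit_expo x \<in> J \<longrightarrow> \<sigma> + unit_expo f + unit_expo y \<in> J \<longrightarrow>
       \<sigma> + unit_expo f + unit_expo x \<in> J \<longrightarrow> \<sigma> + unit_expo e + unit_expo y \<in> J \<longrightarrow>
       \<sigma> + unit_expo e + unit_expo f \<notin> J \<longrightarrow>
       v (\<sigma> + unit_expo e + unit_expo x) + v (\<sigma> + unit_expo f + unit_expo y)
         = v (\<sigma> + unit_expo f + unit_expo x) + v (\<sigma> + unit_expo e + unit_expo y))}"

lemma W_space_eq:
  assumes "v \<in> W_space J" "\<sigma> + unit_expo e + unit_expo x \<in> J" "\<sigma> + unit_expo f + unit_expo y \<in> J"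
    "\<sigma> + unit_expo f + unit_expo x \<in> J" "\<sigma> + unit_expo e + unit_expo y \<in> J"
    "\<sigma> + unit_expo e + unit_expo f \<notin> J"
  shows "v (\<sigma> + unit_expo e + unit_expo x) + v (\<sigma> + unit_expo f + unit_expo y)
         = v (\<sigma> + unit_expo f + unit_expo x) + v (\<sigma> + unit_expo e + unit_expo y)"
  using assms unfolding W_space_def by blast

text \<open>The matroid case is the fact that the ratio depends on \<open>\<tau>\<close> only through the fundamental circuit
  of \<open>e\<close> in \<open>\<tau> + f\<close>, and dually only through a cocircuit; the hypothesis says that circuit and
  cocircuit meet in \<open>e\<close> and \<open>f\<close> only.\<close>
lemma W_space_ratio:
  assumes J: "J \<subseteq> Delta n d" "M_convex J" and v: "v \<in> W_space J" and "e \<noteq> f"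
    and "\<tau>\<^sub>0 + unit_expo e \<in> J" "\<tau>\<^sub>0 + unit_expo f \<in> J" "\<tau>\<^sub>1 + unit_expo e \<in> J" "\<tau>\<^sub>1 + unit_expo f \<in> J"
    and "\<And>l \<mu>. lkp \<tau>\<^sub>1 l < lkp \<tau>\<^sub>0 l \<Longrightarrow> \<mu> \<in> J \<Longrightarrow>
           \<mu> + unit_expo l = \<tau>\<^sub>0 + unit_expo e + unit_expo f \<Longrightarrow> \<tau>\<^sub>1 + unit_expo l \<notin> J"
  shows "v (\<tau>\<^sub>0 + unit_expo f) - v (\<tau>\<^sub>0 + unit_expo e) = v (\<tau>\<^sub>1 + unit_expo f) - v (\<tau>\<^sub>1 + unit_expo e)"
  using assms(5-)
\<comment> \<open>The truncated differences count the units by which \<open>\<tau>\<^sub>0\<close>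
  exceeds \<open>\<tau>\<^sub>1\<close>; as the degrees agree, 0 means equality.\<close>
proof (induction "\<Sum>l<n. lkp \<tau>\<^sub>0 l - lkp \<tau>\<^sub>1 l" arbitrary: \<tau>\<^sub>0 \<tau>\<^sub>1 rule: less_induct)
  case less
  note ex = M_convex_exchange [OF J(2)]
  let ?u = unit_expo
  show ?case
  proof (cases "\<exists>x. lkp \<tau>\<^sub>1 x < lkp \<tau>\<^sub>0 x")
    case False
    have "\<tau>\<^sub>0 + ?u e \<in> Delta n d" "\<tau>\<^sub>1 + ?u e \<in> Delta n d" using less.prems J by auto
    then have sum: "(\<Sum>l<n. lkp \<tau>\<^sub>0 l) = (\<Sum>l<n. lkp \<tau>\<^sub>1 l)"
      by (auto simp: Delta_def lookup_add sum.distrib)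
    have "lkp \<tau>\<^sub>0 l = lkp \<tau>\<^sub>1 l" if "l < n" for l
      using sum_mono_inv [OF sum] False that by (simp add: not_less)
    moreover have "lkp \<tau>\<^sub>0 l = lkp \<tau>\<^sub>1 l" if "\<not> l < n" for l
      using in_Delta_bound [OF \<open>\<tau>\<^sub>0 + ?u e \<in> Delta n d\<close>, of l] in_Delta_bound [OF \<open>\<tau>\<^sub>1 + ?u e \<in> Delta n d\<close>, of l] that
      by (simp add: lookup_add) (metis gr_zeroI)
    ultimately have "\<tau>\<^sub>0 = \<tau>\<^sub>1" by (intro poly_mapping_eqI) blast
    then show ?thesis by simp
  next
    case True
    then obtain x where x: "lkp \<tau>\<^sub>1 x < lkp \<tau>\<^sub>0 x" by blast
    \<comment> \<open>At \<open>l = e\<close> the last hypothesis would contradict that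
      \<open>\<tau>\<^sub>1 + unit_expo e\<close> lies in \<open>J\<close>; likewise for
      \<open>f\<close>.\<close>
    have "x \<noteq> e" using less.prems(5) [OF x, of "\<tau>\<^sub>0 + ?u f"] less.prems by (auto simp: add_ac)
    moreover have "x \<noteq> f" using less.prems(5) [OF x, of "\<tau>\<^sub>0 + ?u e"] less.prems by (auto simp: add_ac)
    ultimately have xef: "x \<noteq> e" "x \<noteq> f" .
    have "x < n" using in_Delta_bound [of "\<tau>\<^sub>0 + ?u e" n d x] less.prems(1) J x by (auto simp: lookup_add)
    have "lkp (\<tau>\<^sub>1 + ?u f) x < lkp (\<tau>\<^sub>0 + ?u f) x" using x by (simp add: lookup_add)
    from ex [OF less.prems(4,2) this] obtain y \<alpha> \<beta> where
      "lkp (\<tau>\<^sub>0 + ?u f) y < lkp (\<tau>\<^sub>1 + ?u f) y" and \<alpha>: "\<alpha> \<in> J" "\<alpha> + ?u y = \<tau>\<^sub>1 + ?u f + ?u x"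
      and \<beta>: "\<beta> \<in> J" "\<beta> + ?u x = \<tau>\<^sub>0 + ?u f + ?u y" by blast
    then have y: "lkp \<tau>\<^sub>0 y < lkp \<tau>\<^sub>1 y" by (simp add: lookup_add)
    have xy: "x \<noteq> y" using x y by auto
    \<comment> \<open>If \<open>\<tau>\<^sub>1 + unit_expo x\<close> lies in \<open>J\<close>, the
      hypothesis at \<open>x\<close> makes \<open>e\<close>, \<open>f\<close> parallel at
      \<open>\<tau>\<^sub>0\<close> minus \<open>x\<close>, and \<open>\<tau>\<^sub>0\<close> moves
      one step towards \<open>\<tau>\<^sub>1\<close>. Otherwise \<open>x\<close>, \<open>y\<close>
      are parallel at \<open>\<tau>\<^sub>1\<close> minus \<open>y\<close>, and the dual step moves
      \<open>\<tau>\<^sub>1\<close>.\<close>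
    show ?thesis
    proof (cases "\<tau>\<^sub>1 + ?u x \<in> J")
      case True
      define \<rho> where "\<rho> = \<tau>\<^sub>0 - ?u x"
      have \<tau>\<^sub>0: "\<tau>\<^sub>0 = \<rho> + ?u x" using x by (simp add: \<rho>_def expo_minus_unit_add)
      have notin: "\<rho> + ?u e + ?u f \<notin> J"
        using less.prems(5) [OF x, of "\<rho> + ?u e + ?u f"] True by (auto simp: \<tau>\<^sub>0 add_ac)
      have fy: "\<rho> + ?u y + ?u f \<in> J"
      proof -
        have "\<beta> + ?u x = (\<rho> + ?u y + ?u f) + ?u x" using \<beta>(2) by (simp add: \<tau>\<^sub>0 add_ac)
        then show ?thesis using \<beta>(1) by (metis add_right_cancel)
      qed
      have "y \<noteq> e" using notin fy by (auto simp: add_ac)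
      have ey: "\<rho> + ?u y + ?u e \<in> J"
      proof -
        have "lkp (\<rho> + ?u y + ?u f) e < lkp (\<tau>\<^sub>0 + ?u e) e"
          using \<open>e \<noteq> f\<close> \<open>y \<noteq> e\<close> by (simp add: \<tau>\<^sub>0 lookup_add)
        from ex [OF fy less.prems(1) this] obtain j A B where
          j: "lkp (\<tau>\<^sub>0 + ?u e) j < lkp (\<rho> + ?u y + ?u f) j" "A \<in> J" "B \<in> J"
            "A + ?u j = \<rho> + ?u y + ?u f + ?u e" "B + ?u e = \<tau>\<^sub>0 + ?u e + ?u j" .
        have "j \<noteq> y"
        proof
          assume "j = y"
          then have "A + ?u y = (\<rho> + ?u e + ?u f) + ?u y" using j(4) by (simp add: add_ac)
          then show False using j(2) notin by (metis add_right_cancel)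
        qed
        then have "j = f" using j(1) by (auto simp: \<tau>\<^sub>0 lookup_add of_bool_def split: if_splits)
        then have "A + ?u f = (\<rho> + ?u y + ?u e) + ?u f" using j(4) by (simp add: add_ac)
        then show ?thesis using j(2) by (metis add_right_cancel)
      qed
      have "v (\<rho> + ?u e + ?u x) + v (\<rho> + ?u f + ?u y) = v (\<rho> + ?u f + ?u x) + v (\<rho> + ?u e + ?u y)"
        using less.prems ey fy notin by (intro W_space_eq [OF v]) (simp_all add: \<tau>\<^sub>0 add_ac)
      moreover have "v (\<rho> + ?u y + ?u f) - v (\<rho> + ?u y + ?u e) = v (\<tau>\<^sub>1 + ?u f) - v (\<tau>\<^sub>1 + ?u e)"
      proof (rule less.hyps)
        show "(\<Sum>l<n. lkp (\<rho> + ?u y) l - lkp \<tau>\<^sub>1 l) < (\<Sum>l<n. lkp \<tau>\<^sub>0 l - lkp \<tau>\<^sub>1 l)"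
        proof (rule sum_strict_mono_ex1)
          show "\<forall>l\<in>{..<n}. lkp (\<rho> + ?u y) l - lkp \<tau>\<^sub>1 l \<le> lkp \<tau>\<^sub>0 l - lkp \<tau>\<^sub>1 l"
            using y xy by (auto simp: \<tau>\<^sub>0 lookup_add of_bool_def split: if_splits)
          show "\<exists>l\<in>{..<n}. lkp (\<rho> + ?u y) l - lkp \<tau>\<^sub>1 l < lkp \<tau>\<^sub>0 l - lkp \<tau>\<^sub>1 l"
            using x xy \<open>x < n\<close> by (intro bexI [of _ x]) (auto simp: \<tau>\<^sub>0 lookup_add)
        qed simp
      next
        fix l \<mu>
        assume l: "lkp \<tau>\<^sub>1 l < lkp (\<rho> + ?u y) l" and \<mu>: "\<mu> \<in> J" "\<mu> + ?u l = \<rho> + ?u y + ?u e + ?u f"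
        have "l \<noteq> y" using l y xy by (auto simp: \<tau>\<^sub>0 lookup_add)
        then have l': "lkp \<tau>\<^sub>1 l < lkp \<tau>\<^sub>0 l" using l by (simp add: \<tau>\<^sub>0 lookup_add)
        have lkp_\<mu>: "lkp \<mu> m + of_bool (m = l) = lkp \<rho> m + of_bool (m = y) + of_bool (m = e) + of_bool (m = f)" for m
          using arg_cong [OF \<mu>(2), of "\<lambda>\<beta>. lkp \<beta> m"] by (simp add: lookup_add)
        have "lkp \<mu> x < lkp (\<tau>\<^sub>0 + ?u f) x"
          using lkp_\<mu> [of x] xy xef by (simp add: \<tau>\<^sub>0 lookup_add)
        \<comment> \<open>Trading \<open>y\<close> for \<open>x\<close> in \<mu> gives an element
          \<open>A\<close> that belongs to the old \<open>\<tau>\<^sub>0\<close> with the same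
          \<open>l\<close>, so the old hypothesis applies.\<close>
        from ex [OF \<mu>(1) less.prems(2) this] obtain j A B where
          j: "lkp (\<tau>\<^sub>0 + ?u f) j < lkp \<mu> j" "A \<in> J" "B \<in> J"
            "A + ?u j = \<mu> + ?u x" "B + ?u x = \<tau>\<^sub>0 + ?u f + ?u j" .
        have "j \<noteq> e"
        proof
          assume "j = e"
          then have "B + ?u x = (\<rho> + ?u e + ?u f) + ?u x" using j(5) by (simp add: \<tau>\<^sub>0 add_ac)
          then show False using j(3) notin by (metis add_right_cancel)
        qed
        then have "j = y" using j(1) lkp_\<mu> [of j] by (auto simp: \<tau>\<^sub>0 lookup_add of_bool_def split: if_splits)
        have "(A + ?u l) + ?u y = (\<mu> + ?u l) + ?u x" using j(4) \<open>j = y\<close> by (metis add.assoc add.commute)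
        also have "\<dots> = (\<tau>\<^sub>0 + ?u e + ?u f) + ?u y" unfolding \<mu>(2) by (simp add: \<tau>\<^sub>0 add_ac)
        finally have "A + ?u l = \<tau>\<^sub>0 + ?u e + ?u f" by (metis add_right_cancel)
        then show "\<tau>\<^sub>1 + ?u l \<notin> J" using less.prems(5) [OF l' j(2)] by simp
      qed (use ey fy less.prems in auto)
      ultimately show ?thesis by (simp add: \<tau>\<^sub>0 add_ac)
    next
      case False
      define \<rho> where "\<rho> = \<tau>\<^sub>1 - ?u y"
      have \<tau>\<^sub>1: "\<tau>\<^sub>1 = \<rho> + ?u y" using y by (simp add: \<rho>_def expo_minus_unit_add)
      have notin: "\<rho> + ?u x + ?u y \<notin> J" using False by (simp add: \<tau>\<^sub>1 add_ac)
      have fx: "\<rho> + ?u x + ?u f \<in> J"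
      proof -
        have "\<alpha> + ?u y = (\<rho> + ?u x + ?u f) + ?u y" using \<alpha>(2) by (simp add: \<tau>\<^sub>1 add_ac)
        then show ?thesis using \<alpha>(1) by (metis add_right_cancel)
      qed
      have ex': "\<rho> + ?u x + ?u e \<in> J"
      proof -
        have "lkp (\<rho> + ?u x + ?u f) e < lkp (\<tau>\<^sub>1 + ?u e) e"
          using \<open>e \<noteq> f\<close> xef by (simp add: \<tau>\<^sub>1 lookup_add)
        from ex [OF fx less.prems(3) this] obtain j A B where
          j: "lkp (\<tau>\<^sub>1 + ?u e) j < lkp (\<rho> + ?u x + ?u f) j" "A \<in> J" "B \<in> J"
            "A + ?u j = \<rho> + ?u x + ?u f + ?u e" "B + ?u e = \<tau>\<^sub>1 + ?u e + ?u j" .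
        have "j \<noteq> x"
        proof
          assume "j = x"
          then have "B + ?u e = (\<rho> + ?u x + ?u y) + ?u e" using j(5) by (simp add: \<tau>\<^sub>1 add_ac)
          then show False using j(3) notin by (metis add_right_cancel)
        qed
        then have "j = f" using j(1) by (auto simp: \<tau>\<^sub>1 lookup_add of_bool_def split: if_splits)
        then have "A + ?u f = (\<rho> + ?u x + ?u e) + ?u f" using j(4) by (simp add: add_ac)
        then show ?thesis using j(2) by (metis add_right_cancel)
      qed
      have "v (\<rho> + ?u x + ?u e) + v (\<rho> + ?u y + ?u f) = v (\<rho> + ?u y + ?u e) + v (\<rho> + ?u x + ?u f)"
        using less.prems ex' fx notin by (intro W_space_eq [OF v]) (simp_all add: \<tau>\<^sub>1)
      moreover have "v (\<tau>\<^sub>0 + ?u f) - v (\<tau>\<^sub>0 + ?u e) = v (\<rho> + ?u x + ?u f) - v (\<rho> + ?u x + ?u e)"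
      proof (rule less.hyps)
        show "(\<Sum>l<n. lkp \<tau>\<^sub>0 l - lkp (\<rho> + ?u x) l) < (\<Sum>l<n. lkp \<tau>\<^sub>0 l - lkp \<tau>\<^sub>1 l)"
        proof (rule sum_strict_mono_ex1)
          show "\<forall>l\<in>{..<n}. lkp \<tau>\<^sub>0 l - lkp (\<rho> + ?u x) l \<le> lkp \<tau>\<^sub>0 l - lkp \<tau>\<^sub>1 l"
            using y xy by (auto simp: \<tau>\<^sub>1 lookup_add of_bool_def split: if_splits)
          show "\<exists>l\<in>{..<n}. lkp \<tau>\<^sub>0 l - lkp (\<rho> + ?u x) l < lkp \<tau>\<^sub>0 l - lkp \<tau>\<^sub>1 l"
            using x xy \<open>x < n\<close> by (intro bexI [of _ x]) (auto simp: \<tau>\<^sub>1 lookup_add)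
        qed simp
      next
        fix l \<mu>
        assume l: "lkp (\<rho> + ?u x) l < lkp \<tau>\<^sub>0 l" and \<mu>: "\<mu> \<in> J" "\<mu> + ?u l = \<tau>\<^sub>0 + ?u e + ?u f"
        show "\<rho> + ?u x + ?u l \<notin> J"
        proof
          assume xl: "\<rho> + ?u x + ?u l \<in> J"
          have "l \<noteq> y" using l y xy by (auto simp: \<tau>\<^sub>1 lookup_add)
          then have l': "lkp \<tau>\<^sub>1 l < lkp \<tau>\<^sub>0 l" using l by (simp add: \<tau>\<^sub>1 lookup_add)
          have "lkp (\<rho> + ?u x + ?u l) y < lkp (\<tau>\<^sub>1 + ?u f) y"
            using \<open>l \<noteq> y\<close> xy by (simp add: \<tau>\<^sub>1 lookup_add)
          from ex [OF xl less.prems(4) this] obtain j A where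
            j: "lkp (\<tau>\<^sub>1 + ?u f) j < lkp (\<rho> + ?u x + ?u l) j" "A \<in> J"
              "A + ?u j = \<rho> + ?u x + ?u l + ?u y" by blast
          have "j \<noteq> l"
          proof
            assume "j = l"
            then have "A + ?u l = (\<rho> + ?u x + ?u y) + ?u l" using j(3) by (simp add: add_ac)
            then show False using j(2) notin by (metis add_right_cancel)
          qed
          then have "j = x" using j(1) by (auto simp: \<tau>\<^sub>1 lookup_add of_bool_def split: if_splits)
          then have "A + ?u x = (\<tau>\<^sub>1 + ?u l) + ?u x" using j(3) by (simp add: \<tau>\<^sub>1 add_ac)
          then have "\<tau>\<^sub>1 + ?u l \<in> J" using j(2) by (metis add_right_cancel)
          then show False using less.prems(5) [OF l' \<mu>] by simp
        qed
      qed (use ex' fx less.prems in auto)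
      ultimately show ?thesis by (simp add: \<tau>\<^sub>1 add_ac)
    qed
  qed
qed

section \<open>Strong representations\<close>

text \<open>With a third nonzero term the list is null at once; without one the two partners are
  equal and, by nonnegativity, attain the maximum.\<close>

lemma inf_nullI:
  fixes t :: "nat \<Rightarrow> real"
  assumes nonneg: "\<And>k. k \<le> s \<Longrightarrow> t k \<ge> 0"
    and ex: "\<And>k. k \<le> s \<Longrightarrow> t k \<noteq> 0 \<Longrightarrow> \<exists>k'\<le>s. k' \<noteq> k \<and> t k' \<noteq> 0 \<and>
      ((\<forall>m\<le>s. t m \<noteq> 0 \<longrightarrow> m \<in> {k, k'}) \<longrightarrow> t k = t k')"
  shows "inf_null (map t [0..<Suc s])"
proof -
  define bs where "bs = map t [0..<Suc s]"
  have len: "length bs = Suc s" and nth: "\<And>k. k \<le> s \<Longrightarrow> bs ! k = t k"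
    unfolding bs_def by (simp, subst nth_map, simp_all del: upt_Suc)
  have set: "set bs = t ` {..s}"
    unfolding bs_def by (simp del: upt_Suc) (simp add: atLeast0AtMost [symmetric] atLeastLessThanSuc_atLeastAtMost del: upt_Suc)
  have nz: "{k. k < length bs \<and> bs ! k \<noteq> 0} = {k. k \<le> s \<and> t k \<noteq> 0}" (is "?L = ?N")
    by (auto simp: len nth less_Suc_eq_le)
  show ?thesis
  proof (cases "\<forall>k\<le>s. t k = 0")
    case True
    then show ?thesis unfolding inf_null_def bs_def [symmetric] set by simp
  next
    case False
    then obtain k where k: "k \<le> s" "t k \<noteq> 0" by blast
    from ex [OF k] obtain k' where k': "k' \<le> s" "k' \<noteq> k" "t k' \<noteq> 0"
      and eq: "(\<forall>m\<le>s. t m \<noteq> 0 \<longrightarrow> m \<in> {k, k'}) \<Longrightarrow> t k = t k'" by blast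
    show ?thesis
    proof (cases "\<forall>m\<le>s. t m \<noteq> 0 \<longrightarrow> m \<in> {k, k'}")
      case True
      have max: "Max (set bs) = t k"
      proof (rule Max_eqI)
        show "b \<le> t k" if b: "b \<in> set bs" for b
        proof -
          obtain m where m: "m \<le> s" "b = t m" using b by (auto simp: set)
          then show ?thesis using True eq [OF True] nonneg [OF k(1)] by (cases "t m = 0") auto
        qed
      qed (use k in \<open>auto simp: set\<close>)
      have "{k, k'} \<subseteq> {m. m < length bs \<and> bs ! m = Max (set bs)}"
        unfolding max using k k' eq [OF True] by (auto simp: len nth)
      then have "card {k, k'} \<le> card {m. m < length bs \<and> bs ! m = Max (set bs)}"
        by (intro card_mono) auto
      then show ?thesis using k'(2) unfolding inf_null_def bs_def [symmetric] by simp
    next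
      case False
      then obtain m where m: "m \<le> s" "t m \<noteq> 0" "m \<notin> {k, k'}" by blast
      have "card {k, k', m} \<le> card ?N" using k k' m by (intro card_mono) auto
      then show ?thesis using k'(2) m(3) nz unfolding inf_null_def bs_def [symmetric] by auto
    qed
  qed
qed

lemma inf_null_three:
  assumes "inf_null [a, b, c]" "a \<ge> 0" "b \<ge> 0" "c \<ge> 0"
  shows "a = 0 \<Longrightarrow> b = c" "b = 0 \<Longrightarrow> a = c" "c = 0 \<Longrightarrow> a = b"
proof -
  have three: "{k. k < length [a, b, c] \<and> P k} = (if P 0 then {0} else {}) \<union> (if P 1 then {1} else {})
      \<union> (if P 2 then {2} else {})" for P :: "nat \<Rightarrow> bool"
    by (auto simp: less_Suc_eq numeral_2_eq_2) (metis gr0I)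
  show "a = 0 \<Longrightarrow> b = c" "b = 0 \<Longrightarrow> a = c" "c = 0 \<Longrightarrow> a = b"
    using assms unfolding inf_null_def three by (auto split: if_splits simp: max_def)
qed

lemma sum_unit_lookup:
  "lkp (\<Sum>m\<in>A. unit_expo (i m)) e = (\<Sum>m\<in>A. of_bool (e = i m))"
  by (simp add: lookup_sum)

text \<open>Exchange between the two factors of a nonzero product, in direction \<open>i k\<close>,
  yields a second nonzero product. If there is no third, the last hypothesis of
  \<open>W_space_ratio\<close> holds, because an index violating it would give one.\<close>

lemma W_space_strong_rep:
  assumes J: "J \<subseteq> Delta n d" "M_convex J" and v: "v \<in> W_space J"
  shows "strong_rep n d J (\<lambda>\<beta>. if \<beta> \<in> J then exp (v \<beta>) else 0)"
  unfolding strong_rep_def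
proof (intro conjI allI impI)
  let ?u = unit_expo and ?\<rho> = "\<lambda>\<beta>. if \<beta> \<in> J then exp (v \<beta>) else 0 :: real"
  show "\<forall>\<alpha>\<in>Delta n d. 0 \<le> ?\<rho> \<alpha>" by simp
  show "{\<alpha> \<in> Delta n d. ?\<rho> \<alpha> \<noteq> 0} = J" using J by auto
  fix s \<alpha> and i j :: "nat \<Rightarrow> nat"
  define G where "G = \<alpha> + (\<Sum>m\<in>{2..s}. ?u (j m))"
  define T where "T = \<alpha> + (\<Sum>m\<in>{0..s}. ?u (i m))"
  define \<beta> where "\<beta> = (\<lambda>k. \<alpha> + (\<Sum>m\<in>{0..s} - {k}. ?u (i m)))"
  define \<gamma> where "\<gamma> = (\<lambda>k. \<alpha> + ?u (i k) + (\<Sum>m\<in>{2..s}. ?u (j m)))"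
  define t where "t = (\<lambda>k. ?\<rho> (\<beta> k) * ?\<rho> (\<gamma> k))"
  have \<gamma>_eq: "\<gamma> k = G + ?u (i k)" for k by (simp add: \<gamma>_def G_def add_ac)
  have \<beta>T: "\<beta> k + ?u (i k) = T" if "k \<le> s" for k
  proof -
    have "(\<Sum>m\<in>{0..s}. ?u (i m)) = ?u (i k) + (\<Sum>m\<in>{0..s} - {k}. ?u (i m))"
      using that by (intro sum.remove) auto
    then show ?thesis by (simp add: \<beta>_def T_def add_ac)
  qed
  have t0: "t k \<noteq> 0 \<longleftrightarrow> \<beta> k \<in> J \<and> \<gamma> k \<in> J" for k by (simp add: t_def)
  have t_cong: "t k = t k'" if "i k = i k'" "k \<le> s" "k' \<le> s" for k k'
    using \<beta>T [OF that(2)] \<beta>T [OF that(3)] that(1) by (simp add: t_def \<gamma>_eq) (metis add_right_cancel)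
  have T_once: "lkp T (i k) = lkp \<alpha> (i k) + 1" if k: "k \<le> s" and once: "\<And>m. m \<le> s \<Longrightarrow> m \<noteq> k \<Longrightarrow> i m \<noteq> i k" for k
  proof -
    have "of_bool (i k = i m) = (0 :: nat)" if "m \<in> {0..s} - {k}" for m
      using once [of m] that by auto
    then have "(\<Sum>m\<in>{0..s}. of_bool (i k = i m)) = (\<Sum>m\<in>{k}. of_bool (i k = i m) :: nat)"
      using k by (intro sum.mono_neutral_right) auto
    then show ?thesis by (simp add: T_def lookup_add sum_unit_lookup)
  qed
  have "inf_null (map t [0..<Suc s])"
  proof (rule inf_nullI)
    show "t k \<ge> 0" for k by (simp add: t_def)
    fix k assume k: "k \<le> s" "t k \<noteq> 0"
    show "\<exists>k'\<le>s. k' \<noteq> k \<and> t k' \<noteq> 0 \<and> ((\<forall>m\<le>s. t m \<noteq> 0 \<longrightarrow> m \<in> {k, k'}) \<longrightarrow> t k = t k')"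
    proof (cases "\<exists>k'\<le>s. k' \<noteq> k \<and> i k' = i k")
      case True
      \<comment> \<open>A repeated index produces the same product twice.\<close>
      then show ?thesis using t_cong k by metis
    next
      case False
      have kJ: "\<beta> k \<in> J" "\<gamma> k \<in> J" using k t0 by auto
      have T_k: "lkp T (i k) = lkp \<alpha> (i k) + 1" using T_once k(1) False by blast
      \<comment> \<open>As \<open>i k\<close> occurs only once, \<open>\<beta> k\<close> has the
        entry of \<alpha> there, and \<open>\<gamma> k\<close> at least one unit more.\<close>
      have "lkp (\<beta> k) (i k) < lkp (\<gamma> k) (i k)"
        using arg_cong [OF \<beta>T [OF k(1)], of "\<lambda>\<beta>. lkp \<beta> (i k)"] T_k
        by (simp add: \<gamma>_eq G_def lookup_add)
      from M_convex_exchange [OF J(2) kJ this] obtain l A B where l: "lkp (\<gamma> k) l < lkp (\<beta> k) l"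
        "A \<in> J" "B \<in> J" "A + ?u l = \<beta> k + ?u (i k)" "B + ?u (i k) = \<gamma> k + ?u l" .
      \<comment> \<open>The direction \<open>l\<close> must be some \<open>i k'\<close>: elsewhere
        \<open>\<beta> k\<close> agrees with \<alpha>, which \<open>\<gamma> k\<close>
        dominates.\<close>
      have "(\<Sum>m\<in>{0..s} - {k}. of_bool (l = i m) :: nat) \<noteq> 0"
      proof
        assume "(\<Sum>m\<in>{0..s} - {k}. of_bool (l = i m) :: nat) = 0"
        then have "lkp (\<beta> k) l = lkp \<alpha> l" by (simp add: \<beta>_def lookup_add sum_unit_lookup)
        then show False using l(1) by (simp add: \<gamma>_eq G_def lookup_add)
      qed
      then obtain k' where "k' \<in> {0..s} - {k}" "of_bool (l = i k') \<noteq> (0 :: nat)"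
        by (rule sum.not_neutral_contains_not_neutral)
      then have k': "k' \<le> s" "k' \<noteq> k" "i k' = l" by auto
      have "\<beta> k' + ?u l = A + ?u l" using \<beta>T [OF k'(1)] \<beta>T [OF k(1)] k'(3) l(4) by simp
      then have \<beta>k': "\<beta> k' = A" by simp
      have "\<gamma> k' + ?u (i k) = B + ?u (i k)" using l(5) by (simp add: \<gamma>_eq k'(3) add_ac)
      then have \<gamma>k': "\<gamma> k' = B" by simp
      have k'J: "\<beta> k' \<in> J" "\<gamma> k' \<in> J" using \<beta>k' \<gamma>k' l by auto
      have "t k = t k'" if only: "\<forall>m\<le>s. t m \<noteq> 0 \<longrightarrow> m \<in> {k, k'}"
      proof -
        let ?e = "i k" and ?f = "i k'"
        have ef: "?e \<noteq> ?f" using False k' by metis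
        have T_k': "lkp T ?f = lkp \<alpha> ?f + 1"
        proof (rule T_once [OF k'(1)])
          fix m assume m: "m \<le> s" "m \<noteq> k'"
          show "i m \<noteq> i k'"
          proof
            assume eq: "i m = i k'"
            then have "t m = t k'" using t_cong m k' by blast
            then have "t m \<noteq> 0" using t0 k'J by simp
            then have "m = k" using only m by auto
            then show False using eq ef by simp
          qed
        qed
        define \<tau> where "\<tau> = \<beta> k - ?u ?f"
        have \<tau>f: "\<tau> + ?u ?f = \<beta> k"
          using l(1) k'(3) by (simp add: \<tau>_def expo_minus_unit_add)
        have "\<beta> k' + ?u ?f = (\<tau> + ?u ?e) + ?u ?f"
          using \<beta>T [OF k'(1)] \<beta>T [OF k(1)] \<tau>f by (metis add.assoc add.commute)
        then have \<tau>e: "\<tau> + ?u ?e = \<beta> k'" by simp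
        have \<tau>ef: "\<tau> + ?u ?e + ?u ?f = T" using \<beta>T [OF k'(1)] \<tau>e by simp
        have "v (\<tau> + ?u ?f) - v (\<tau> + ?u ?e) = v (G + ?u ?f) - v (G + ?u ?e)"
        proof (rule W_space_ratio [OF J v ef])
          fix l \<mu> assume l: "lkp G l < lkp \<tau> l" and \<mu>: "\<mu> \<in> J" "\<mu> + ?u l = \<tau> + ?u ?e + ?u ?f"
          show "G + ?u l \<notin> J"
          proof
            assume Gl: "G + ?u l \<in> J"
            have G_ge: "lkp \<alpha> l \<le> lkp G l" by (simp add: G_def lookup_add)
            have T_l: "lkp T l = lkp \<tau> l + of_bool (l = ?e) + of_bool (l = ?f)"
              by (simp add: lookup_add flip: \<tau>ef)
            have "l \<noteq> ?e" "l \<noteq> ?f" using T_l G_ge l T_k T_k' ef by auto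
            have "(\<Sum>m\<in>{0..s}. of_bool (l = i m) :: nat) \<noteq> 0"
            proof
              assume "(\<Sum>m\<in>{0..s}. of_bool (l = i m) :: nat) = 0"
              then have "lkp T l = lkp \<alpha> l" by (simp add: T_def lookup_add sum_unit_lookup)
              then show False using T_l G_ge l by simp
            qed
            then obtain m where "m \<in> {0..s}" "of_bool (l = i m) \<noteq> (0 :: nat)"
              by (rule sum.not_neutral_contains_not_neutral)
            then have m: "m \<le> s" "i m = l" by auto
            have "\<beta> m + ?u l = \<mu> + ?u l" using \<beta>T [OF m(1)] m(2) \<mu>(2) \<tau>ef by simp
            then have "t m \<noteq> 0" using \<mu>(1) Gl m(2) by (simp add: t0 \<gamma>_eq)
            then show False using only m \<open>l \<noteq> ?e\<close> \<open>l \<noteq> ?f\<close> by auto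
          qed
        qed (use kJ k'J \<tau>e \<tau>f in \<open>auto simp: \<gamma>_eq\<close>)
        then have "v (\<beta> k) + v (\<gamma> k) = v (\<beta> k') + v (\<gamma> k')"
          by (simp add: \<tau>e \<tau>f \<gamma>_eq)
        then show ?thesis using kJ k'J by (simp add: t_def flip: exp_add)
      qed
      then show ?thesis using k' k'J t0 by blast
    qed
  qed
  then show "inf_null (map (\<lambda>k. ?\<rho> (\<alpha> + (\<Sum>m\<in>{0..s} - {k}. ?u (i m))) *
      ?\<rho> (\<alpha> + ?u (i k) + (\<Sum>m\<in>{2..s}. ?u (j m)))) [0..<Suc s])"
    unfolding t_def \<beta>_def \<gamma>_def .
qed

lemma strong_rep_three_term:
  assumes \<rho>: "strong_rep n d J \<rho>" and "d \<ge> 2" "\<sigma> \<in> Delta n (d - 2)"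
    and order: "a < b" "b < c" and n: "a < n" "b < n" "c < n" "y < n"
    and bounds: "delta_minus J \<le> lkp \<sigma>"
      "lkp (\<sigma> + unit_expo a + unit_expo b + unit_expo c + unit_expo y) \<le> delta_plus J"
  shows "inf_null [\<rho> (\<sigma> + unit_expo b + unit_expo c) * \<rho> (\<sigma> + unit_expo a + unit_expo y),
    \<rho> (\<sigma> + unit_expo a + unit_expo c) * \<rho> (\<sigma> + unit_expo b + unit_expo y),
    \<rho> (\<sigma> + unit_expo a + unit_expo b) * \<rho> (\<sigma> + unit_expo c + unit_expo y)]"
proof -
  define i where "i = (\<lambda>m::nat. if m = 0 then a else if m = 1 then b else c)"
  have sets: "{0..2::nat} = {0, 1, 2}" "{0, 1, 2} - {0::nat} = {1, 2}" "{0, 1, 2} - {1::nat} = {0, 2}"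
    "{0, 1, 2} - {2::nat} = {0, 1}" "{2..2::nat} = {2}"
    by auto
  have list: "[0..<Suc 2] = [0, 1, 2]" by (simp add: upt_rec)
  have "inf_null (map (\<lambda>k. \<rho> (\<sigma> + (\<Sum>m\<in>{0..2} - {k}. unit_expo (i m))) *
          \<rho> (\<sigma> + unit_expo (i k) + (\<Sum>m\<in>{2..2::nat}. unit_expo y))) [0..<Suc 2])"
  proof (rule \<rho> [unfolded strong_rep_def, THEN conjunct2, THEN conjunct2, rule_format, of 2 \<sigma> i "\<lambda>_. y"],
      intro conjI)
    show "mono_on {0..2} i" using order unfolding sets i_def by (auto intro!: mono_onI)
    show "i ` {0..2} \<subseteq> {..<n}" using n by (auto simp: i_def)
    show "lkp (\<sigma> + (\<Sum>m\<in>{0..2}. unit_expo (i m)) + (\<Sum>m\<in>{2..2::nat}. unit_expo y)) \<le> delta_plus J"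
      using bounds(2) unfolding sets by (simp add: i_def add_ac)
  qed (use assms in \<open>auto intro!: mono_onI\<close>)
  then show ?thesis unfolding list list.map sets by (simp add: i_def add_ac)
qed

text \<open>In the relation with \<open>s = 2\<close> for \<open>e\<close>, \<open>f\<close>,
  \<open>x\<close> against \<open>y\<close> one product vanishes, so the other two agree. Index
  sequences are increasing, hence one case for each ordering of \<open>e\<close>, \<open>f\<close>,
  \<open>x\<close>.\<close>

lemma strong_rep_W_space:
  assumes J: "J \<subseteq> Delta n d" "M_convex J" and \<rho>: "strong_rep n d J \<rho>"
  shows "(\<lambda>\<alpha>. if \<alpha> \<in> J then ln (\<rho> \<alpha>) else 0) \<in> W_space J"
proof -
  let ?u = unit_expo and ?v = "\<lambda>\<alpha>. if \<alpha> \<in> J then ln (\<rho> \<alpha>) else 0"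
  have fin: "finite J" using J finite_Delta finite_subset by blast
  have \<rho>0: "\<rho> \<beta> \<ge> 0" if "\<beta> \<in> Delta n d" for \<beta> using \<rho> that by (simp add: strong_rep_def)
  have \<rho>J: "\<rho> \<beta> \<noteq> 0 \<longleftrightarrow> \<beta> \<in> J" if "\<beta> \<in> Delta n d" for \<beta>
    using \<rho> that unfolding strong_rep_def by blast
  have dm: "delta_minus J l \<le> lkp \<beta> l" and dp: "lkp \<beta> l \<le> delta_plus J l" if "\<beta> \<in> J" for \<beta> l
    using that fin by (auto simp: delta_minus_def delta_plus_def)
  have rel: "?v (\<sigma> + ?u e + ?u x) + ?v (\<sigma> + ?u f + ?u y) = ?v (\<sigma> + ?u f + ?u x) + ?v (\<sigma> + ?u e + ?u y)"
    if in_J: "\<sigma> + ?u e + ?u x \<in> J" "\<sigma> + ?u f + ?u y \<in> J" "\<sigma> + ?u f + ?u x \<in> J" "\<sigma> + ?u e + ?u y \<in> J"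
      and ef: "\<sigma> + ?u e + ?u f \<notin> J" for \<sigma> e f x y
  proof (cases "e = f \<or> x = y")
    case True
    then show ?thesis by auto
  next
    case False
    have ne: "e \<noteq> x" "e \<noteq> y" "f \<noteq> x" "f \<noteq> y" using in_J ef by (auto simp: add_ac)
    have \<Delta>: "\<sigma> + ?u e + ?u x \<in> Delta n d" "\<sigma> + ?u f + ?u y \<in> Delta n d" using in_J J by auto
    have n: "e < n" "x < n" "f < n" "y < n"
      using in_Delta_bound [OF \<Delta>(1), of e] in_Delta_bound [OF \<Delta>(1), of x]
        in_Delta_bound [OF \<Delta>(2), of f] in_Delta_bound [OF \<Delta>(2), of y] by (simp_all add: lookup_add)
    have "d \<noteq> 0 \<and> d \<noteq> 1"
      using \<Delta>(1) n by (auto simp: Delta_def lookup_add sum.distrib simp del: lookup_unit_expo)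
    then obtain d' where d': "d = Suc (Suc d')" by (metis One_nat_def not0_implies_Suc)
    have \<sigma>: "\<sigma> \<in> Delta n (d - 2)" using \<Delta>(1) unfolding d' by (auto dest!: in_Delta_cancel)
    have in_Delta: "\<sigma> + ?u k + ?u l \<in> Delta n d" if "k < n" "l < n" for k l
      using \<sigma> that unfolding d' by (intro add_unit_in_Delta) auto
    \<comment> \<open>As \<open>e\<close>, \<open>f\<close>, \<open>x\<close>, \<open>y\<close> are
      distinct, each coordinate of \<sigma> is unchanged after adding the units \<open>e\<close>,
      \<open>x\<close> or after adding \<open>f\<close>, \<open>y\<close>, and both sums lie in
      \<open>J\<close>. The upper bound is dual.\<close>
    have lower: "delta_minus J \<le> lkp \<sigma>"
    proof (rule le_funI)
      fix l
      consider "l \<noteq> e" "l \<noteq> x" | "l = e" | "l = x" by blast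
      then show "delta_minus J l \<le> lkp \<sigma> l"
      proof cases
        case 1
        then show ?thesis using dm [OF in_J(1), of l] by (simp add: lookup_add)
      next
        case 2
        then show ?thesis using dm [OF in_J(2), of l] False ne by (simp add: lookup_add)
      next
        case 3
        then show ?thesis using dm [OF in_J(2), of l] False ne by (simp add: lookup_add)
      qed
    qed
    have upper: "lkp (\<sigma> + ?u e + ?u f + ?u x + ?u y) \<le> delta_plus J"
    proof (rule le_funI)
      fix l
      have "lkp (\<sigma> + ?u e + ?u f + ?u x + ?u y) l \<le> lkp (\<sigma> + ?u e + ?u x) l \<or>
          lkp (\<sigma> + ?u e + ?u f + ?u x + ?u y) l \<le> lkp (\<sigma> + ?u f + ?u y) l"
        using False ne by (auto simp: lookup_add of_bool_def)
      then show "lkp (\<sigma> + ?u e + ?u f + ?u x + ?u y) l \<le> delta_plus J l"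
        using dp [OF in_J(1), of l] dp [OF in_J(2), of l] by linarith
    qed
    define p q z where "p = \<rho> (\<sigma> + ?u f + ?u x) * \<rho> (\<sigma> + ?u e + ?u y)"
      and "q = \<rho> (\<sigma> + ?u e + ?u x) * \<rho> (\<sigma> + ?u f + ?u y)"
      and "z = \<rho> (\<sigma> + ?u e + ?u f) * \<rho> (\<sigma> + ?u x + ?u y)"
    have nonneg: "p \<ge> 0" "q \<ge> 0"
      using n by (auto simp: p_def q_def in_Delta \<rho>0)
    have z: "z = 0" using \<rho>J [OF in_Delta [OF n(1,3)]] ef by (simp add: z_def)
    note three = strong_rep_three_term [OF \<rho> _ \<sigma>, where y = y, OF _ _ _ _ _ _ n(4) lower]
    have d2: "d \<ge> 2" using d' by simp
    consider "e < f" "f < x" | "e < x" "x < f" | "f < e" "e < x" | "f < x" "x < e" | "x < e" "e < f" | "x < f" "f < e"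
      using False ne by linarith
    then have "p = q"
    proof cases
      case 1
      have "inf_null [p, q, z]"
        using three [of e f x] d2 1 n upper by (simp add: p_def q_def z_def add_ac)
      then show ?thesis using inf_null_three(3) nonneg z by blast
    next
      case 2
      have "inf_null [p, z, q]"
        using three [of e x f] d2 2 n upper by (simp add: p_def q_def z_def add_ac)
      then show ?thesis using inf_null_three(2) [of p z q] nonneg z by simp
    next
      case 3
      have "inf_null [q, p, z]"
        using three [of f e x] d2 3 n upper by (simp add: p_def q_def z_def add_ac)
      then show ?thesis using inf_null_three(3) [of q p z] nonneg z by simp
    next
      case 4
      have "inf_null [q, z, p]"
        using three [of f x e] d2 4 n upper by (simp add: p_def q_def z_def add_ac)
      then show ?thesis using inf_null_three(2) [of q z p] nonneg z by simp
    next
      case 5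
      have "inf_null [z, p, q]"
        using three [of x e f] d2 5 n upper by (simp add: p_def q_def z_def add_ac)
      then show ?thesis using inf_null_three(1) [of z p q] nonneg z by simp
    next
      case 6
      have "inf_null [z, q, p]"
        using three [of x f e] d2 6 n upper by (simp add: p_def q_def z_def add_ac)
      then show ?thesis using inf_null_three(1) [of z q p] nonneg z by simp
    qed
    then have "ln p = ln q" by simp
    moreover have "\<rho> \<beta> \<noteq> 0" if "\<beta> \<in> J" for \<beta>
      using \<rho>J [of \<beta>] that J by blast
    ultimately show ?thesis using in_J by (simp add: p_def q_def ln_mult)
  qed
  show ?thesis
    unfolding W_space_def
  proof (intro CollectI conjI allI impI)
    show "?v \<beta> = 0" if "\<beta> \<notin> J" for \<beta> using that by simp
  qed (rule rel)
qed

lemma V_space_eq_W_space: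
  assumes "J \<subseteq> Delta n d" "M_convex J"
  shows "V_space n d J = W_space J"
proof
  show "V_space n d J \<subseteq> W_space J"
    unfolding V_space_def using strong_rep_W_space [OF assms] by auto
  show "W_space J \<subseteq> V_space n d J"
  proof
    fix v assume v: "v \<in> W_space J"
    have "v = (\<lambda>\<alpha>. if \<alpha> \<in> J then ln (if \<alpha> \<in> J then exp (v \<alpha>) else 0) else 0)"
      using v by (auto simp: W_space_def)
    then show "v \<in> V_space n d J"
      unfolding V_space_def mem_Collect_eq
      using W_space_strong_rep [OF assms v]
      by (intro exI [of _ "\<lambda>\<beta>. if \<beta> \<in> J then exp (v \<beta>) else 0"] conjI)
  qed
qed

section \<open>Coefficients and Hessians of polynomials\<close>

lemma expo_fact_superset:
  assumes "finite S" "supp \<alpha> \<subseteq> S"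
  shows "expo_fact \<alpha> = (\<Prod>i\<in>S. fact (lkp \<alpha> i))"
  unfolding expo_fact_def using assms
  by (intro prod.mono_neutral_left) (auto simp: in_keys_iff)

lemma expo_fact_pos: "expo_fact \<alpha> > 0"
  unfolding expo_fact_def by (intro prod_pos) simp

lemma expo_fact_add_unit: "expo_fact (\<alpha> + unit_expo i) = real (lkp \<alpha> i + 1) * expo_fact \<alpha>"
proof -
  let ?S = "insert i (supp \<alpha>)"
  have "supp (\<alpha> + unit_expo i) \<subseteq> ?S" by (auto simp: in_keys_iff lookup_add split: if_splits)
  then have "expo_fact (\<alpha> + unit_expo i) = (\<Prod>k\<in>?S. fact (lkp (\<alpha> + unit_expo i) k))"
    by (intro expo_fact_superset) auto
  also have "\<dots> = fact (lkp \<alpha> i + 1) * (\<Prod>k\<in>?S - {i}. fact (lkp (\<alpha> + unit_expo i) k))"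
    by (subst prod.remove [of _ i]) (auto simp: lookup_add)
  also have "(\<Prod>k\<in>?S - {i}. fact (lkp (\<alpha> + unit_expo i) k)) = (\<Prod>k\<in>?S - {i}. fact (lkp \<alpha> k) :: real)"
    by (intro prod.cong refl) (auto simp: lookup_add)
  also have "fact (lkp \<alpha> i + 1) * \<dots> = real (lkp \<alpha> i + 1) * (\<Prod>k\<in>?S. fact (lkp \<alpha> k))"
    by (subst prod.remove [of ?S i]) auto
  also have "(\<Prod>k\<in>?S. fact (lkp \<alpha> k) :: real) = expo_fact \<alpha>"
    by (intro expo_fact_superset [symmetric]) auto
  finally show ?thesis .
qed

text \<open>The coefficient \<open>c_\<alpha>\<close> of \<open>f = \<Sum> c_\<alpha> x^\<alpha> / \<alpha>!\<close>; partial derivatives act on these by shifting.\<close>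
definition norm_coeff :: "rpoly \<Rightarrow> expo \<Rightarrow> real"
  where "norm_coeff f \<alpha> = expo_fact \<alpha> * lkp f \<alpha>"

lemma norm_coeff_partial_deriv: "norm_coeff (partial_deriv i f) \<beta> = norm_coeff f (\<beta> + unit_expo i)"
proof -
  have "lkp (partial_deriv i f) \<beta>
      = (\<Sum>\<alpha>\<in>supp f. if \<alpha> - unit_expo i = \<beta> then real (lkp \<alpha> i) * lkp f \<alpha> else 0)"
    by (simp add: partial_deriv_def lookup_sum lookup_single when_def)
  also have "\<dots> = (\<Sum>\<alpha>\<in>supp f. if \<alpha> = \<beta> + unit_expo i then real (lkp \<alpha> i) * lkp f \<alpha> else 0)"
  proof (intro sum.cong refl)
    fix \<alpha>
    show "(if \<alpha> - unit_expo i = \<beta> then real (lkp \<alpha> i) * lkp f \<alpha> else 0)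
        = (if \<alpha> = \<beta> + unit_expo i then real (lkp \<alpha> i) * lkp f \<alpha> else 0)"
    \<comment> \<open>The difference determines \<alpha> unless the subtraction truncates, and then
      the factor \<open>lkp \<alpha> i\<close> is 0.\<close>
    proof (cases "lkp \<alpha> i = 0")
      case False
      then have "\<alpha> - unit_expo i = \<beta> \<longleftrightarrow> \<alpha> = \<beta> + unit_expo i"
        using expo_minus_unit_add [of \<alpha> i] by auto
      then show ?thesis by simp
    qed simp
  qed
  also have "\<dots> = real (lkp \<beta> i + 1) * lkp f (\<beta> + unit_expo i)"
    by (simp add: lookup_add in_keys_iff)
  finally show ?thesis by (simp add: norm_coeff_def expo_fact_add_unit)
qed

lemma norm_coeff_partial_deriv_power:
  "norm_coeff ((partial_deriv i ^^ k) f) \<beta> = norm_coeff f (\<beta> + Poly_Mapping.single i k)"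
proof (induction k arbitrary: \<beta>)
  case (Suc k)
  have "unit_expo i + Poly_Mapping.single i k = Poly_Mapping.single i (Suc k)"
    by (simp add: unit_expo_def flip: single_add)
  then show ?case by (simp add: norm_coeff_partial_deriv Suc add.assoc)
qed simp

lemma norm_coeff_multi_deriv: "norm_coeff (multi_deriv \<alpha> f) \<beta> = norm_coeff f (\<alpha> + \<beta>)"
proof -
  have "norm_coeff (fold (\<lambda>i. partial_deriv i ^^ lkp \<alpha> i) is f) \<beta>
      = norm_coeff f ((\<Sum>i\<leftarrow>is. Poly_Mapping.single i (lkp \<alpha> i)) + \<beta>)" for "is"
    by (induction "is" arbitrary: f \<beta>) (simp_all add: norm_coeff_partial_deriv_power add_ac)
  then have "norm_coeff (multi_deriv \<alpha> f) \<beta>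
      = norm_coeff f ((\<Sum>i\<leftarrow>sorted_list_of_set (supp \<alpha>). Poly_Mapping.single i (lkp \<alpha> i)) + \<beta>)"
    by (simp add: multi_deriv_def)
  also have "(\<Sum>i\<leftarrow>sorted_list_of_set (supp \<alpha>). Poly_Mapping.single i (lkp \<alpha> i))
      = (\<Sum>i\<in>supp \<alpha>. Poly_Mapping.single i (lkp \<alpha> i))"
    by (simp add: sum_list_distinct_conv_sum_set)
  also have "\<dots> = \<alpha>"
    by (intro poly_mapping_eqI) (simp add: lookup_sum lookup_single when_def in_keys_iff)
  finally show ?thesis .
qed

lemma hessian_multi_deriv:
  "hessian n (multi_deriv \<alpha> f) = mat n n (\<lambda>(i, j). norm_coeff f (\<alpha> + unit_expo i + unit_expo j))"
proof -
  have "lkp g 0 = norm_coeff g 0" for g by (simp add: norm_coeff_def expo_fact_def)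
  then show ?thesis
    by (simp add: hessian_def norm_coeff_partial_deriv norm_coeff_multi_deriv add_ac)
qed

lemma lookup_sum_single:
  "finite A \<Longrightarrow> lkp (\<Sum>\<alpha>\<in>A. Poly_Mapping.single \<alpha> (g \<alpha>)) \<beta> = (if \<beta> \<in> A then g \<beta> else 0)"
  by (simp add: lookup_sum lookup_single when_def)

lemma Lorentzian_supp_iff:
  assumes "J \<subseteq> Delta n d" "M_convex J"
  shows "f \<in> Lorentzian_supp n d J \<longleftrightarrow> supp f = J \<and> (\<forall>\<beta>. lkp f \<beta> \<ge> 0) \<and>
    (d \<ge> 2 \<longrightarrow> (\<forall>\<alpha>\<in>Delta n (d - 2).
      hyperbolic {..<n} (\<lambda>i j. norm_coeff f (\<alpha> + unit_expo i + unit_expo j))))"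
proof -
  have "at_most_one_pos_eigenvalue (hessian n (multi_deriv \<alpha> f))
      \<longleftrightarrow> hyperbolic {..<n} (\<lambda>i j. norm_coeff f (\<alpha> + unit_expo i + unit_expo j))" for \<alpha>
    unfolding hessian_multi_deriv
    by (rule at_most_one_pos_eigenvalue_iff_hyperbolic) (simp add: add_ac)
  moreover have "f \<noteq> 0" if "supp f = J" using that assms(2) by (auto simp: M_convex_def)
  ultimately show ?thesis
    using assms by (auto simp: Lorentzian_supp_def Lorentzian_def)
qed

lemma add_two_units_in_Delta:
  assumes "\<sigma> + unit_expo e + unit_expo x \<in> Delta n d"
  shows "d \<ge> 2" "\<sigma> \<in> Delta n (d - 2)" "e < n" "x < n"
proof -
  show n: "e < n" "x < n"
    using in_Delta_bound [OF assms, of e] in_Delta_bound [OF assms, of x] by (simp_all add: lookup_add)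
  show d: "d \<ge> 2"
    using assms n by (auto simp: Delta_def lookup_add sum.distrib simp del: lookup_unit_expo)
  then obtain d' where d': "d = Suc (Suc d')"
    using add_2_eq_Suc le_Suc_ex by blast
  show "\<sigma> \<in> Delta n (d - 2)" using assms unfolding d' by (auto dest!: in_Delta_cancel)
qed

definition hess :: "expo set \<Rightarrow> (expo \<Rightarrow> real) \<Rightarrow> expo \<Rightarrow> nat \<Rightarrow> nat \<Rightarrow> real"
  where "hess J v \<alpha> i j = (if \<alpha> + unit_expo i + unit_expo j \<in> J
    then exp (v (\<alpha> + unit_expo i + unit_expo j)) else 0)"

lemma hess_commute: "hess J v \<alpha> i j = hess J v \<alpha> j i"
  by (simp add: hess_def add_ac)

lemma hess_nonneg: "hess J v \<alpha> i j \<ge> 0"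
  by (simp add: hess_def)

definition log_Lorentzian :: "nat \<Rightarrow> nat \<Rightarrow> expo set \<Rightarrow> (expo \<Rightarrow> real) set"
  where "log_Lorentzian n d J =
    {v \<in> W_space J. d \<ge> 2 \<longrightarrow> (\<forall>\<alpha>\<in>Delta n (d - 2). hyperbolic {..<n} (hess J v \<alpha>))}"

text \<open>The equations of \<open>W_space J\<close> are extracted from the Hessians by
  \<open>hyperbolic_proportional\<close>. Conversely, exponentials of the entries give back a
  polynomial.\<close>

lemma log_coeffs_Lorentzian_supp:
  assumes J: "J \<subseteq> Delta n d" "M_convex J"
  shows "log_coeffs ` Lorentzian_supp n d J = log_Lorentzian n d J"
proof (intro equalityI subsetI)
  fix v assume "v \<in> log_coeffs ` Lorentzian_supp n d J"
  then obtain f where v: "v = log_coeffs f" and f: "f \<in> Lorentzian_supp n d J" by blast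
  note f = f [unfolded Lorentzian_supp_iff [OF J]]
  have hess: "hess J v \<alpha> = (\<lambda>i j. norm_coeff f (\<alpha> + unit_expo i + unit_expo j))" for \<alpha>
  proof (intro ext)
    fix i j
    let ?\<beta> = "\<alpha> + unit_expo i + unit_expo j"
    show "hess J v \<alpha> i j = norm_coeff f ?\<beta>"
    proof (cases "?\<beta> \<in> J")
      case True
      then have "lkp f ?\<beta> > 0" using f by (metis in_keys_iff order_le_less)
      then show ?thesis
        using True f expo_fact_pos [of ?\<beta>] by (simp add: hess_def v log_coeffs_def norm_coeff_def)
    next
      case False
      then have "lkp f ?\<beta> = 0" using f by (metis in_keys_iff)
      then show ?thesis using False by (simp add: hess_def norm_coeff_def)
    qed
  qed
  have "v \<in> W_space J"
    unfolding W_space_def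
  proof (intro CollectI conjI allI impI)
    show "v \<beta> = 0" if "\<beta> \<notin> J" for \<beta> using that f by (simp add: v log_coeffs_def)
    fix \<sigma> e f' x y
    assume in_J: "\<sigma> + unit_expo e + unit_expo x \<in> J" "\<sigma> + unit_expo f' + unit_expo y \<in> J"
      "\<sigma> + unit_expo f' + unit_expo x \<in> J" "\<sigma> + unit_expo e + unit_expo y \<in> J"
      and ef: "\<sigma> + unit_expo e + unit_expo f' \<notin> J"
    have \<Delta>: "\<sigma> + unit_expo e + unit_expo x \<in> Delta n d" "\<sigma> + unit_expo f' + unit_expo y \<in> Delta n d"
      using in_J J by auto
    note \<sigma> = add_two_units_in_Delta [OF \<Delta>(1)] add_two_units_in_Delta [OF \<Delta>(2)]
    \<comment> \<open>\<open>e\<close> is parallel to the non-loop \<open>f\<close>, hence to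
      itself, and likewise \<open>f\<close>; these are the zero diagonal entries required
      below.\<close>
    have ee: "\<sigma> + unit_expo e + unit_expo e \<notin> J" "\<sigma> + unit_expo f' + unit_expo f' \<notin> J"
      using M_convex_nonloop_trans [OF J(2) _ in_J(2), of e e]
        M_convex_nonloop_trans [OF J(2) _ in_J(1), of f' f'] ef by (auto simp: add_ac)
    have "hess J v \<sigma> e x * hess J v \<sigma> f' y = hess J v \<sigma> f' x * hess J v \<sigma> e y"
    proof (rule hyperbolic_proportional [of "{..<n}"])
      show "hyperbolic {..<n} (hess J v \<sigma>)" using f \<sigma> by (simp add: hess)
    qed (use \<sigma> in_J ef ee in \<open>simp_all add: hess_commute hess_nonneg, simp_all add: hess_def\<close>)
    then show "v (\<sigma> + unit_expo e + unit_expo x) + v (\<sigma> + unit_expo f' + unit_expo y)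
        = v (\<sigma> + unit_expo f' + unit_expo x) + v (\<sigma> + unit_expo e + unit_expo y)"
      using in_J by (simp add: hess_def flip: exp_add)
  qed
  then show "v \<in> log_Lorentzian n d J" using f by (simp add: log_Lorentzian_def hess)
next
  fix v assume v: "v \<in> log_Lorentzian n d J"
  have fin: "finite J" using J finite_Delta finite_subset by blast
  define f where "f = (\<Sum>\<beta>\<in>J. Poly_Mapping.single \<beta> (exp (v \<beta>) / expo_fact \<beta>))"
  have lkp: "lkp f \<beta> = (if \<beta> \<in> J then exp (v \<beta>) / expo_fact \<beta> else 0)" for \<beta>
    unfolding f_def by (rule lookup_sum_single [OF fin])
  have nz: "expo_fact \<beta> \<noteq> 0" for \<beta> using expo_fact_pos [of \<beta>] by simp
  have supp: "supp f = J" by (auto simp: in_keys_iff lkp nz split: if_splits)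
  have "(\<lambda>i j. norm_coeff f (\<alpha> + unit_expo i + unit_expo j)) = hess J v \<alpha>" for \<alpha>
    by (intro ext) (simp add: norm_coeff_def lkp hess_def nz)
  then have "f \<in> Lorentzian_supp n d J"
    unfolding Lorentzian_supp_iff [OF J] using v supp
    by (simp add: log_Lorentzian_def lkp less_imp_le [OF expo_fact_pos])
  moreover have "log_coeffs f = v"
    using v by (auto simp: log_coeffs_def supp lkp nz log_Lorentzian_def W_space_def)
  ultimately show "v \<in> log_coeffs ` Lorentzian_supp n d J" by blast
qed

lemma log_coeffs_N_op_gen_poly:
  assumes "finite J"
  shows "log_coeffs (N_op t (gen_poly J)) = (\<lambda>\<beta>. if \<beta> \<in> J then - t * ln (expo_fact \<beta>) else 0)"
proof -
  have nz: "expo_fact \<beta> \<noteq> 0" for \<beta> using expo_fact_pos [of \<beta>] by simp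
  have gen: "lkp (gen_poly J) \<beta> = (if \<beta> \<in> J then 1 / expo_fact \<beta> else 0)" for \<beta>
    unfolding gen_poly_def by (rule lookup_sum_single [OF assms])
  have supp: "supp (gen_poly J) = J" by (auto simp: in_keys_iff gen nz split: if_splits)
  have N: "lkp (N_op t (gen_poly J)) \<beta> = (if \<beta> \<in> J then 1 / expo_fact \<beta> / expo_fact \<beta> powr t else 0)" for \<beta>
    unfolding N_op_def supp by (simp add: lookup_sum_single [OF assms] gen)
  have "supp (N_op t (gen_poly J)) = J" by (auto simp: in_keys_iff N nz split: if_splits)
  then show ?thesis
    using expo_fact_pos by (auto simp: log_coeffs_def N nz ln_div ln_powr)
qed

section \<open>The space of logarithms of Lorentzian polynomials\<close>

lemma subspace_W_space: "Real_Vector_Spaces.subspace (W_space J)"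
proof -
  have "0 \<in> W_space J" by (simp add: W_space_def)
  moreover have "v + w \<in> W_space J" if "v \<in> W_space J" "w \<in> W_space J" for v w
  proof -
    have "v (\<sigma> + unit_expo e + unit_expo x) + w (\<sigma> + unit_expo e + unit_expo x)
          + (v (\<sigma> + unit_expo f + unit_expo y) + w (\<sigma> + unit_expo f + unit_expo y))
        = v (\<sigma> + unit_expo f + unit_expo x) + w (\<sigma> + unit_expo f + unit_expo x)
          + (v (\<sigma> + unit_expo e + unit_expo y) + w (\<sigma> + unit_expo e + unit_expo y))"
      if "\<sigma> + unit_expo e + unit_expo x \<in> J" "\<sigma> + unit_expo f + unit_expo y \<in> J"
        "\<sigma> + unit_expo f + unit_expo x \<in> J" "\<sigma> + unit_expo e + unit_expo y \<in> J"
        "\<sigma> + unit_expo e + unit_expo f \<notin> J" for \<sigma> e f x y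
      using W_space_eq [OF \<open>v \<in> _\<close> that] W_space_eq [OF \<open>w \<in> _\<close> that] by linarith
    then show ?thesis using that unfolding W_space_def by auto
  qed
  moreover have "c *\<^sub>R v \<in> W_space J" if "v \<in> W_space J" for c v
  proof -
    have "c * v (\<sigma> + unit_expo e + unit_expo x) + c * v (\<sigma> + unit_expo f + unit_expo y)
        = c * v (\<sigma> + unit_expo f + unit_expo x) + c * v (\<sigma> + unit_expo e + unit_expo y)"
      if "\<sigma> + unit_expo e + unit_expo x \<in> J" "\<sigma> + unit_expo f + unit_expo y \<in> J"
        "\<sigma> + unit_expo f + unit_expo x \<in> J" "\<sigma> + unit_expo e + unit_expo y \<in> J"
        "\<sigma> + unit_expo e + unit_expo f \<notin> J" for \<sigma> e f x y
      using W_space_eq [OF \<open>v \<in> _\<close> that] by (simp flip: distrib_left)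
    then show ?thesis using that unfolding W_space_def by (auto simp: scaleR_fun_def)
  qed
  ultimately show ?thesis by (simp add: real_vector.subspace_def)
qed

text \<open>Coordinate vectors need not lie in \<open>W_space J\<close>; they serve to bound the
  size of a basis chosen inside it.\<close>

lemma finite_spanning_set_W_space:
  assumes "finite J"
  shows "\<exists>B. finite B \<and> W_space J = Real_Vector_Spaces.span B"
proof -
  let ?b = "\<lambda>\<beta> \<alpha> :: expo. of_bool (\<alpha> = \<beta>) :: real"
  have eval: "(\<Sum>\<beta>\<in>A. h \<beta>) \<alpha> = (\<Sum>\<beta>\<in>A. h \<beta> \<alpha>)" for A :: "expo set" and h :: "expo \<Rightarrow> expo \<Rightarrow> real" and \<alpha>
    by (induction A rule: infinite_finite_induct) auto
  have sub: "W_space J \<subseteq> Real_Vector_Spaces.span (?b ` J)"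
  proof
    fix v assume v: "v \<in> W_space J"
    have "v = (\<Sum>\<beta>\<in>J. v \<beta> *\<^sub>R ?b \<beta>)"
    proof
      fix \<alpha>
      have "(\<Sum>\<beta>\<in>J. v \<beta> *\<^sub>R ?b \<beta>) \<alpha> = (\<Sum>\<beta>\<in>J. if \<beta> = \<alpha> then v \<beta> else 0)"
        unfolding eval by (intro sum.cong refl) (simp add: scaleR_fun_def)
      also have "\<dots> = v \<alpha>" using v assms by (simp add: W_space_def)
      finally show "v \<alpha> = (\<Sum>\<beta>\<in>J. v \<beta> *\<^sub>R ?b \<beta>) \<alpha>" by simp
    qed
    also have "\<dots> \<in> Real_Vector_Spaces.span (?b ` J)" by (intro real_vector.span_sum real_vector.span_scale real_vector.span_base) simp
    finally show "v \<in> Real_Vector_Spaces.span (?b ` J)" .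
  qed
  obtain B where B: "B \<subseteq> W_space J" "Real_Vector_Spaces.independent B" "W_space J \<subseteq> Real_Vector_Spaces.span B"
    using real_vector.basis_exists by metis
  have "B \<subseteq> Real_Vector_Spaces.span (?b ` J)" using B sub by blast
  then have "finite B" using real_vector.independent_span_bound [OF _ B(2)] assms by blast
  moreover have "W_space J = Real_Vector_Spaces.span B"
    using B real_vector.span_minimal [OF B(1) subspace_W_space] by blast
  ultimately show ?thesis by blast
qed

text \<open>As \<open>i\<close> is parallel to the non-loop \<open>r\<close>, transitivity gives
  both rows the same support, and there the equations of \<open>W_space J\<close> fix their ratio,
  read off at column \<open>k\<close>.\<close>

lemma hess_row_proportional:
  assumes "M_convex J" "v \<in> W_space J"
    and ik: "\<alpha> + unit_expo i + unit_expo k \<in> J" and rl: "\<alpha> + unit_expo r + unit_expo l \<in> J"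
    and ir: "\<alpha> + unit_expo i + unit_expo r \<notin> J"
  shows "hess J v \<alpha> i j = hess J v \<alpha> i k / hess J v \<alpha> r k * hess J v \<alpha> r j"
proof -
  let ?u = unit_expo
  have rk: "\<alpha> + ?u r + ?u k \<in> J" using M_convex_nonloop_trans [OF assms(1) ik rl] ir by simp
  show ?thesis
  proof (cases "\<alpha> + ?u i + ?u j \<in> J")
    case True
    then have rj: "\<alpha> + ?u r + ?u j \<in> J"
      using M_convex_nonloop_trans [OF assms(1) True rl] ir by simp
    have "v (\<alpha> + ?u i + ?u k) + v (\<alpha> + ?u r + ?u j) = v (\<alpha> + ?u r + ?u k) + v (\<alpha> + ?u i + ?u j)"
      by (rule W_space_eq [OF assms(2) ik rj rk True ir])
    then have "v (\<alpha> + ?u i + ?u j) = v (\<alpha> + ?u i + ?u k) - v (\<alpha> + ?u r + ?u k) + v (\<alpha> + ?u r + ?u j)"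
      by simp
    then show ?thesis using True ik rk rj by (simp add: hess_def exp_add exp_diff)
  next
    case False
    then have "\<alpha> + ?u r + ?u j \<notin> J"
      using M_convex_nonloop_trans [OF assms(1) _ ik, of r j] ir by (auto simp: add_ac)
    then show ?thesis using False by (simp add: hess_def)
  qed
qed

text \<open>A maximal set of pairwise nonparallel elements of the quadratic support at \<open>\<alpha>\<close>; it carries all
  the information about the signature of the Hessian.\<close>
lemma hess_representatives:
  assumes J: "M_convex J"
  obtains R where "R \<subseteq> {..<n}" "\<And>i j. i \<in> R \<Longrightarrow> j \<in> R \<Longrightarrow> i \<noteq> j \<Longrightarrow> \<alpha> + unit_expo i + unit_expo j \<in> J"
    "\<And>v. v \<in> W_space J \<Longrightarrow> hyperbolic R (hess J v \<alpha>) \<Longrightarrow> hyperbolic {..<n} (hess J v \<alpha>)"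
proof -
  let ?u = unit_expo
  define nonloop where "nonloop = (\<lambda>i. \<exists>k. \<alpha> + ?u i + ?u k \<in> J)"
  define \<C> where "\<C> = {R. R \<subseteq> {..<n} \<and> (\<forall>i\<in>R. nonloop i) \<and> (\<forall>i\<in>R. \<forall>j\<in>R. i \<noteq> j \<longrightarrow> \<alpha> + ?u i + ?u j \<in> J)}"
  have "finite \<C>" unfolding \<C>_def by (rule finite_subset [of _ "Pow {..<n}"]) auto
  moreover have "{} \<in> \<C>" by (simp add: \<C>_def)
  ultimately obtain R where R: "R \<in> \<C>" and max: "\<And>S. S \<in> \<C> \<Longrightarrow> R \<subseteq> S \<Longrightarrow> R = S"
    using finite_has_maximal [of \<C>] by (metis empty_iff)
  have fin: "finite R" using R finite_subset by (auto simp: \<C>_def)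
  have rep: "\<exists>r\<in>R. \<alpha> + ?u i + ?u r \<notin> J" if "i < n" "nonloop i" "i \<notin> R" for i
  proof (rule ccontr)
    assume "\<not> ?thesis"
    then have "insert i R \<in> \<C>" using R that by (auto simp: \<C>_def add_ac)
    then show False using max [of "insert i R"] that(3) by blast
  qed
  have "hyperbolic {..<n} (hess J v \<alpha>)" if v: "v \<in> W_space J" and hyp: "hyperbolic R (hess J v \<alpha>)" for v
  proof -
    \<comment> \<open>Zero rows get \<open>l = 0\<close>, members of \<open>R\<close> represent
      themselves, and any other index is parallel to a member by maximality.\<close>
    have "\<exists>l r. (l \<noteq> 0 \<longrightarrow> r \<in> R) \<and> (\<forall>j. hess J v \<alpha> i j = l * hess J v \<alpha> r j)" if i: "i < n" for i
    proof (cases "nonloop i")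
      case False
      then show ?thesis by (intro exI [of _ 0]) (simp add: nonloop_def hess_def)
    next
      case True
      show ?thesis
      proof (cases "i \<in> R")
        case True
        then show ?thesis by (intro exI [of _ 1] exI [of _ i]) simp
      next
        case False
        obtain k where k: "\<alpha> + ?u i + ?u k \<in> J" using True by (auto simp: nonloop_def)
        obtain r where r: "r \<in> R" "\<alpha> + ?u i + ?u r \<notin> J" using rep [OF i True False] by blast
        then obtain l where "\<alpha> + ?u r + ?u l \<in> J" using R by (auto simp: \<C>_def nonloop_def)
        from hess_row_proportional [OF J v k this r(2)] r(1) show ?thesis by blast
      qed
    qed
    then obtain l r where lr: "\<And>i. i < n \<Longrightarrow> l i \<noteq> 0 \<Longrightarrow> r i \<in> R"
        "\<And>i j. i < n \<Longrightarrow> hess J v \<alpha> i j = l i * hess J v \<alpha> (r i) j"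
      by metis
    show ?thesis
    proof (rule hyperbolic_pullback [OF _ fin _ _ hyp])
      fix i j assume ij: "i \<in> {..<n}" "j \<in> {..<n}"
      have "hess J v \<alpha> i j = l i * hess J v \<alpha> j (r i)"
        using lr(2) [of i j] ij by (simp add: hess_commute)
      also have "\<dots> = l i * l j * hess J v \<alpha> (r i) (r j)"
        using lr(2) [of j "r i"] ij by (simp add: hess_commute)
      finally show "hess J v \<alpha> i j = l i * l j * hess J v \<alpha> (r i) (r j)" .
    qed (use lr(1) in auto)
  qed
  then show ?thesis using R by (intro that [of R]) (auto simp: \<C>_def)
qed

section \<open>Closedness and interior points\<close>

lemma continuous_on_hess: "continuous_on UNIV (\<lambda>v. hess J v \<alpha> i j)"
  unfolding hess_def
  by (cases "\<alpha> + unit_expo i + unit_expo j \<in> J")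
    (auto intro!: continuous_intros continuous_on_product_coordinates)

lemma closedin_log_Lorentzian: "closedin (top_of_set (W_space J)) (log_Lorentzian n d J)"
proof -
  define C where "C = {v. \<forall>\<alpha>\<in>Delta n (d - 2). d \<ge> 2 \<longrightarrow> (\<forall>x.
    bil_form {..<n} (hess J v \<alpha>) x x * bil_form {..<n} (hess J v \<alpha>) (\<lambda>_. 1) (\<lambda>_. 1)
      \<le> (bil_form {..<n} (hess J v \<alpha>) x (\<lambda>_. 1))\<^sup>2)}"
  have cont: "continuous_on UNIV (\<lambda>v. bil_form {..<n} (hess J v \<alpha>) x y)" for \<alpha> x y
    unfolding bil_form_def by (intro continuous_intros continuous_on_hess)
  have "closed C"
    unfolding C_def Ball_def
    by (intro closed_Collect_all closed_Collect_imp closed_Collect_le open_Collect_const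
        continuous_intros cont)
  moreover have "log_Lorentzian n d J = W_space J \<inter> C"
    unfolding log_Lorentzian_def C_def
    by (auto simp: hyperbolic_iff_closed_condition hess_commute hess_nonneg)
  ultimately show ?thesis by (simp add: closedin_closed_Int)
qed

text \<open>Hyperbolicity on representatives persists nearby and, inside \<open>W_space J\<close>,
  decides the whole Hessian; the neighbourhoods are intersected over finitely many \<alpha>.
  Strictness is asked for every pairwise nonparallel \<open>R\<close>, so no choice of
  representatives enters the statement.\<close>

lemma interior_log_Lorentzian:
  assumes J: "M_convex J" and y: "y \<in> W_space J"
    and strict: "\<And>\<alpha> R. d \<ge> 2 \<Longrightarrow> \<alpha> \<in> Delta n (d - 2) \<Longrightarrow> R \<subseteq> {..<n} \<Longrightarrow>
      (\<And>i j. i \<in> R \<Longrightarrow> j \<in> R \<Longrightarrow> i \<noteq> j \<Longrightarrow> \<alpha> + unit_expo i + unit_expo j \<in> J) \<Longrightarrow>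
      strictly_hyperbolic R (hess J y \<alpha>)"
  shows "y \<in> (top_of_set (W_space J)) interior_of (log_Lorentzian n d J)"
proof -
  have "\<exists>U. open U \<and> y \<in> U \<and> (\<forall>v\<in>U \<inter> W_space J. hyperbolic {..<n} (hess J v \<alpha>))"
    if d: "d \<ge> 2" and \<alpha>: "\<alpha> \<in> Delta n (d - 2)" for \<alpha>
  proof -
    obtain R where R: "R \<subseteq> {..<n}"
        "\<And>i j. i \<in> R \<Longrightarrow> j \<in> R \<Longrightarrow> i \<noteq> j \<Longrightarrow> \<alpha> + unit_expo i + unit_expo j \<in> J"
      and hyp: "\<And>v. v \<in> W_space J \<Longrightarrow> hyperbolic R (hess J v \<alpha>) \<Longrightarrow> hyperbolic {..<n} (hess J v \<alpha>)"
      using hess_representatives [OF J] by metis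
    have fin: "finite R" using R(1) finite_subset by blast
    have sh: "strictly_hyperbolic R (hess J y \<alpha>)" using R by (intro strict [OF d \<alpha>]) auto
    obtain \<epsilon> where \<epsilon>: "\<epsilon> > 0"
      "\<And>P. (\<And>i j. i \<in> R \<Longrightarrow> j \<in> R \<Longrightarrow> \<bar>P i j - hess J y \<alpha> i j\<bar> \<le> \<epsilon>) \<Longrightarrow> hyperbolic R P"
      using strictly_hyperbolic_open [OF fin sh] by blast
    define U where "U = (\<Inter>i\<in>R. \<Inter>j\<in>R. {v. \<bar>hess J v \<alpha> i j - hess J y \<alpha> i j\<bar> < \<epsilon>})"
    have "open U"
      unfolding U_def using fin
      by (intro open_INT ballI open_Collect_less continuous_intros continuous_on_hess)
    moreover have "y \<in> U" using \<epsilon>(1) by (simp add: U_def)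
    moreover have "hyperbolic {..<n} (hess J v \<alpha>)" if "v \<in> U \<inter> W_space J" for v
      using that by (intro hyp \<epsilon>(2)) (auto simp: U_def less_imp_le)
    ultimately show ?thesis by blast
  qed
  then obtain U where U: "\<And>\<alpha>. d \<ge> 2 \<Longrightarrow> \<alpha> \<in> Delta n (d - 2) \<Longrightarrow> open (U \<alpha>) \<and> y \<in> U \<alpha> \<and>
      (\<forall>v\<in>U \<alpha> \<inter> W_space J. hyperbolic {..<n} (hess J v \<alpha>))"
    by metis
  define T where "T = (if d \<ge> 2 then \<Inter>\<alpha>\<in>Delta n (d - 2). U \<alpha> else UNIV)"
  have "open T" using U finite_Delta by (auto simp: T_def intro!: open_INT)
  then have "openin (top_of_set (W_space J)) (W_space J \<inter> T)" by (rule openin_open_Int)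
  moreover have "y \<in> W_space J \<inter> T" using y U by (simp add: T_def)
  moreover have "W_space J \<inter> T \<subseteq> log_Lorentzian n d J"
    using U by (auto simp: log_Lorentzian_def T_def)
  ultimately show ?thesis unfolding interior_of_def by blast
qed

text \<open>For distinct \<open>a\<close>, \<open>b\<close> the logarithm of the factorial splits
  into a term in \<open>a\<close>, a term in \<open>b\<close> and a constant; parallelism of
  \<open>e\<close>, \<open>f\<close> keeps them distinct from \<open>x\<close>,
  \<open>y\<close>.\<close>

lemma ln_expo_fact_in_W_space:
  "(\<lambda>\<beta>. if \<beta> \<in> J then c * ln (expo_fact \<beta>) else 0) \<in> W_space J"
  unfolding W_space_def
proof (intro CollectI conjI allI impI)
  let ?u = unit_expo
  fix \<sigma> e f x y
  assume in_J: "\<sigma> + ?u e + ?u x \<in> J" "\<sigma> + ?u f + ?u y \<in> J" "\<sigma> + ?u f + ?u x \<in> J" "\<sigma> + ?u e + ?u y \<in> J"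
    and ef: "\<sigma> + ?u e + ?u f \<notin> J"
  have ne: "e \<noteq> x" "e \<noteq> y" "f \<noteq> x" "f \<noteq> y" using in_J ef by (auto simp: add_ac)
  have "ln (expo_fact (\<sigma> + ?u a + ?u b))
      = ln (real (lkp \<sigma> a + 1)) + ln (real (lkp \<sigma> b + 1)) + ln (expo_fact \<sigma>)" if "a \<noteq> b" for a b
    using that expo_fact_pos [of \<sigma>]
    by (simp add: expo_fact_add_unit lookup_add ln_mult del: of_nat_Suc of_nat_add)
  then show "(if \<sigma> + ?u e + ?u x \<in> J then c * ln (expo_fact (\<sigma> + ?u e + ?u x)) else 0) +
      (if \<sigma> + ?u f + ?u y \<in> J then c * ln (expo_fact (\<sigma> + ?u f + ?u y)) else 0)
      = (if \<sigma> + ?u f + ?u x \<in> J then c * ln (expo_fact (\<sigma> + ?u f + ?u x)) else 0) +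
      (if \<sigma> + ?u e + ?u y \<in> J then c * ln (expo_fact (\<sigma> + ?u e + ?u y)) else 0)"
    using ne in_J by (simp add: algebra_simps)
qed simp

text \<open>Rescaling the Hessian by \<open>(\<alpha>\<^sub>i + 1)^\<tau>\<close> turns the factors \<open>(\<beta>!)^(-\<tau>)\<close> into 1 off the diagonal and
  into \<open>((\<alpha>\<^sub>i + 1) / (\<alpha>\<^sub>i + 2))^\<tau> < 1\<close> on the diagonal.\<close>
lemma hess_strictly_hyperbolic:
  assumes \<tau>: "\<tau> > 0" and fin: "finite R"
    and R: "\<And>i j. i \<in> R \<Longrightarrow> j \<in> R \<Longrightarrow> i \<noteq> j \<Longrightarrow> \<alpha> + unit_expo i + unit_expo j \<in> J"
    and \<theta>: "\<theta> = 0 \<or> 0 < \<theta> \<and> \<theta> < 1 \<and> hyperbolic R (hess J w \<alpha>)"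
    and y: "\<And>\<beta>. \<beta> \<in> J \<Longrightarrow> y \<beta> = \<theta> * w \<beta> - \<tau> * ln (expo_fact \<beta>)"
  shows "strictly_hyperbolic R (hess J y \<alpha>)"
proof -
  let ?u = unit_expo
  define c where "c = expo_fact \<alpha> powr - \<tau>"
  define s where "s = (\<lambda>i. real (lkp \<alpha> i + 1) powr - \<tau>)"
  have c: "c > 0" using expo_fact_pos [of \<alpha>] by (simp add: c_def)
  have s: "s i > 0" for i by (simp add: s_def)
  define P where "P = (\<lambda>i j. hess J y \<alpha> i j / (c * s i * s j))"
  \<comment> \<open>True also for zero entries at \<theta> = 0, since
    \<open>0 powr 0 = 0\<close>.\<close>
  have hess_y: "hess J y \<alpha> i j = hess J w \<alpha> i j powr \<theta> * expo_fact (\<alpha> + ?u i + ?u j) powr - \<tau>" for i j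
    using expo_fact_pos [of "\<alpha> + ?u i + ?u j"]
    by (simp add: hess_def y powr_def exp_diff exp_minus divide_inverse exp_add)
  have off: "P i j = hess J w \<alpha> i j powr \<theta>" if "i \<noteq> j" for i j
  proof -
    have "expo_fact (\<alpha> + ?u i + ?u j) powr - \<tau> = c * s i * s j"
      using that expo_fact_pos [of \<alpha>]
      by (simp add: expo_fact_add_unit lookup_add c_def s_def powr_mult mult_ac del: of_nat_Suc of_nat_add)
    then show ?thesis using c s [of i] s [of j] by (simp add: P_def hess_y)
  qed
  define \<kappa> where "\<kappa> = (\<lambda>i. real (lkp \<alpha> i + 2) powr - \<tau> / s i)"
  have \<kappa>: "\<kappa> i < 1" for i
  proof -
    have "real (lkp \<alpha> i + 2) powr - \<tau> < s i"
      unfolding s_def using \<tau> by (intro powr_less_mono2_neg) auto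
    then show ?thesis using s [of i] by (simp add: \<kappa>_def)
  qed
  have diag: "P i i = \<kappa> i * hess J w \<alpha> i i powr \<theta>" for i
  proof -
    have "expo_fact (\<alpha> + ?u i + ?u i) = real (lkp \<alpha> i + 2) * real (lkp \<alpha> i + 1) * expo_fact \<alpha>"
      by (simp add: expo_fact_add_unit lookup_add)
    then have "expo_fact (\<alpha> + ?u i + ?u i) powr - \<tau> = real (lkp \<alpha> i + 2) powr - \<tau> * s i * c"
      using expo_fact_pos [of \<alpha>] by (simp add: c_def s_def powr_mult del: of_nat_Suc of_nat_add)
    then show ?thesis using c s [of i] by (simp add: P_def hess_y \<kappa>_def field_simps)
  qed
  have "strictly_hyperbolic R P"
  proof (rule strictly_hyperbolic_powr [OF fin, where Q = "hess J w \<alpha>" and \<theta> = \<theta>])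
    show "hess J w \<alpha> i j > 0" if "i \<in> R" "j \<in> R" "i \<noteq> j" for i j
      using R [OF that] by (simp add: hess_def)
    show "P i i \<le> hess J w \<alpha> i i powr \<theta>" for i
      unfolding diag using \<kappa> [of i] by (intro mult_left_le_one_le) (auto simp: \<kappa>_def s_def)
    show "P i i < hess J w \<alpha> i i powr \<theta>" if "hess J w \<alpha> i i > 0" for i
      unfolding diag using \<kappa> [of i] that by simp
  qed (use \<theta> off in \<open>simp_all add: hess_commute hess_nonneg\<close>)
  then show ?thesis
  proof (rule strictly_hyperbolic_scale [where c = c and s = s])
    show "hess J y \<alpha> i j = c * s i * s j * P i j" for i j
      using c s [of i] s [of j] by (simp add: P_def)
  qed (use c s in auto)
qed

theorem theorem4p16:
  fixes t :: real and n d :: nat and J :: "expo set"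
  assumes "t > 0" and "J \<subseteq> Delta n d" and "M_convex J"
  shows "strongly_star_shaped (log_coeffs (N_op t (gen_poly J)))
           (log_coeffs ` Lorentzian_supp n d J) (V_space n d J)"
proof -
  have fin: "finite J" using assms finite_Delta finite_subset by blast
  let ?X = "log_Lorentzian n d J" and ?W = "W_space J"
  define x\<^sub>0 where "x\<^sub>0 = (\<lambda>\<beta>. if \<beta> \<in> J then - t * ln (expo_fact \<beta>) else 0)"
  have x0W: "x\<^sub>0 \<in> ?W" unfolding x\<^sub>0_def by (rule ln_expo_fact_in_W_space)
  \<comment> \<open>\<theta> = 0 is allowed for every \<open>x\<close> of the space, so that the
    centre can be proved a member by this very claim.\<close>
  have star: "x\<^sub>0 + \<theta> *\<^sub>R (x - x\<^sub>0) \<in> (top_of_set ?W) interior_of ?X"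
    if x: "x \<in> ?W" "\<theta> \<in> {0..<1}" "\<theta> = 0 \<or> x \<in> ?X" for x \<theta>
  proof (rule interior_log_Lorentzian [OF assms(3)])
    show "x\<^sub>0 + \<theta> *\<^sub>R (x - x\<^sub>0) \<in> ?W"
      by (intro real_vector.subspace_add real_vector.subspace_scale real_vector.subspace_diff subspace_W_space x0W x)
    fix \<alpha> R
    assume d: "d \<ge> 2" "\<alpha> \<in> Delta n (d - 2)" and R: "R \<subseteq> {..<n}"
      "\<And>i j. i \<in> R \<Longrightarrow> j \<in> R \<Longrightarrow> i \<noteq> j \<Longrightarrow> \<alpha> + unit_expo i + unit_expo j \<in> J"
    show "strictly_hyperbolic R (hess J (x\<^sub>0 + \<theta> *\<^sub>R (x - x\<^sub>0)) \<alpha>)"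
    \<comment> \<open>The point is \<theta> times \<open>x\<close> plus 1 - \<theta> times
      \<open>x\<^sub>0\<close>; the second part contributes this \<tau>, positive because \<theta> <
      1.\<close>
    proof (rule hess_strictly_hyperbolic [where w = x and \<theta> = \<theta> and \<tau> = "t * (1 - \<theta>)"])
      show "\<theta> = 0 \<or> 0 < \<theta> \<and> \<theta> < 1 \<and> hyperbolic R (hess J x \<alpha>)"
      proof (cases "\<theta> = 0")
        case False
        then have "hyperbolic {..<n} (hess J x \<alpha>)" using x(3) d by (simp add: log_Lorentzian_def)
        then have "hyperbolic R (hess J x \<alpha>)" using hyperbolic_subset R(1) by blast
        then show ?thesis using x(2) by auto
      qed simp
      show "(x\<^sub>0 + \<theta> *\<^sub>R (x - x\<^sub>0)) \<beta> = \<theta> * x \<beta> - t * (1 - \<theta>) * ln (expo_fact \<beta>)" if "\<beta> \<in> J" for \<beta>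
        using that by (simp add: x\<^sub>0_def scaleR_fun_def algebra_simps)
    qed (use assms x(2) R finite_subset [OF R(1)] in auto)
  qed
  have "x\<^sub>0 \<in> ?X"
    using star [of x\<^sub>0 0] x0W interior_of_subset [of "top_of_set ?W" ?X] by auto
  moreover have "?X \<subseteq> ?W" by (auto simp: log_Lorentzian_def)
  ultimately have "strongly_star_shaped x\<^sub>0 ?X ?W"
    unfolding strongly_star_shaped_def
    using subspace_W_space finite_spanning_set_W_space [OF fin] closedin_log_Lorentzian star by blast
  then show ?thesis
    unfolding log_coeffs_N_op_gen_poly [OF fin] log_coeffs_Lorentzian_supp [OF assms(2,3)]
      V_space_eq_W_space [OF assms(2,3)] x\<^sub>0_def .
qed

end
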